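(* Let $n\ge 1$, let $l>1$ be an odd integer, let $\varepsilon\in\mathbf C$ be a primitive $l$-th root of unity, and let $\lambda=(\lambda_1,\dots,\lambda_n)$ with $\lambda_i\in\{0,1,\dots,l-1\}$. Let $r,s\in(\mathbf C^\times)^n$ and $a,b\in(\mathbf C^\times)^{n(n+1)/2}$ be parameters satisfying $$a_{i,k}a_{i,k+1}\cdots a_{i,n}=1,\qquad r_i\,b_{i,k}b_{i,k-1}b_{i-1,k-1}^{-1}b_{i+1,k}^{-1}=1\qquad(1\le i\le k\le n),$$ $$\frac{r_i}{s_i}\,b_{i,n}^2b_{i-1,n}^{-1}b_{i+1,n}^{-1}=\varepsilon^{\lambda_i}\qquad(1\le i\le n).$$ Consider the $U_\varepsilon$-module $\mathcal V=(\Phi_{r,s,a,b},\mathcal V)$ and its $U_\varepsilon$-submodule $L(\lambda):=U_\varepsilon u_{\vec 0}$, where $u_{\vec 0}$ is the basis vector indexed by $\vec 0=(0,\dots,0)$. Then: (i) If the actions of $e_\alpha$ and $f_\alpha$ ($\alpha\in\Delta_+$) on $\mathcal V$ are defined recursively from those of $e_i,f_i$ by $$e_{\alpha+\alpha_i}=\varepsilon^{-1}e_ie_\alpha-e_\alpha e_i,\qquad f_{\alpha+\alpha_i}=\varepsilon f_\alpha f_i-f_if_\alpha\qquad\text{whenever }(\alpha_i,\alpha)=-1\text{ and }i<g(\alpha),$$ then $\mathcal V$ becomes a $U^{\rm fin}_\varepsilon$-module. (ii) The subspace $L(\lambda)$ is an irreducible $U^{\rm fin}_\varepsilon$-submodule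 of $\mathcal V$.
   Context: Notation. $I=\{1,\dots,n\}$; $(a_{ij})$ is the Cartan matrix of type $A_n$ (the integers $a_{ij}$ with $i,j\in I$ as Cartan entries occur only in the relations of the algebras below; otherwise $a=(a_{ij})_{1\le i\le j\le n}$ is a parameter). $\alpha_1,\dots,\alpha_n$ are the simple roots, $\Delta_+=\{\alpha_j+\alpha_{j+1}+\cdots+\alpha_k: 1\le j\le k\le n\}$ the positive roots, $(\cdot,\cdot)$ the invariant form with $(\alpha_i,\alpha_j)$ equal to the Cartan entry. For $\alpha=\sum_i c_i\alpha_i\in\Delta_+$, $g(\alpha)$ is the largest index $i$ with $c_i\neq 0$. $[a]=(\varepsilon^a-\varepsilon^{-a})/(\varepsilon-\varepsilon^{-1})$. The algebra $U_\varepsilon$ (non-restricted specialization of $U_q(\mathfrak{sl}_{n+1})$) is the associative $\mathbf C$-algebra with generators $e_i,f_i,t_i^{\pm1}$ ($i\in I$) and relations $t_it_i^{-1}=t_i^{-1}t_i=1$, $t_it_j=t_jt_i$, $t_ie_jt_i^{-1}=\varepsilon^{a_{ij}}e_j$, $t_if_jt_i^{-1}=\varepsilon^{-a_{ij}}f_j$ ($a_{ij}$ Cartan entries), $e_if_j-f_je_i=\delta_{ij}(t_i-t_i^{-1})/(\varepsilon-\varepsilon^{-1})$, and the quantum Serre relations: $e_ie_j=e_je_i$ and $f_if_j=f_jf_i$ if $|i-j|\ge2$; $e_i^2e_j-[2]e_ie_je_i+e_je_i^2=0$ and $f_i^2f_j-[2]f_if_jf_i+f_jf_i^2=0$ if $|i-j|=1$.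 The algebra $U^{\rm fin}_\varepsilon$ is the subalgebra generated by $e_i,f_i,t_i^{\pm1}$ ($i\in I$) of the restricted (Lusztig) specialization $U^{\rm res}_\varepsilon$ of $U_q(\mathfrak{sl}_{n+1})$ at $q=\varepsilon$. It is known (and may be taken as the definition) that it is the associative $\mathbf C$-algebra with generators $e_\alpha,f_\alpha$ ($\alpha\in\Delta_+$), $t_i^{\pm1}$ ($i\in I$), where $e_i:=e_{\alpha_i}$, $f_i:=f_{\alpha_i}$, and relations: the relations of $U_\varepsilon$ listed above other than the Serre relations; if $(\alpha_i,\alpha)=0$ and $i<g(\alpha)$: $e_ie_\alpha=e_\alpha e_i$, $f_if_\alpha=f_\alpha f_i$; if $(\alpha_i,\alpha)=-1$ and $i<g(\alpha)$: $e_{\alpha+\alpha_i}=\varepsilon^{-1}e_ie_\alpha-e_\alpha e_i$, $\varepsilon e_ie_{\alpha+\alpha_i}=e_{\alpha+\alpha_i}e_i$, $\varepsilon e_{\alpha+\alpha_i}e_\alpha=e_\alpha e_{\alpha+\alpha_i}$, $f_{\alpha+\alpha_i}=\varepsilon f_\alpha f_i-f_if_\alpha$, $\varepsilon f_if_{\alpha+\alpha_i}=f_{\alpha+\alpha_i}f_i$, $\varepsilon f_{\alpha+\alpha_i}f_\alpha=f_\alpha f_{\alpha+\alpha_i}$; and $e_\alpha^l=f_\alpha^l=0$ for all $\alpha\in\Delta_+$, $t_i^{2l}=1$ for all $i\in I$. The representation $\Phi_{r,s,a,b}$ (maximal cyclic representation of Date–Jimbo–Miki–Miwa). Let $M=(\mathbf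 Z/l\mathbf Z)^{n(n+1)/2}$, with elements $\mathbf m=(m_{jk})_{1\le j\le k\le n}$, and let $\mathcal V=\bigotimes_{1\le j\le k\le n}\mathbf C^l$ with basis $u_{\mathbf m}$, $\mathbf m\in M$. Let $\epsilon_{jk}\in M$ have $(j,k)$-entry $1$ and all other entries $0$. Define $X_{jk}u_{\mathbf m}=u_{\mathbf m+\epsilon_{jk}}$ and $Z_{jk}u_{\mathbf m}=\varepsilon^{m_{jk}}u_{\mathbf m}$. For $r=(r_i),s=(s_i)\in(\mathbf C^\times)^n$ and $a=(a_{jk})_{1\le j\le k\le n}$, $b=(b_{jk})_{1\le j\le k\le n}\in(\mathbf C^\times)^{n(n+1)/2}$ put $x_{jk}=a_{jk}X_{jk}$, $z_{jk}=b_{jk}Z_{jk}$, with the convention that $z_{jk}=1$ and $b_{jk}=1$ when $1\le j\le k\le n$ fails. Write $\{z\}=(z-z^{-1})/(\varepsilon-\varepsilon^{-1})$. The representation $\Phi_{r,s,a,b}:U_\varepsilon\to\mathrm{End}(\mathcal V)$ is $$e_i\mapsto\sum_{k=i}^n x_{i,k}x_{i,k+1}\cdots x_{i,n}\{r_iz_{i,k}z_{i,k-1}z_{i-1,k-1}^{-1}z_{i+1,k}^{-1}\},$$ $$f_i\mapsto\sum_{k=1}^i x_{i+1-k,n+1-k}^{-1}x_{i+2-k,n+2-k}^{-1}\cdots x_{i,n}^{-1}\{s_iz_{i+1-k,n-k}z_{i+1-k,n+1-k}^{-1}z_{i-k,n+1-k}z_{i-k,n-k}^{-1}\},$$ $$t_i\mapsto\frac{r_i}{s_i}z_{i,n}^2z_{i-1,n}^{-1}z_{i+1,n}^{-1}.$$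 It is known that this is an algebra homomorphism. *)

theory Defs
  imports Complex_Main
    "HOL-Algebra.Module" "HOL-Algebra.QuotRing"
    "HOL-Library.Poly_Mapping" "HOL-Library.Function_Algebras"
begin

section \<open>Associative algebras over the complex numbers\<close>

text \<open>
  Algebras are records of type \<^typ>\<open>(complex, 'a) module\<close>: a ring together with a scalar
  multiplication. (The library's locale \<^locale>\<open>algebra\<close> is for commutative algebras, so it is
  not used.) Homomorphisms are unital.
\<close>

definition alg_hom ::
  "(complex, 'a) module \<Rightarrow> (complex, 'b) module \<Rightarrow> ('a \<Rightarrow> 'b) set" where
  "alg_hom A B = {h \<in> ring_hom A B.
     \<forall>c. \<forall>x\<in>carrier A. h (c \<odot>\<^bsub>A\<^esub> x) = c \<odot>\<^bsub>B\<^esub> h x}"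

definition op_prod :: "(complex, 'a) module \<Rightarrow> 'a list \<Rightarrow> 'a" where
  "op_prod A xs = foldr (mult A) xs \<one>\<^bsub>A\<^esub>"

subsection \<open>Algebras presented by generators and relations\<close>

text \<open>
  Lists form the free monoid, so \<^typ>\<open>'g list \<Rightarrow>\<^sub>0 complex\<close> with the convolution product of
  \<^theory>\<open>HOL-Library.Poly_Mapping\<close> is the free associative algebra on \<^typ>\<open>'g\<close>.
\<close>

instantiation list :: (type) monoid_add
begin
definition zero_list :: "'a list" where "zero_list = []"
definition plus_list :: "'a list \<Rightarrow> 'a list \<Rightarrow> 'a list" where "plus_list = (@)"
instance by standard (simp_all add: zero_list_def plus_list_def)
end

type_synonym 'g free = "'g list \<Rightarrow>\<^sub>0 complex"

definition const_free :: "complex \<Rightarrow> 'g free" where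
  "const_free c = Poly_Mapping.single [] c"

definition gen_free :: "'g \<Rightarrow> 'g free" where
  "gen_free x = Poly_Mapping.single [x] 1"

definition free_alg :: "'g set \<Rightarrow> (complex, 'g free) module" where
  "free_alg G = \<lparr>carrier = {p. Poly_Mapping.keys p \<subseteq> lists G},
     mult = (*), one = 1, zero = 0, add = (+), smult = (\<lambda>c p. const_free c * p)\<rparr>"

definition quot_alg :: "(complex, 'a) module \<Rightarrow> 'a set \<Rightarrow> (complex, 'a set) module" where
  "quot_alg A J = (let Q = A Quot J in
     \<lparr>carrier = carrier Q, mult = mult Q, one = one Q, zero = zero Q, add = add Q,
      smult = (\<lambda>c x. (J +>\<^bsub>A\<^esub> (c \<odot>\<^bsub>A\<^esub> \<one>\<^bsub>A\<^esub>)) \<otimes>\<^bsub>Q\<^esub> x)\<rparr>)"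

text \<open>
  A relation \<open>p = q\<close> is represented by the element \<open>p - q\<close>; \<^const>\<open>genideal\<close> generates a
  two-sided ideal.
\<close>

definition presented :: "'g set \<Rightarrow> 'g free set \<Rightarrow> (complex, 'g free set) module" where
  "presented G R = quot_alg (free_alg G) (Idl\<^bsub>free_alg G\<^esub> R)"

definition cls :: "'g set \<Rightarrow> 'g free set \<Rightarrow> 'g free \<Rightarrow> 'g free set" where
  "cls G R p = (Idl\<^bsub>free_alg G\<^esub> R) +>\<^bsub>free_alg G\<^esub> p"

definition eval_free :: "(complex, 'a) module \<Rightarrow> ('g \<Rightarrow> 'a) \<Rightarrow> 'g free \<Rightarrow> 'a" where
  "eval_free A h p = (\<Oplus>\<^bsub>A\<^esub>w\<in>Poly_Mapping.keys p.
     Poly_Mapping.lookup p w \<odot>\<^bsub>A\<^esub> op_prod A (map h w))"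

text \<open>
  The map out of a presented algebra given by values on the generators. It is meaningful when
  these values satisfy the relations: then evaluation is constant on each coset.
\<close>

definition induced :: "(complex, 'a) module \<Rightarrow> ('g \<Rightarrow> 'a) \<Rightarrow> 'g free set \<Rightarrow> 'a" where
  "induced A h x = the_elem (eval_free A h ` x)"

subsection \<open>Endomorphism algebras and modules\<close>

definition vscale :: "complex \<Rightarrow> ('m \<Rightarrow> complex) \<Rightarrow> 'm \<Rightarrow> complex" where
  "vscale c v = (\<lambda>m. c * v m)"

definition is_subspace :: "('m \<Rightarrow> complex) set \<Rightarrow> bool" where
  "is_subspace W \<longleftrightarrow> 0 \<in> W \<and> (\<forall>v\<in>W. \<forall>w\<in>W. v + w \<in> W) \<and> (\<forall>c. \<forall>v\<in>W. vscale c v \<in> W)"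

definition End_alg ::
  "('m \<Rightarrow> complex) set \<Rightarrow> (complex, ('m \<Rightarrow> complex) \<Rightarrow> ('m \<Rightarrow> complex)) module" where
  "End_alg W = \<lparr>
     carrier = {S \<in> W \<rightarrow>\<^sub>E W. (\<forall>v\<in>W. \<forall>w\<in>W. S (v + w) = S v + S w)
                              \<and> (\<forall>c. \<forall>v\<in>W. S (vscale c v) = vscale c (S v))},
     mult = compose W,
     one = (\<lambda>v\<in>W. v),
     zero = (\<lambda>v\<in>W. 0),
     add = (\<lambda>S T. \<lambda>v\<in>W. S v + T v),
     smult = (\<lambda>c S. \<lambda>v\<in>W. vscale c (S v))\<rparr>"

text \<open>
  An \<open>A\<close>-module structure on \<open>W\<close> is an element \<open>\<rho>\<close> of \<^term>\<open>alg_hom A (End_alg W)\<close>.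
\<close>

definition rep_submodule ::
  "(complex, 'a) module \<Rightarrow> ('m \<Rightarrow> complex) set \<Rightarrow>
   ('a \<Rightarrow> ('m \<Rightarrow> complex) \<Rightarrow> ('m \<Rightarrow> complex)) \<Rightarrow> ('m \<Rightarrow> complex) set \<Rightarrow> bool" where
  "rep_submodule A W \<rho> S \<longleftrightarrow>
     S \<subseteq> W \<and> is_subspace S \<and> (\<forall>x\<in>carrier A. \<forall>v\<in>S. \<rho> x v \<in> S)"

definition rep_irreducible ::
  "(complex, 'a) module \<Rightarrow> ('m \<Rightarrow> complex) set \<Rightarrow>
   ('a \<Rightarrow> ('m \<Rightarrow> complex) \<Rightarrow> ('m \<Rightarrow> complex)) \<Rightarrow> ('m \<Rightarrow> complex) set \<Rightarrow> bool" where
  "rep_irreducible A W \<rho> S \<longleftrightarrow> rep_submodule A W \<rho> S \<and> S \<noteq> {0} \<and>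
     (\<forall>S'. rep_submodule A W \<rho> S' \<and> S' \<subseteq> S \<longrightarrow> S' = {0} \<or> S' = S)"

section \<open>The root system of type A\<close>

text \<open>Elements of the root lattice are given by their coefficients on the simple_root roots.\<close>

type_synonym root = "nat \<Rightarrow> int"

definition cartan :: "nat \<Rightarrow> nat \<Rightarrow> int" where
  "cartan i j = (if i = j then 2 else if i = Suc j \<or> j = Suc i then - 1 else 0)"

definition simple_root :: "nat \<Rightarrow> root" where
  "simple_root i = (\<lambda>k. if k = i then 1 else 0)"

definition pos_roots :: "nat \<Rightarrow> root set" where
  "pos_roots n = {\<Sum>i\<in>{j..k}. simple_root i | j k. 1 \<le> j \<and> j \<le> k \<and> k \<le> n}"

definition root_form :: "nat \<Rightarrow> root \<Rightarrow> root \<Rightarrow> int" where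
  "root_form n \<alpha> \<beta> = (\<Sum>i\<in>{1..n}. \<Sum>j\<in>{1..n}. \<alpha> i * cartan i j * \<beta> j)"

definition top_index :: "root \<Rightarrow> nat" where
  "top_index \<alpha> = Max {i. \<alpha> i \<noteq> 0}"

section \<open>The algebras\<close>

text \<open>
  The parameter type of the root vectors is \<^typ>\<open>nat\<close> for the non-restricted
  specialization and \<^typ>\<open>root\<close> for the subalgebra of the restricted one.
\<close>

datatype 'r qgen = GE 'r | GF 'r | GT nat | GTinv nat

definition qgens :: "nat \<Rightarrow> 'r set \<Rightarrow> 'r qgen set" where
  "qgens n R = GE ` R \<union> GF ` R \<union> GT ` {1..n} \<union> GTinv ` {1..n}"

definition t_gen :: "nat \<Rightarrow> 'r qgen free" where "t_gen i = gen_free (GT i)"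
definition t_inv_gen :: "nat \<Rightarrow> 'r qgen free" where "t_inv_gen i = gen_free (GTinv i)"

definition common_rels ::
  "nat \<Rightarrow> complex \<Rightarrow> (nat \<Rightarrow> 'r qgen free) \<Rightarrow> (nat \<Rightarrow> 'r qgen free) \<Rightarrow> 'r qgen free set" where
  "common_rels n \<epsilon> e f = (let I = {1..n}; t = t_gen; t' = t_inv_gen in
      {t i * t' i - 1 | i. i \<in> I} \<union> {t' i * t i - 1 | i. i \<in> I}
    \<union> {t i * t j - t j * t i | i j. i \<in> I \<and> j \<in> I}
    \<union> {t i * e j * t' i - const_free (\<epsilon> powi cartan i j) * e j | i j. i \<in> I \<and> j \<in> I}
    \<union> {t i * f j * t' i - const_free (\<epsilon> powi (- cartan i j)) * f j | i j. i \<in> I \<and> j \<in> I}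
    \<union> {e i * f j - f j * e i
         - (if i = j then const_free (1 / (\<epsilon> - inverse \<epsilon>)) * (t i - t' i) else 0)
       | i j. i \<in> I \<and> j \<in> I})"

definition qint :: "complex \<Rightarrow> int \<Rightarrow> complex" where
  "qint \<epsilon> k = (\<epsilon> powi k - \<epsilon> powi (- k)) / (\<epsilon> - inverse \<epsilon>)"

definition serre_rels :: "nat \<Rightarrow> complex \<Rightarrow> (nat \<Rightarrow> 'g free) \<Rightarrow> 'g free set" where
  "serre_rels n \<epsilon> y = (let I = {1..n} in
      {y i * y j - y j * y i | i j. i \<in> I \<and> j \<in> I \<and> (i + 2 \<le> j \<or> j + 2 \<le> i)}
    \<union> {y i ^ 2 * y j - const_free (qint \<epsilon> 2) * (y i * y j * y i) + y j * y i ^ 2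
       | i j. i \<in> I \<and> j \<in> I \<and> (i = j + 1 \<or> j = i + 1)})"

definition U_rels :: "nat \<Rightarrow> complex \<Rightarrow> nat qgen free set" where
  "U_rels n \<epsilon> = (let e = (\<lambda>i. gen_free (GE i)); f = (\<lambda>i. gen_free (GF i)) in
      common_rels n \<epsilon> e f \<union> serre_rels n \<epsilon> e \<union> serre_rels n \<epsilon> f)"

definition Ueps :: "nat \<Rightarrow> complex \<Rightarrow> (complex, nat qgen free set) module" where
  "Ueps n \<epsilon> = presented (qgens n {1..n}) (U_rels n \<epsilon>)"

definition U_cls :: "nat \<Rightarrow> complex \<Rightarrow> nat qgen \<Rightarrow> nat qgen free set" where
  "U_cls n \<epsilon> x = cls (qgens n {1..n}) (U_rels n \<epsilon>) (gen_free x)"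

definition Ufin_rels :: "nat \<Rightarrow> nat \<Rightarrow> complex \<Rightarrow> root qgen free set" where
  "Ufin_rels n l \<epsilon> = (let
      I = {1..n}; D = pos_roots n;
      E = (\<lambda>\<alpha>. gen_free (GE \<alpha>)); F = (\<lambda>\<alpha>. gen_free (GF \<alpha>));
      e = (\<lambda>i. E (simple_root i)); f = (\<lambda>i. F (simple_root i));
      P0 = {(i, \<alpha>). i \<in> I \<and> \<alpha> \<in> D \<and> root_form n (simple_root i) \<alpha> = 0 \<and> i < top_index \<alpha>};
      P1 = {(i, \<alpha>). i \<in> I \<and> \<alpha> \<in> D \<and> root_form n (simple_root i) \<alpha> = - 1 \<and> i < top_index \<alpha>};
      q = const_free \<epsilon>; q' = const_free (inverse \<epsilon>)
    in common_rels n \<epsilon> e f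
    \<union> {e i * E \<alpha> - E \<alpha> * e i | i \<alpha>. (i, \<alpha>) \<in> P0}
    \<union> {f i * F \<alpha> - F \<alpha> * f i | i \<alpha>. (i, \<alpha>) \<in> P0}
    \<union> {E (\<alpha> + simple_root i) - (q' * (e i * E \<alpha>) - E \<alpha> * e i) | i \<alpha>. (i, \<alpha>) \<in> P1}
    \<union> {q * (e i * E (\<alpha> + simple_root i)) - E (\<alpha> + simple_root i) * e i | i \<alpha>. (i, \<alpha>) \<in> P1}
    \<union> {q * (E (\<alpha> + simple_root i) * E \<alpha>) - E \<alpha> * E (\<alpha> + simple_root i) | i \<alpha>. (i, \<alpha>) \<in> P1}
    \<union> {F (\<alpha> + simple_root i) - (q * (F \<alpha> * f i) - f i * F \<alpha>) | i \<alpha>. (i, \<alpha>) \<in> P1}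
    \<union> {q * (f i * F (\<alpha> + simple_root i)) - F (\<alpha> + simple_root i) * f i | i \<alpha>. (i, \<alpha>) \<in> P1}
    \<union> {q * (F (\<alpha> + simple_root i) * F \<alpha>) - F \<alpha> * F (\<alpha> + simple_root i) | i \<alpha>. (i, \<alpha>) \<in> P1}
    \<union> {E \<alpha> ^ l | \<alpha>. \<alpha> \<in> D} \<union> {F \<alpha> ^ l | \<alpha>. \<alpha> \<in> D}
    \<union> {t_gen i ^ (2 * l) - 1 | i. i \<in> I})"

definition Ufin :: "nat \<Rightarrow> nat \<Rightarrow> complex \<Rightarrow> (complex, root qgen free set) module" where
  "Ufin n l \<epsilon> = presented (qgens n (pos_roots n)) (Ufin_rels n l \<epsilon>)"

definition Ufin_cls :: "nat \<Rightarrow> nat \<Rightarrow> complex \<Rightarrow> root qgen \<Rightarrow> root qgen free set" where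
  "Ufin_cls n l \<epsilon> x = cls (qgens n (pos_roots n)) (Ufin_rels n l \<epsilon>) (gen_free x)"

section \<open>The maximal cyclic representation\<close>

definition positions :: "nat \<Rightarrow> (nat \<times> nat) set" where
  "positions n = {(j, k). 1 \<le> j \<and> j \<le> k \<and> k \<le> n}"

text \<open>Residues modulo \<open>l\<close> are represented by \<open>0, \<dots>, l - 1\<close>.\<close>

type_synonym idx = "nat \<times> nat \<Rightarrow> nat"
type_synonym vec = "idx \<Rightarrow> complex"
type_synonym endo = "vec \<Rightarrow> vec"

definition idx_set :: "nat \<Rightarrow> nat \<Rightarrow> idx set" where
  "idx_set n l = positions n \<rightarrow>\<^sub>E {0..<l}"

definition Vspace :: "nat \<Rightarrow> nat \<Rightarrow> vec set" where
  "Vspace n l = {v. \<forall>m. m \<notin> idx_set n l \<longrightarrow> v m = 0}"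

definition u_vec :: "idx \<Rightarrow> vec" where
  "u_vec m = (\<lambda>m'. if m' = m then 1 else 0)"

definition EndV :: "nat \<Rightarrow> nat \<Rightarrow> (complex, endo) module" where
  "EndV n l = End_alg (Vspace n l)"

definition on_basis :: "nat \<Rightarrow> nat \<Rightarrow> (idx \<Rightarrow> vec) \<Rightarrow> endo" where
  "on_basis n l h = (\<lambda>v\<in>Vspace n l. \<Sum>m\<in>idx_set n l. vscale (v m) (h m))"

definition X_op :: "nat \<Rightarrow> nat \<Rightarrow> nat \<Rightarrow> nat \<Rightarrow> endo" where
  "X_op n l j k = on_basis n l (\<lambda>m. u_vec (m((j, k) := (m (j, k) + 1) mod l)))"

definition Z_op :: "nat \<Rightarrow> nat \<Rightarrow> complex \<Rightarrow> nat \<Rightarrow> nat \<Rightarrow> endo" where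
  "Z_op n l \<epsilon> j k = on_basis n l (\<lambda>m. vscale (\<epsilon> ^ m (j, k)) (u_vec m))"

definition x_op :: "nat \<Rightarrow> nat \<Rightarrow> (nat \<Rightarrow> nat \<Rightarrow> complex) \<Rightarrow> nat \<Rightarrow> nat \<Rightarrow> endo" where
  "x_op n l a j k = a j k \<odot>\<^bsub>EndV n l\<^esub> X_op n l j k"

definition z_op :: "nat \<Rightarrow> nat \<Rightarrow> complex \<Rightarrow> (nat \<Rightarrow> nat \<Rightarrow> complex) \<Rightarrow> nat \<Rightarrow> nat \<Rightarrow> endo" where
  "z_op n l \<epsilon> b j k =
     (if (j, k) \<in> positions n then b j k \<odot>\<^bsub>EndV n l\<^esub> Z_op n l \<epsilon> j k else \<one>\<^bsub>EndV n l\<^esub>)"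

definition b_ext :: "nat \<Rightarrow> (nat \<Rightarrow> nat \<Rightarrow> complex) \<Rightarrow> nat \<Rightarrow> nat \<Rightarrow> complex" where
  "b_ext n b j k = (if (j, k) \<in> positions n then b j k else 1)"

definition curly :: "nat \<Rightarrow> nat \<Rightarrow> complex \<Rightarrow> endo \<Rightarrow> endo" where
  "curly n l \<epsilon> S = (let A = EndV n l in
     (1 / (\<epsilon> - inverse \<epsilon>)) \<odot>\<^bsub>A\<^esub> (S \<ominus>\<^bsub>A\<^esub> inv\<^bsub>A\<^esub> S))"

text \<open>
  None of the truncated subtractions on \<^typ>\<open>nat\<close> below underflows in the relevant range of
  \<open>i\<close> and \<open>k\<close>.
\<close>

definition Phi_e :: "nat \<Rightarrow> nat \<Rightarrow> complex \<Rightarrow> (nat \<Rightarrow> complex) \<Rightarrow>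
    (nat \<Rightarrow> nat \<Rightarrow> complex) \<Rightarrow> (nat \<Rightarrow> nat \<Rightarrow> complex) \<Rightarrow> nat \<Rightarrow> endo" where
  "Phi_e n l \<epsilon> r a b i = (let A = EndV n l; z = z_op n l \<epsilon> b in
     \<Oplus>\<^bsub>A\<^esub>k\<in>{i..n}.
       op_prod A (map (\<lambda>p. x_op n l a i p) [k..<Suc n])
       \<otimes>\<^bsub>A\<^esub> curly n l \<epsilon>
           (r i \<odot>\<^bsub>A\<^esub> (z i k \<otimes>\<^bsub>A\<^esub> z i (k - 1)
              \<otimes>\<^bsub>A\<^esub> inv\<^bsub>A\<^esub> z (i - 1) (k - 1) \<otimes>\<^bsub>A\<^esub> inv\<^bsub>A\<^esub> z (i + 1) k)))"

definition Phi_f :: "nat \<Rightarrow> nat \<Rightarrow> complex \<Rightarrow> (nat \<Rightarrow> complex) \<Rightarrow>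
    (nat \<Rightarrow> nat \<Rightarrow> complex) \<Rightarrow> (nat \<Rightarrow> nat \<Rightarrow> complex) \<Rightarrow> nat \<Rightarrow> endo" where
  "Phi_f n l \<epsilon> s a b i = (let A = EndV n l; z = z_op n l \<epsilon> b in
     \<Oplus>\<^bsub>A\<^esub>k\<in>{1..i}.
       op_prod A (map (\<lambda>p. inv\<^bsub>A\<^esub> x_op n l a (i + p - k) (n + p - k)) [1..<Suc k])
       \<otimes>\<^bsub>A\<^esub> curly n l \<epsilon>
           (s i \<odot>\<^bsub>A\<^esub> (z (i + 1 - k) (n - k) \<otimes>\<^bsub>A\<^esub> inv\<^bsub>A\<^esub> z (i + 1 - k) (n + 1 - k)
              \<otimes>\<^bsub>A\<^esub> z (i - k) (n + 1 - k) \<otimes>\<^bsub>A\<^esub> inv\<^bsub>A\<^esub> z (i - k) (n - k))))"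

definition Phi_t :: "nat \<Rightarrow> nat \<Rightarrow> complex \<Rightarrow> (nat \<Rightarrow> complex) \<Rightarrow> (nat \<Rightarrow> complex) \<Rightarrow>
    (nat \<Rightarrow> nat \<Rightarrow> complex) \<Rightarrow> nat \<Rightarrow> endo" where
  "Phi_t n l \<epsilon> r s b i = (let A = EndV n l; z = z_op n l \<epsilon> b in
     (r i / s i) \<odot>\<^bsub>A\<^esub> (z i n [^]\<^bsub>A\<^esub> (2::nat)
        \<otimes>\<^bsub>A\<^esub> inv\<^bsub>A\<^esub> z (i - 1) n \<otimes>\<^bsub>A\<^esub> inv\<^bsub>A\<^esub> z (i + 1) n))"

fun Phi_gen :: "nat \<Rightarrow> nat \<Rightarrow> complex \<Rightarrow> (nat \<Rightarrow> complex) \<Rightarrow> (nat \<Rightarrow> complex) \<Rightarrow>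
    (nat \<Rightarrow> nat \<Rightarrow> complex) \<Rightarrow> (nat \<Rightarrow> nat \<Rightarrow> complex) \<Rightarrow> nat qgen \<Rightarrow> endo" where
  "Phi_gen n l \<epsilon> r s a b (GE i) = Phi_e n l \<epsilon> r a b i"
| "Phi_gen n l \<epsilon> r s a b (GF i) = Phi_f n l \<epsilon> s a b i"
| "Phi_gen n l \<epsilon> r s a b (GT i) = Phi_t n l \<epsilon> r s b i"
| "Phi_gen n l \<epsilon> r s a b (GTinv i) = inv\<^bsub>EndV n l\<^esub> Phi_t n l \<epsilon> r s b i"

definition Phi :: "nat \<Rightarrow> nat \<Rightarrow> complex \<Rightarrow> (nat \<Rightarrow> complex) \<Rightarrow> (nat \<Rightarrow> complex) \<Rightarrow>
    (nat \<Rightarrow> nat \<Rightarrow> complex) \<Rightarrow> (nat \<Rightarrow> nat \<Rightarrow> complex) \<Rightarrow> nat qgen free set \<Rightarrow> endo" where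
  "Phi n l \<epsilon> r s a b = induced (EndV n l) (Phi_gen n l \<epsilon> r s a b)"

definition Lmod :: "nat \<Rightarrow> nat \<Rightarrow> complex \<Rightarrow> (nat \<Rightarrow> complex) \<Rightarrow> (nat \<Rightarrow> complex) \<Rightarrow>
    (nat \<Rightarrow> nat \<Rightarrow> complex) \<Rightarrow> (nat \<Rightarrow> nat \<Rightarrow> complex) \<Rightarrow> vec set" where
  "Lmod n l \<epsilon> r s a b =
     {Phi n l \<epsilon> r s a b y (u_vec (\<lambda>p\<in>positions n. 0)) | y. y \<in> carrier (Ueps n \<epsilon>)}"

section \<open>Extending the action\<close>

text \<open>
  In the next two definitions \<open>\<Phi>\<close> is a representation of \<^term>\<open>Ueps n \<epsilon>\<close>, and \<open>E \<alpha>\<close>, \<open>F \<alpha>\<close> are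
  operators for the positive roots \<open>\<alpha>\<close>; values of \<open>E\<close> and \<open>F\<close> elsewhere are irrelevant.
\<close>

definition recursive_root_actions ::
  "nat \<Rightarrow> nat \<Rightarrow> complex \<Rightarrow> (nat qgen free set \<Rightarrow> endo) \<Rightarrow>
   (root \<Rightarrow> endo) \<Rightarrow> (root \<Rightarrow> endo) \<Rightarrow> bool" where
  "recursive_root_actions n l \<epsilon> \<Phi> E F \<longleftrightarrow> (let
      A = EndV n l; e = (\<lambda>i. \<Phi> (U_cls n \<epsilon> (GE i))); f = (\<lambda>i. \<Phi> (U_cls n \<epsilon> (GF i)))
    in (\<forall>i\<in>{1..n}. E (simple_root i) = e i \<and> F (simple_root i) = f i) \<and>
       (\<forall>i\<in>{1..n}. \<forall>\<alpha>\<in>pos_roots n.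
          root_form n (simple_root i) \<alpha> = - 1 \<and> i < top_index \<alpha> \<longrightarrow>
            E (\<alpha> + simple_root i) = inverse \<epsilon> \<odot>\<^bsub>A\<^esub> (e i \<otimes>\<^bsub>A\<^esub> E \<alpha>) \<ominus>\<^bsub>A\<^esub> E \<alpha> \<otimes>\<^bsub>A\<^esub> e i \<and>
            F (\<alpha> + simple_root i) = \<epsilon> \<odot>\<^bsub>A\<^esub> (F \<alpha> \<otimes>\<^bsub>A\<^esub> f i) \<ominus>\<^bsub>A\<^esub> f i \<otimes>\<^bsub>A\<^esub> F \<alpha>))"

definition Ufin_structure ::
  "nat \<Rightarrow> nat \<Rightarrow> complex \<Rightarrow> (nat qgen free set \<Rightarrow> endo) \<Rightarrow>
   (root \<Rightarrow> endo) \<Rightarrow> (root \<Rightarrow> endo) \<Rightarrow> (root qgen free set \<Rightarrow> endo) \<Rightarrow> bool" where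
  "Ufin_structure n l \<epsilon> \<Phi> E F \<rho> \<longleftrightarrow>
     \<rho> \<in> alg_hom (Ufin n l \<epsilon>) (EndV n l) \<and>
     (\<forall>\<alpha>\<in>pos_roots n. \<rho> (Ufin_cls n l \<epsilon> (GE \<alpha>)) = E \<alpha> \<and> \<rho> (Ufin_cls n l \<epsilon> (GF \<alpha>)) = F \<alpha>) \<and>
     (\<forall>i\<in>{1..n}. \<rho> (Ufin_cls n l \<epsilon> (GT i)) = \<Phi> (U_cls n \<epsilon> (GT i)) \<and>
                 \<rho> (Ufin_cls n l \<epsilon> (GTinv i)) = \<Phi> (U_cls n \<epsilon> (GTinv i)))"

end

theory Submission
  imports Defs "HOL-Computational_Algebra.Formal_Power_Series"
begin

text \<open>
  The conditions on the parameters force all \<open>a\<^sub>j\<^sub>k\<close> to be 1 and turn every other coefficient into a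
  power of \<open>\<epsilon>\<close>. The representation therefore comes from operators on functions on a lattice
  of integer tuples, vectors of \<open>V\<close> being the periodic functions, and on the lattice \<open>\<epsilon>\<close> may be
  replaced by any unit \<open>q\<close>.

  Each \<open>e\<^sub>i\<close> is a sum of monomials that can be ordered so that those of \<open>e\<^sub>i\<close> and \<open>e\<^sub>i\<^sub>+\<^sub>1\<close> q-commute
  with the exponents of the Cartan matrix. This implies the Serre relations, and at a root of unity
  the q-binomial theorem gives \<open>e\<^sub>i\<^sup>l = 0\<close>. The commutation relations between root vectors are formal
  consequences of the Serre relations, but their nilpotency is not. For that, let \<open>q = \<epsilon> + X\<close> over
  power series: for a root vector \<open>w\<close> built from \<open>x\<close> and \<open>y\<close>, an \<open>l\<close>-fold twisted
  commutator of \<open>x\<close> with \<open>y\<^sup>l\<close> is \<open>w\<^sup>l\<close> times a scalar with a simple zero at \<open>X = 0\<close>; since \<open>y\<^sup>l\<close>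
  is divisible by \<open>X\<close>, cancelling \<open>X\<close> and then putting \<open>X = 0\<close> leaves a multiple of the commutator
  of \<open>x\<^sup>l = 0\<close>.

  Every \<open>e\<^sub>i\<close> strictly raises a height function on the basis, so each nonzero submodule contains a
  nonzero vector killed by all \<open>e\<^sub>i\<close>. For such a vector the supports of the summands of \<open>e\<^sub>i\<close> are
  disjoint, which forces it to be a multiple of \<open>u\<^sub>0\<close>.
\<close>

section \<open>Linear operators on functions on a lattice\<close>

text \<open>The obstacle is the nilpotency of the composite root vectors. In the non-restricted
  algebra the l-th powers of all root vectors are independent central elements, so the Serre
  relations and \<open>e_i ^ l = 0\<close> do not decide \<open>e_\<alpha> ^ l\<close>; what decides
  it is that these operators extend to generic q. The space V itself does not extend, since powers
  of q indexed by residues mod l make no sense once \<open>q ^ l\<close> differs from 1. Hence the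
  integer tuples, where the Serre relations hold for arbitrary q.

  The lower half needs no second proof. A symmetry of the triangle of positions, exchanging rows and
  diagonals, carries \<open>f_i\<close> to \<open>e_j\<close> with j = n + 1 - i. The weight becomes
  a constant added to the exponents, which changes neither the commutation factors nor the l-th
  powers.

  The condition i < g(\<alpha>) means that a root is only ever extended at its lower end. So each
  root vector has a single construction, by prepending letters, and it has to be compared only with
  its first letter, with the rest of the root after that letter, and with letters inside the root or
  far below it.\<close>

type_synonym lat = "nat \<times> nat \<Rightarrow> int"

text \<open>
  The operators are made into a type so that identities between them can be proved with the
  simplification machinery of \<^class>\<open>ring_1\<close>. The scalars are a type parameter because the
  nilpotency of the root vectors is obtained by deforming \<open>\<epsilon>\<close> to \<open>\<epsilon> + X\<close> over power series.
\<close>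

typedef (overloaded) 'k::comm_ring_1 lop =
  "{F :: (lat \<Rightarrow> 'k) \<Rightarrow> lat \<Rightarrow> 'k.
     (\<forall>f g. F (f + g) = F f + F g) \<and> (\<forall>c f. F (\<lambda>M. c * f M) = (\<lambda>M. c * F f M))}"
  morphisms app Abs_lop
  by (rule exI[of _ "\<lambda>f. f"]) simp

setup_lifting type_definition_lop

instantiation lop :: (comm_ring_1) ring_1
begin
lift_definition zero_lop :: "'a lop" is "\<lambda>f M. 0" by (auto simp: fun_eq_iff)
lift_definition one_lop :: "'a lop" is "\<lambda>f. f" by (auto simp: fun_eq_iff)
lift_definition plus_lop :: "'a lop \<Rightarrow> 'a lop \<Rightarrow> 'a lop" is "\<lambda>F G f M. F f M + G f M"
  by (auto simp: fun_eq_iff algebra_simps)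
lift_definition minus_lop :: "'a lop \<Rightarrow> 'a lop \<Rightarrow> 'a lop" is "\<lambda>F G f M. F f M - G f M"
  by (auto simp: fun_eq_iff algebra_simps)
lift_definition uminus_lop :: "'a lop \<Rightarrow> 'a lop" is "\<lambda>F f M. - F f M"
  by (auto simp: fun_eq_iff algebra_simps)
lift_definition times_lop :: "'a lop \<Rightarrow> 'a lop \<Rightarrow> 'a lop" is "\<lambda>F G f. F (G f)"
  by simp
instance
proof
  fix A B C :: "'a lop"
  show "A * (B + C) = A * B + A * C"
  proof (transfer, rule ext)
    fix A B C :: "(lat \<Rightarrow> 'a) \<Rightarrow> lat \<Rightarrow> 'a" and f
    assume *: "(\<forall>f g. A (f + g) = A f + A g) \<and> (\<forall>c f. A (\<lambda>M. c * f M) = (\<lambda>M. c * A f M))"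
    have "A (B f + C f) = A (B f) + A (C f)" using * by blast
    then show "A (\<lambda>M. B f M + C f M) = (\<lambda>M. A (B f) M + A (C f) M)"
      by (simp add: plus_fun_def)
  qed
  show "(0::'a lop) \<noteq> 1"
  proof (transfer, rule notI)
    assume "(\<lambda>f M. 0) = (\<lambda>f. f :: lat \<Rightarrow> 'a)"
    from fun_cong[OF fun_cong[OF this], of "\<lambda>_. 1" "\<lambda>_. 0"] show False by simp
  qed
qed (transfer; simp add: algebra_simps; fail)+
end

lift_definition sc :: "'k::comm_ring_1 \<Rightarrow> 'k lop" is "\<lambda>c f M. c * f M"
  by (auto simp: fun_eq_iff algebra_simps)

text \<open>\<open>T d \<phi>\<close> sends the basis vector at \<open>M\<close> to \<open>\<phi> M\<close> times the basis vector at \<open>M + d\<close>.\<close>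

lift_definition T :: "lat \<Rightarrow> (lat \<Rightarrow> 'k::comm_ring_1) \<Rightarrow> 'k lop" is
  "\<lambda>d \<phi> f M. \<phi> (M - d) * f (M - d)"
  by (auto simp: fun_eq_iff algebra_simps)

lemma lop_eqI: "(\<And>f M. app A f M = app B f M) \<Longrightarrow> A = B"
  by transfer (simp add: fun_eq_iff)

lemma app_simps [simp]:
  "app 0 f = (\<lambda>M. 0)" "app 1 f = f" "app (A + B) f = (\<lambda>M. app A f M + app B f M)"
  "app (A - B) f = (\<lambda>M. app A f M - app B f M)" "app (- A) f = (\<lambda>M. - app A f M)"
  "app (A * B) f = app A (app B f)" "app (sc c) f = (\<lambda>M. c * f M)"
  "app (T d \<phi>) f = (\<lambda>M. \<phi> (M - d) * f (M - d))"
  by (transfer; simp)+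

lemma app_add: "app A (f + g) = app A f + app A g"
  by transfer simp

lemma app_scale: "app A (\<lambda>M. c * f M) = (\<lambda>M. c * app A f M)"
  by transfer simp

lemma app_sum: "app (\<Sum>i\<in>I. A i) f = (\<lambda>M. \<Sum>i\<in>I. app (A i) f M)"
  by (induction I rule: infinite_finite_induct) simp_all

lemma sc_simps [simp]: "sc 0 = 0" "sc 1 = 1"
  by (rule lop_eqI; simp)+

lemma sc_add: "sc (c + d) = sc c + sc d"
  and sc_uminus: "sc (- c) = - sc c"
  and sc_mult: "sc (c * d) = sc c * sc d"
  by (rule lop_eqI; simp add: algebra_simps)+

lemma sc_commute: "A * sc c = sc c * A"
  by (rule lop_eqI) (simp add: app_scale)

lemma sc_left_commute: "A * (sc c * B) = sc c * (A * B)"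
  by (metis mult.assoc sc_commute)

lemma T_mult: "T d \<phi> * T d' \<psi> = T (d + d') (\<lambda>M. \<phi> (M + d') * \<psi> M)"
  by (rule lop_eqI) (simp add: algebra_simps)

lemma T_add: "T d \<phi> + T d \<psi> = T d (\<lambda>M. \<phi> M + \<psi> M)"
  and T_minus: "T d \<phi> - T d \<psi> = T d (\<lambda>M. \<phi> M - \<psi> M)"
  and sc_T: "sc c * T d \<phi> = T d (\<lambda>M. c * \<phi> M)"
  by (rule lop_eqI; simp add: algebra_simps)+

lemma T_one: "T 0 (\<lambda>M. 1) = 1" and T_zero [simp]: "T d (\<lambda>M. 0) = 0"
  by (rule lop_eqI; simp)+

section \<open>Root vectors in algebras satisfying the quantum Serre relations\<close>

locale qalg = Modules.module scale
  for scale :: "'k::comm_ring_1 \<Rightarrow> 'r::ring_1 \<Rightarrow> 'r" (infixr \<open>\<star>\<close> 75) +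
  fixes q q' h :: 'k
  assumes scale_times_left: "(c \<star> A) * B = c \<star> (A * B)"
    and scale_times_right: "A * (c \<star> B) = c \<star> (A * B)"
    and qq': "q * q' = 1"
    and half: "h * (q + q') = 1"
begin

lemma qq'_simps: "q' * q = 1" "q * (q' * c) = c" "q' * (q * c) = c"
  using qq' by (metis mult.commute mult_1 mult.assoc)+

lemmas expand = scale_times_left scale_times_right scale_right_distrib scale_right_diff_distrib
  scale_left_distrib scale_left_diff_distrib distrib_left distrib_right right_diff_distrib
  left_diff_distrib mult.assoc scale_minus_right scale_minus_left minus_mult_left[symmetric]
  minus_mult_right[symmetric] qq' qq'_simps

text \<open>The quantum Serre expression. Its linearity in \<open>y\<close> is what lets the
  relation pass from simple to composite root vectors.\<close>

definition srr :: "'r \<Rightarrow> 'r \<Rightarrow> 'r" where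
  "srr x y = x * (x * y) - (q + q') \<star> (x * (y * x)) + y * (x * x)"

definition qcomm :: "'r \<Rightarrow> 'r \<Rightarrow> 'r" where
  "qcomm x y = q' \<star> (x * y) - y * x"

text \<open>Together with \<open>qcomm_right\<close> this translates the two Serre relations into
  q-commutation of the bracket with each of its factors, and back.\<close>

lemma qcomm_left: "qcomm x y * x - q \<star> (x * qcomm x y) = - srr x y"
  by (simp add: srr_def qcomm_def expand)

lemma qcomm_right: "q \<star> (qcomm x y * y) - y * qcomm x y = srr y x"
  by (simp add: srr_def qcomm_def expand)

text \<open>A factor commuting with \<open>x\<close> can be pulled out of the second argument of
  \<open>srr x\<close>.\<close>

lemma srr_qcomm:
  assumes "x * u = u * x" and "srr x z = 0"
  shows "srr x (qcomm z u) = 0"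
proof -
  have [simp]: "u * x = x * u" "u * (x * A) = x * (u * A)" for A
    using assms(1) by (metis mult.assoc)+
  have "srr x (qcomm z u) = q' \<star> (srr x z * u) - u * srr x z"
    by (simp add: srr_def qcomm_def expand)
  then show ?thesis using assms(2) by simp
qed

lemma srr_qcomm':
  assumes "x * u = u * x" and "srr u z = 0"
  shows "srr u (qcomm x z) = 0"
proof -
  have [simp]: "u * x = x * u" "u * (x * A) = x * (u * A)" for A
    using assms(1) by (metis mult.assoc)+
  have "srr u (qcomm x z) = q' \<star> (x * srr u z) - srr u z * x"
    by (simp add: srr_def qcomm_def expand)
  then show ?thesis using assms(2) by simp
qed

text \<open>Multiplying the two Serre relations of \<open>z\<close> by \<open>u\<close> and
  \<open>x\<close> from either side gives four zero expressions. In a suitable combination the terms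
  containing \<open>z * z\<close> cancel, because \<open>x\<close> and \<open>u\<close> commute, and
  [2] times \<open>?D\<close> remains; dividing by [2] gives the extra relation.\<close>

lemma qcomm_interior:
  assumes "x * u = u * x" and "srr z x = 0" and "srr z u = 0"
  shows "z * qcomm x (qcomm z u) = qcomm x (qcomm z u) * z"
proof -
  have [simp]: "u * x = x * u" "u * (x * A) = x * (u * A)" for A
    using assms(1) by (metis mult.assoc)+
  let ?D = "z * (x * (z * u)) - x * (z * (u * z)) - z * (u * (z * x)) + u * (z * (x * z))"
  have "(q + q') \<star> ?D = srr z u * x - u * srr z x - (srr z x * u - x * srr z u)"
    by (simp add: srr_def expand)
  then have "h \<star> (q + q') \<star> ?D = 0" using assms by simp
  then have D: "?D = 0" by (simp add: half)
  have "z * qcomm x (qcomm z u) - qcomm x (qcomm z u) * z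
      = - ?D - q' \<star> (srr z x * u - x * srr z u)"
    by (simp add: srr_def qcomm_def expand)
  then show ?thesis using D assms by simp
qed

text \<open>This associativity lets a root vector be bracketed from its upper end, although it is
  built from the lower one.\<close>

lemma qcomm_qcomm: "x * u = u * x \<Longrightarrow> qcomm x (qcomm z u) = qcomm (qcomm x z) u"
proof -
  assume "x * u = u * x"
  then have [simp]: "u * x = x * u" "u * (x * A) = x * (u * A)" for A
    by (metis mult.assoc)+
  show ?thesis by (simp add: qcomm_def expand)
qed

end

locale serre_family = qalg +
  fixes n :: nat and e :: "nat \<Rightarrow> 'b"
  assumes far: "\<lbrakk>i \<in> {1..n}; j \<in> {1..n}; i + 2 \<le> j\<rbrakk> \<Longrightarrow> e i * e j = e j * e i"
    and serre: "\<lbrakk>i \<in> {1..n}; Suc i \<in> {1..n}\<rbrakk> \<Longrightarrow> srr (e i) (e (Suc i)) = 0"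
    and serre': "\<lbrakk>i \<in> {1..n}; Suc i \<in> {1..n}\<rbrakk> \<Longrightarrow> srr (e (Suc i)) (e i) = 0"
begin

text \<open>The root vector \<open>rv i d\<close> belongs to the root \<open>\<alpha>\<^sub>i + \<cdots> + \<alpha>\<^sub>i\<^sub>+\<^sub>d\<close>.\<close>

fun rv :: "nat \<Rightarrow> nat \<Rightarrow> 'b" where
  "rv i 0 = e i"
| "rv i (Suc d) = qcomm (e i) (rv (Suc i) d)"

lemma commute_qcomm:
  assumes "x * a = a * x" and "x * b = b * x"
  shows "x * qcomm a b = qcomm a b * x"
proof -
  have [simp]: "a * x = x * a" "a * (x * A) = x * (a * A)" "b * x = x * b" "b * (x * A) = x * (b * A)"
    for A using assms by (metis mult.assoc)+
  show ?thesis by (simp add: qcomm_def expand)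
qed

lemma rv_far: "\<lbrakk>j \<in> {1..n}; j + 2 \<le> i; i + d \<le> n\<rbrakk> \<Longrightarrow> e j * rv i d = rv i d * e j"
proof (induction d arbitrary: i)
  case 0
  then show ?case using far[of j i] by auto
next
  case (Suc d)
  have "e j * e i = e i * e j" using Suc.prems far[of j i] by auto
  moreover have "e j * rv (Suc i) d = rv (Suc i) d * e j" using Suc by auto
  ultimately show ?case by (simp add: commute_qcomm)
qed

text \<open>Only the lowest letter of the root interacts with \<open>e i\<close>; the others commute
  with it and factor out.\<close>

lemma srr_e_rv: "\<lbrakk>1 \<le> i; Suc i + d \<le> n\<rbrakk> \<Longrightarrow> srr (e i) (rv (Suc i) d) = 0"
proof (cases d)
  case 0
  assume "1 \<le> i" "Suc i + d \<le> n"
  then show ?thesis using serre[of i] 0 by auto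
next
  case (Suc d')
  assume *: "1 \<le> i" "Suc i + d \<le> n"
  have "e i * rv (Suc (Suc i)) d' = rv (Suc (Suc i)) d' * e i"
    using * Suc by (intro rv_far) auto
  moreover have "srr (e i) (e (Suc i)) = 0" using * by (intro serre) auto
  ultimately show ?thesis using Suc by (simp add: srr_qcomm)
qed

lemma rv_left:
  assumes "1 \<le> i" and "Suc i + d \<le> n"
  shows "q \<star> (e i * rv i (Suc d)) = rv i (Suc d) * e i"
  using qcomm_left[of "e i" "rv (Suc i) d"] srr_e_rv[OF assms] by simp

text \<open>Lower letters far from \<open>j\<close> are peeled off until \<open>j\<close> is the
  second letter; there \<open>qcomm_interior\<close> applies with neighbours \<open>e i\<close> and
  the remaining root vector.\<close>

lemma rv_interior: "\<lbrakk>1 \<le> i; i < j; j < i + d; i + d \<le> n\<rbrakk> \<Longrightarrow> e j * rv i d = rv i d * e j"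
proof (induction d arbitrary: i)
  case 0
  then show ?case by simp
next
  case (Suc d)
  show ?case
  proof (cases "j = Suc i")
    case False
    have "e i * e j = e j * e i" using Suc.prems False far[of i j] by auto
    moreover have "e j * rv (Suc i) d = rv (Suc i) d * e j" using Suc False by auto
    ultimately show ?thesis by (simp add: commute_qcomm)
  next
    case True
    with Suc.prems obtain d' where d: "d = Suc d'" by (cases d) auto
    have "e i * rv (Suc (Suc i)) d' = rv (Suc (Suc i)) d' * e i"
      using Suc.prems d by (intro rv_far) auto
    moreover have "srr (e (Suc i)) (e i) = 0" using Suc.prems d by (intro serre') auto
    moreover have "srr (e (Suc i)) (rv (Suc (Suc i)) d') = 0"
      using Suc.prems d by (intro srr_e_rv) auto
    ultimately show ?thesis using d True by (simp add: qcomm_interior)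
  qed
qed

text \<open>Quadratic in the composite vector, so linearity does not help. By
  \<open>qcomm_right\<close> it is enough that \<open>w\<close> q-commutes with \<open>y\<close>,
  which is built from \<open>z\<close> and \<open>u\<close>. It commutes with the interior letter
  \<open>z\<close>; rewritten as a bracket of \<open>qcomm x z\<close> with \<open>u\<close>, it
  q-commutes with \<open>u\<close> by the induction hypothesis.\<close>

lemma srr_rv_e: "\<lbrakk>1 \<le> i; Suc i + d \<le> n\<rbrakk> \<Longrightarrow> srr (rv (Suc i) d) (e i) = 0"
proof (induction d arbitrary: i)
  case 0
  then show ?case using serre'[of i] by auto
next
  case (Suc d)
  define x z u where "x = e i" and "z = e (Suc i)" and "u = rv (Suc (Suc i)) d"
  define w y where "w = rv i (Suc (Suc d))" and "y = rv (Suc i) (Suc d)"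
  have wy: "w = qcomm x y" "y = qcomm z u" by (simp_all add: w_def y_def x_def z_def u_def)
  have xu: "x * u = u * x" unfolding x_def u_def using Suc.prems by (intro rv_far) auto
  have w: "w = qcomm (qcomm x z) u" using xu wy by (simp add: qcomm_qcomm)
  have "srr u z = 0" unfolding u_def z_def using Suc.prems by (intro Suc.IH) auto
  then have "srr u (qcomm x z) = 0" using xu by (simp add: srr_qcomm')
  then have wu: "q \<star> (w * u) = u * w" using qcomm_right[of "qcomm x z" u] w by simp
  have zw: "z * w = w * z"
    unfolding z_def w_def using Suc.prems by (intro rv_interior) auto
  have [simp]: "z * w = w * z" "z * (w * A) = w * (z * A)" "u * w = q \<star> (w * u)"
    "u * (w * A) = q \<star> (w * (u * A))" for A
    using wu zw scale_times_left by (metis mult.assoc)+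
  have "q \<star> (w * y) - y * w = 0" unfolding wy(2) by (simp add: qcomm_def expand)
  then show ?case using qcomm_right[of x y] wy by (simp add: x_def y_def)
qed

lemma rv_right:
  assumes "1 \<le> i" and "Suc i + d \<le> n"
  shows "q \<star> (rv i (Suc d) * rv (Suc i) d) = rv (Suc i) d * rv i (Suc d)"
  using qcomm_right[of "e i" "rv (Suc i) d"] srr_rv_e[OF assms] by simp

end

section \<open>Sums of q-commuting elements\<close>

context qalg
begin

text \<open>Expanded in powers of \<open>X\<close>, the parts of degree one and two vanish
  separately for these exponents, whatever \<open>e\<close> and \<open>f\<close> are.\<close>

lemma srr_add_last_left:
  assumes "e * X = (q * q) \<star> (X * e)" and "f * X = q' \<star> (X * f)" and "srr e f = 0"
  shows "srr (e + X) f = 0"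
proof -
  have [simp]: "e * (X * A) = (q * q) \<star> (X * (e * A))" "f * (X * A) = q' \<star> (X * (f * A))" for A
    using assms(1,2) scale_times_left by (metis mult.assoc)+
  have "srr (e + X) f - srr e f = 0"
    by (simp add: srr_def expand assms(1,2) mult.assoc[of q])
  then show ?thesis using assms(3) by simp
qed

lemma srr_add_last_right:
  assumes "e * X = q' \<star> (X * e)" and "srr e f = 0"
  shows "srr e (f + X) = 0"
proof -
  have [simp]: "e * (X * A) = q' \<star> (X * (e * A))" for A
    using assms(1) scale_times_left by (metis mult.assoc)
  have "srr e (f + X) - srr e f = 0"
    by (simp add: srr_def expand assms(1))
  then show ?thesis using assms(2) by simp
qed

text \<open>The mechanism of Feigin's homomorphism: sums of variables whose commutation exponents
  are the Cartan integers 2 and -1, for a fixed order, satisfy the Serre relations. The predicate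
  \<open>col\<close> tells the two simple roots apart, and the induction always appends the variable
  of largest key.\<close>

lemma srr_sum:
  fixes key :: "'x \<Rightarrow> int" and X :: "'x \<Rightarrow> 'r" and col :: "'x \<Rightarrow> bool"
  assumes "finite S"
    and "\<And>x y. \<lbrakk>x \<in> S; y \<in> S; x \<noteq> y; key x \<le> key y\<rbrakk> \<Longrightarrow>
      X x * X y = (if col x = col y then q * q else q') \<star> (X y * X x)"
  shows "srr (\<Sum>x\<in>{x\<in>S. col x}. X x) (\<Sum>x\<in>{x\<in>S. \<not> col x}. X x) = 0 \<and>
    srr (\<Sum>x\<in>{x\<in>S. \<not> col x}. X x) (\<Sum>x\<in>{x\<in>S. col x}. X x) = 0"
  using assms
proof (induction rule: finite_ranking_induct[where f = key])
  case empty
  then show ?case by (simp add: srr_def)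
next
  case (insert x S)
  show ?case
  proof (cases "x \<in> S")
    case True
    with insert show ?thesis by (simp add: insert_absorb)
  next
    case False
    define A where "A c = (\<Sum>y\<in>{y\<in>S. col y = c}. X y)" for c
    have IH: "srr (A c) (A (\<not> c)) = 0" for c
    proof -
      have "srr (A True) (A False) = 0 \<and> srr (A False) (A True) = 0"
        using insert.IH insert.prems by (simp add: A_def)
      then show ?thesis by (cases c) auto
    qed
    have comm: "A c * X x = (if c = col x then q * q else q') \<star> (X x * A c)" for c
    proof -
      have "X y * X x = (if c = col x then q * q else q') \<star> (X x * X y)" if "y \<in> S" "col y = c" for y
        using insert.prems[of y x] insert.hyps that False by (metis insertCI)
      then have "A c * X x = (\<Sum>y\<in>{y\<in>S. col y = c}. (if c = col x then q * q else q') \<star> (X x * X y))"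
        unfolding A_def sum_distrib_right by (intro sum.cong) auto
      then show ?thesis by (simp add: A_def sum_distrib_left scale_sum_right)
    qed
    have fin: "finite {y\<in>S. col y = c}" for c using insert.hyps by simp
    have upd: "(\<Sum>y\<in>{y \<in> insert x S. col y = c}. X y) = (if c = col x then A c + X x else A c)" for c
    proof (cases "c = col x")
      case True
      then have "{y \<in> insert x S. col y = c} = insert x {y\<in>S. col y = c}" by auto
      then show ?thesis using True False fin by (simp add: A_def add.commute)
    next
      case neq: False
      then have "{y \<in> insert x S. col y = c} = {y\<in>S. col y = c}" by auto
      then show ?thesis using neq by (simp add: A_def)
    qed
    have main: "srr (if c = col x then A c + X x else A c)
        (if (\<not> c) = col x then A (\<not> c) + X x else A (\<not> c)) = 0" for c
      using srr_add_last_left[of "A c" "X x" "A (\<not> c)"] srr_add_last_right[of "A c" "X x" "A (\<not> c)"]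
        comm[of c] comm[of "\<not> c"] IH[of c] by (cases "c = col x") auto
    show ?thesis using main[of True] main[of False] upd[of True] upd[of False]
      by (cases "col x") simp_all
  qed
qed

end

text \<open>Gaussian binomial coefficients through their Pascal rule, which needs no division and so
  makes sense at roots of unity.\<close>

fun gbin :: "'k::comm_ring_1 \<Rightarrow> nat \<Rightarrow> nat \<Rightarrow> 'k" where
  "gbin p m 0 = 1"
| "gbin p 0 (Suc k) = 0"
| "gbin p (Suc m) (Suc k) = p ^ Suc k * gbin p m (Suc k) + gbin p m k"

lemma gbin_eq_0: "m < k \<Longrightarrow> gbin p m k = 0"
  by (induction p m k rule: gbin.induct) auto

lemma gbin_diag: "gbin p m m = 1"
  by (induction m) (auto simp: gbin_eq_0)

text \<open>The quotient formula for Gaussian binomials without denominators. If p has order l, the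
  right factor vanishes at the top row while the left one does not, which kills the inner
  coefficients.\<close>

lemma gbin_absorb: "(1 - p ^ Suc k) * gbin p (Suc m) (Suc k) = (1 - p ^ Suc m) * gbin p m k"
proof (induction m arbitrary: k)
  case 0
  show ?case by (cases k) auto
next
  case (Suc m)
  have IH: "(1 - p ^ Suc k) * gbin p (Suc m) (Suc k) = (1 - p ^ Suc m) * gbin p m k" for k
    by (rule Suc)
  show ?case
  proof (cases k)
    case 0
    have "(1 - p) * gbin p (Suc (Suc m)) 1 = p * ((1 - p) * gbin p (Suc m) 1) + (1 - p)"
      by (simp add: algebra_simps)
    also have "\<dots> = p * (1 - p ^ Suc m) + (1 - p)"
      using IH[of 0] by (simp del: gbin.simps(3))
    finally show ?thesis using 0 by (simp add: algebra_simps)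
  next
    case (Suc k')
    \<comment> \<open>The Pascal rule is solved for \<open>p ^ k * gbin p m k\<close>; the entry
      \<open>gbin p m k'\<close> that it brings in is removed by the induction hypothesis at
      \<open>k'\<close>, read backwards.\<close>
    have "p ^ Suc k * ((1 - p ^ Suc m) * gbin p m k)
        = p * (1 - p ^ Suc m) * (gbin p (Suc m) k - gbin p m k')"
      using Suc by (simp add: algebra_simps)
    also have "\<dots> = p * (1 - p ^ Suc m) * gbin p (Suc m) k - p * ((1 - p ^ Suc m) * gbin p m k')"
      by (simp add: algebra_simps)
    also have "\<dots> = p * (1 - p ^ Suc m) * gbin p (Suc m) k - p * ((1 - p ^ k) * gbin p (Suc m) k)"
      unfolding IH[symmetric] Suc ..
    finally have *: "p ^ Suc k * ((1 - p ^ Suc m) * gbin p m k) =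
      p * (1 - p ^ Suc m) * gbin p (Suc m) k - p * ((1 - p ^ k) * gbin p (Suc m) k)" .
    have "(1 - p ^ Suc k) * gbin p (Suc (Suc m)) (Suc k) =
        p ^ Suc k * ((1 - p ^ Suc k) * gbin p (Suc m) (Suc k)) + (1 - p ^ Suc k) * gbin p (Suc m) k"
      unfolding gbin.simps(3)[of p "Suc m" k] by (simp only: algebra_simps)
    also have "\<dots> = (1 - p ^ Suc (Suc m)) * gbin p (Suc m) k"
      unfolding IH * by (simp add: algebra_simps)
    finally show ?thesis .
  qed
qed

lemma gbin_root_of_unity:
  fixes p :: "'k::idom"
  assumes "p ^ l = 1" and "\<And>k. 0 < k \<Longrightarrow> k < l \<Longrightarrow> p ^ k \<noteq> 1" and "0 < k" "k < l"
  shows "gbin p l k = 0"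
proof -
  obtain k' l' where kl: "k = Suc k'" "l = Suc l'" using assms(3,4) by (cases k; cases l) auto
  have "(1 - p ^ k) * gbin p l k = 0"
    using gbin_absorb[of p k' l'] assms(1) kl by (simp del: gbin.simps)
  moreover have "1 - p ^ k \<noteq> 0" using assms(2)[of k] assms(3,4) by auto
  ultimately show ?thesis by simp
qed

context qalg
begin

lemma power_q_commute:
  assumes "X * Y = p \<star> (Y * X)"
  shows "X * Y ^ k = (p ^ k) \<star> (Y ^ k * X)"
proof (induction k)
  case (Suc k)
  have "X * Y ^ Suc k = p \<star> (Y * (X * Y ^ k))"
    by (metis assms mult.assoc power_Suc scale_times_left)
  then show ?case by (simp add: Suc scale_times_right mult.assoc)
qed simp

lemma q_binomial:
  assumes "X * Y = p \<star> (Y * X)"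
  shows "(X + Y) ^ m = (\<Sum>k\<le>m. gbin p m k \<star> (Y ^ k * X ^ (m - k)))"
proof (induction m)
  case (Suc m)
  have X: "X * (gbin p m k \<star> (Y ^ k * X ^ (m - k))) = (p ^ k * gbin p m k) \<star> (Y ^ k * X ^ (Suc m - k))"
    if "k \<le> m" for k
  proof -
    have "X * (Y ^ k * X ^ (m - k)) = p ^ k \<star> (Y ^ k * X ^ (Suc m - k))"
      using power_q_commute[OF assms, of k] that
      by (metis Suc_diff_le mult.assoc power_Suc scale_times_left)
    then show ?thesis by (simp add: scale_times_right mult.commute)
  qed
  have "(X + Y) ^ Suc m = (\<Sum>k\<le>m. X * (gbin p m k \<star> (Y ^ k * X ^ (m - k))))
      + (\<Sum>k\<le>m. Y * (gbin p m k \<star> (Y ^ k * X ^ (m - k))))"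
    by (simp only: power_Suc Suc distrib_right sum_distrib_left sum.distrib)
  also have "(\<Sum>k\<le>m. X * (gbin p m k \<star> (Y ^ k * X ^ (m - k)))) =
      (\<Sum>k\<le>Suc m. (p ^ k * gbin p m k) \<star> (Y ^ k * X ^ (Suc m - k)))"
    using X by (simp add: gbin_eq_0)
  also have "\<dots> = X ^ Suc m + (\<Sum>k\<le>m. (p ^ Suc k * gbin p m (Suc k)) \<star> (Y ^ Suc k * X ^ (m - k)))"
    by (subst sum.atMost_Suc_shift) simp
  also have "(\<Sum>k\<le>m. Y * (gbin p m k \<star> (Y ^ k * X ^ (m - k)))) =
      (\<Sum>k\<le>m. gbin p m k \<star> (Y ^ Suc k * X ^ (m - k)))"
    by (simp add: scale_times_right mult.assoc)
  also have "X ^ Suc m + (\<Sum>k\<le>m. (p ^ Suc k * gbin p m (Suc k)) \<star> (Y ^ Suc k * X ^ (m - k)))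
      + (\<Sum>k\<le>m. gbin p m k \<star> (Y ^ Suc k * X ^ (m - k)))
    = X ^ Suc m + (\<Sum>k\<le>m. gbin p (Suc m) (Suc k) \<star> (Y ^ Suc k * X ^ (Suc m - Suc k)))"
    by (simp add: sum.distrib[symmetric] scale_left_distrib del: power_Suc)
  also have "\<dots> = (\<Sum>k\<le>Suc m. gbin p (Suc m) k \<star> (Y ^ k * X ^ (Suc m - k)))"
    by (subst sum.atMost_Suc_shift) simp
  finally show ?case .
qed simp

text \<open>Summands are split off in key order, and each time only the two outer terms of the
  q-binomial expansion survive. The vanishing of the coefficients is the hypothesis, rather than the
  order of \<open>p\<close>, because the scalars here need not be a domain.\<close>

lemma q_frobenius_sum:
  fixes key :: "'x \<Rightarrow> int" and X :: "'x \<Rightarrow> 'r"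
  assumes "finite S" and l: "0 < l" and p: "\<And>k. 0 < k \<Longrightarrow> k < l \<Longrightarrow> gbin p l k = 0"
    and "\<And>x y. \<lbrakk>x \<in> S; y \<in> S; x \<noteq> y; key x \<le> key y\<rbrakk> \<Longrightarrow> X x * X y = p \<star> (X y * X x)"
  shows "(\<Sum>x\<in>S. X x) ^ l = (\<Sum>x\<in>S. X x ^ l)"
  using assms(1,4)
proof (induction rule: finite_ranking_induct[where f = key])
  case empty
  then show ?case using l by (simp add: zero_power)
next
  case (insert x S)
  show ?case
  proof (cases "x \<in> S")
    case True
    with insert show ?thesis by (simp add: insert_absorb)
  next
    case False
    have "X y * X x = p \<star> (X x * X y)" if "y \<in> S" for y
      using insert.prems[of y x] insert.hyps that False by auto
    then have comm: "(\<Sum>y\<in>S. X y) * X x = p \<star> (X x * (\<Sum>y\<in>S. X y))"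
      by (simp add: sum_distrib_left sum_distrib_right scale_sum_right)
    have z: "gbin p l k \<star> A = 0" if "k \<noteq> 0" "k \<noteq> l" "k \<le> l" for k A
      using p[of k] that by simp
    have "((\<Sum>y\<in>S. X y) + X x) ^ l =
        (\<Sum>k\<le>l. gbin p l k \<star> (X x ^ k * (\<Sum>y\<in>S. X y) ^ (l - k)))"
      by (rule q_binomial[OF comm])
    also have "\<dots> = (\<Sum>k\<in>{0, l}. gbin p l k \<star> (X x ^ k * (\<Sum>y\<in>S. X y) ^ (l - k)))"
      by (intro sum.mono_neutral_right) (use z in auto)
    also have "\<dots> = (\<Sum>y\<in>S. X y) ^ l + X x ^ l"
      using l by (simp add: gbin_diag)
    finally show ?thesis using insert False by (simp add: add.commute)
  qed
qed

end

section \<open>The operators of the cyclic representation on the lattice\<close>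

text \<open>
  \<open>cx n i k\<close> is the exponent of \<open>\<epsilon>\<close> contributed by \<open>z\<^sub>i\<^sub>,\<^sub>k z\<^sub>i\<^sub>,\<^sub>k\<^sub>-\<^sub>1\<close> divided by \<open>z\<^sub>i\<^sub>-\<^sub>1\<^sub>,\<^sub>k\<^sub>-\<^sub>1 z\<^sub>i\<^sub>+\<^sub>1\<^sub>,\<^sub>k\<close>, \<open>yv n i k\<close>
  is the shift by \<open>x\<^sub>i\<^sub>,\<^sub>k \<cdots> x\<^sub>i\<^sub>,\<^sub>n\<close>, and \<open>om\<close> is their pairing. The integers \<open>mu i\<close> below are \<open>0\<close> for the
  \<open>e\<^sub>i\<close> and carry the weight for the \<open>f\<^sub>i\<close>.
\<close>

definition ext :: "nat \<Rightarrow> lat \<Rightarrow> nat \<Rightarrow> nat \<Rightarrow> int" where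
  "ext n M j k = (if (j, k) \<in> positions n then M (j, k) else 0)"

definition cx :: "nat \<Rightarrow> nat \<Rightarrow> nat \<Rightarrow> lat \<Rightarrow> int" where
  "cx n i k M = ext n M i k + ext n M i (k - 1) - ext n M (i - 1) (k - 1) - ext n M (i + 1) k"

definition yv :: "nat \<Rightarrow> nat \<Rightarrow> nat \<Rightarrow> lat" where
  "yv n i k = (\<lambda>(j, p). if j = i \<and> k \<le> p \<and> p \<le> n then 1 else 0)"

definition om :: "nat \<Rightarrow> nat \<Rightarrow> nat \<Rightarrow> nat \<Rightarrow> int" where
  "om i k j k' =
     (if j = i then (if k' = k then 1 else if k' < k then 2 else 0)
      else if j = Suc i then (if k' \<le> k then - 1 else 0)
      else if i = Suc j then (if k' < k then - 1 else 0) else 0)"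

lemma cx_add: "cx n i k (M + N) = cx n i k M + cx n i k N"
  by (simp add: cx_def ext_def)

lemma cx_yv:
  assumes "(i, k) \<in> positions n" and "(j, k') \<in> positions n"
  shows "cx n i k (yv n j k') = om i k j k'"
  using assms by (auto simp: cx_def ext_def yv_def om_def positions_def)

lemma cx_yv_multiple:
  "cx n i k (\<lambda>p. t * M p) = t * cx n i k M"
  by (simp add: cx_def ext_def algebra_simps)

locale lattice_rep =
  fixes q q' h d :: "'k::comm_ring_1" and n :: nat and mu :: "nat \<Rightarrow> int"
  assumes qq': "q * q' = 1" and half: "h * (q + q') = 1" and diff: "d * (q - q') = 1"
begin

definition qp :: "int \<Rightarrow> 'k" where
  "qp z = (if 0 \<le> z then q ^ nat z else q' ^ nat (- z))"

definition br :: "int \<Rightarrow> 'k" where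
  "br z = d * (qp z - qp (- z))"

definition e :: "nat \<Rightarrow> 'k lop" where
  "e i = (\<Sum>k=i..n. T (yv n i k) (\<lambda>M. br (cx n i k M + mu i)))"

lemma q'q: "q' * q = 1" "q * (q' * c) = c" "q' * (q * c) = c"
  using qq' by (metis mult.commute mult_1 mult.assoc)+

lemma qp_0 [simp]: "qp 0 = 1"
  by (simp add: qp_def)

lemma qp_Suc: "qp (z + 1) = q * qp z"
proof (cases "0 \<le> z")
  case True
  then show ?thesis by (simp add: qp_def nat_add_distrib)
next
  case False
  then have "nat (- z) = Suc (nat (- (z + 1)))" by simp
  then show ?thesis using False by (auto simp: qp_def q'q)
qed

lemma qp_diff_1: "qp (z - 1) = q' * qp z"
  using qp_Suc[of "z - 1"] by (simp add: q'q)

lemma qp_add: "qp (x + y) = qp x * qp y"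
proof (induction x rule: int_induct[where k = 0])
  case (step1 i)
  then show ?case using qp_Suc[of i] qp_Suc[of "i + y"] by (simp add: algebra_simps)
next
  case (step2 i)
  then show ?case using qp_diff_1[of i] qp_diff_1[of "i + y"] by (simp add: algebra_simps)
qed simp

lemma qp_inverse: "qp z * qp (- z) = 1"
  using qp_add[of z "- z"] by simp

lemma qp_power: "qp z ^ m = qp (int m * z)"
  by (induction m) (simp_all add: qp_add[symmetric] algebra_simps)

lemma br_0 [simp]: "br 0 = 0"
  by (simp add: br_def)

text \<open>This identity of quantum integers collapses each term of the commutator of e and f to a
  single bracket, and is thus the origin of \<open>t_i - t_i\<^sup>-\<^sup>1\<close>.\<close>

lemma br_mult_diff: "br (x - 1) * br y - br x * br (y - 1) = br (x - y)"
proof -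
  have 1: "qp (x - 1) = q' * qp x" "qp (y - 1) = q' * qp y" "qp (- (x - 1)) = q * qp (- x)"
    "qp (- (y - 1)) = q * qp (- y)" "qp (x - y) = qp x * qp (- y)" "qp (- (x - y)) = qp y * qp (- x)"
    using qp_diff_1 qp_Suc[of "- x"] qp_Suc[of "- y"] qp_add[of x "- y"] qp_add[of y "- x"] by simp_all
  have "br (x - 1) * br y - br x * br (y - 1) = d * (d * (q - q')) * (qp (x - y) - qp (- (x - y)))"
    unfolding br_def 1 by (simp add: algebra_simps)
  then show ?thesis by (simp add: diff br_def)
qed

sublocale Modules.module "\<lambda>c A. sc c * (A::'k lop)"
  by standard (simp_all add: algebra_simps sc_add sc_mult)

sublocale qalg "\<lambda>c A. sc c * (A::'k lop)" q q' h
  by standard (simp_all add: mult.assoc sc_left_commute qq' half)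

text \<open>A bracket is a difference of two powers of q, and \<open>s\<close> selects one of them
  with its sign. The halves q-commute with each other; whole summands of \<open>e i\<close> do
  not.\<close>

definition mono :: "int \<times> nat \<times> nat \<Rightarrow> 'k lop" where
  "mono = (\<lambda>(s, i, k). T (yv n i k) (\<lambda>M. of_int s * d * qp (s * (cx n i k M + mu i))))"

definition mono_index :: "nat \<Rightarrow> (int \<times> nat \<times> nat) set" where
  "mono_index i = {1, - 1} \<times> {i} \<times> {i..n}"

lemma finite_mono_index: "finite (mono_index i)"
  by (simp add: mono_index_def)

lemma sum_mono_index: "(\<Sum>x\<in>mono_index i. f x) = (\<Sum>k=i..n. f (1, i, k)) + (\<Sum>k=i..n. f (- 1, i, k))"
proof -
  have "mono_index i = (\<lambda>k. (1, i, k)) ` {i..n} \<union> (\<lambda>k. (- 1, i, k)) ` {i..n}"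
    by (auto simp: mono_index_def)
  then show ?thesis by (simp add: sum.union_disjoint disjoint_iff image_iff sum.reindex inj_on_def)
qed

lemma e_mono: "e i = (\<Sum>x\<in>mono_index i. mono x)"
proof -
  have "(\<Sum>x\<in>mono_index i. mono x) = (\<Sum>k=i..n. mono (1, i, k)) + (\<Sum>k=i..n. mono (- 1, i, k))"
    by (rule sum_mono_index)
  also have "\<dots> = e i"
    by (simp add: e_def mono_def sum.distrib[symmetric] T_add br_def algebra_simps)
  finally show ?thesis ..
qed

text \<open>A monomial is a shift weighted by q to an affine form. Exchanging two of them evaluates
  the linear part of each form on the shift of the other; the constants \<open>mu\<close>
  cancel.\<close>

lemma mono_mult:
  assumes "(i, k) \<in> positions n" and "(j, k') \<in> positions n"
  shows "mono (s, i, k) * mono (s', j, k') =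
    sc (qp (s * om i k j k' - s' * om j k' i k)) * (mono (s', j, k') * mono (s, i, k))"
proof -
  define W where "W = yv n i k + yv n j k'"
  have W: "yv n i k + yv n j k' = W" "yv n j k' + yv n i k = W" by (simp_all add: W_def add.commute)
  have "qp (s * (cx n i k (M + yv n j k') + mu i)) * qp (s' * (cx n j k' M + mu j)) =
    qp (s * om i k j k' - s' * om j k' i k) *
      (qp (s' * (cx n j k' (M + yv n i k) + mu j)) * qp (s * (cx n i k M + mu i)))" for M
    unfolding qp_add[symmetric] cx_add cx_yv[OF assms] cx_yv[OF assms(2,1)]
    by (rule arg_cong[of _ _ qp]) (simp add: algebra_simps)
  then show ?thesis
    unfolding mono_def by (simp add: T_mult sc_T mult.assoc mult.left_commute W)
qed

text \<open>
  An order that makes all the commutation factors of \<open>e i\<close> and \<open>e (i + 1)\<close> those of the simple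
  roots: positive monomials with decreasing second index, then the negative ones increasingly.
\<close>

definition mono_key :: "nat \<Rightarrow> int \<times> nat \<times> nat \<Rightarrow> int" where
  "mono_key i = (\<lambda>(s, j, k). - s * (2 * int k - (if j = i then 0 else 1)))"

text \<open>Keys of \<open>e i\<close> are even and those of \<open>e (Suc i)\<close> odd, so
  distinct monomials never tie; the exponents are then read off the table \<open>om\<close>.\<close>

lemma mono_q_commute:
  assumes "1 \<le> i" "x \<in> mono_index i \<union> mono_index (Suc i)" "y \<in> mono_index i \<union> mono_index (Suc i)"
    "x \<noteq> y" "mono_key i x \<le> mono_key i y"
  shows "mono x * mono y =
    sc (if (fst (snd x) = i) = (fst (snd y) = i) then q * q else q') * (mono y * mono x)"
proof -
  obtain s j k s' j' k' where xy: "x = (s, j, k)" "y = (s', j', k')" by (cases x; cases y) auto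
  have pos: "(j, k) \<in> positions n" "(j', k') \<in> positions n"
    using assms(1-3) by (auto simp: xy mono_index_def positions_def)
  have "qp (s * om j k j' k' - s' * om j' k' j k) = (if (j = i) = (j' = i) then q * q else q')"
  proof -
    have "s * om j k j' k' - s' * om j' k' j k = (if (j = i) = (j' = i) then 2 else - 1)"
      using assms pos by (auto simp: xy mono_index_def mono_key_def om_def positions_def)
    then show ?thesis by (simp add: qp_def power2_eq_square)
  qed
  then show ?thesis using mono_mult[OF pos] by (simp add: xy)
qed

lemma e_serre: 
  assumes "1 \<le> i"
  shows "srr (e i) (e (Suc i)) = 0 \<and> srr (e (Suc i)) (e i) = 0"
proof -
  let ?S = "mono_index i \<union> mono_index (Suc i)"
  have "{x\<in>?S. fst (snd x) = i} = mono_index i" "{x\<in>?S. fst (snd x) \<noteq> i} = mono_index (Suc i)"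
    by (auto simp: mono_index_def)
  then show ?thesis
    using srr_sum[of ?S "mono_key i" mono "\<lambda>x. fst (snd x) = i"] mono_q_commute[OF assms]
    by (simp add: finite_mono_index e_mono)
qed

lemma e_far:
  assumes "1 \<le> i" "i + 2 \<le> j"
  shows "e i * e j = e j * e i"
proof -
  have "mono x * mono y = mono y * mono x" if xy: "x \<in> mono_index i" "y \<in> mono_index j" for x y
  proof -
    obtain s k s' k' where x: "x = (s, i, k)" "y = (s', j, k')" "(i, k) \<in> positions n" "(j, k') \<in> positions n"
      using xy assms by (auto simp: mono_index_def positions_def)
    show ?thesis using mono_mult[OF x(3,4), of s s'] assms by (simp add: x om_def)
  qed
  then show ?thesis
    unfolding e_mono sum_product by (subst (2) sum.swap) (intro sum.cong refl)
qed

sublocale serre_family "\<lambda>c A. sc c * (A::'k lop)" q q' h n e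
  by standard (use e_serre e_far in auto)

end

section \<open>Nilpotency at a root of unity\<close>

lemma T_power: "T y \<phi> ^ m = T (\<lambda>p. int m * y p) (\<lambda>M. \<Prod>t<m. \<phi> (\<lambda>p. M p + int t * y p))"
proof (induction m)
  case 0
  then show ?case using T_one by (simp add: zero_fun_def)
next
  case (Suc m)
  have "T y \<phi> ^ Suc m = T y \<phi> * T (\<lambda>p. int m * y p) (\<lambda>M. \<Prod>t<m. \<phi> (\<lambda>p. M p + int t * y p))"
    by (simp add: Suc)
  also have "\<dots> = T (\<lambda>p. int (Suc m) * y p) (\<lambda>M. \<Prod>t<Suc m. \<phi> (\<lambda>p. M p + int t * y p))"
    by (simp add: T_mult plus_fun_def algebra_simps)
  finally show ?case .
qed

lemma sum_int_odd: "odd l \<Longrightarrow> (\<Sum>t<l. int t) = int l * int ((l - 1) div 2)"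
proof -
  have *: "2 * (\<Sum>t<m. int t) = int m * (int m - 1)" for m
    by (induction m) (simp_all add: algebra_simps)
  assume "odd l"
  then have "int l - 1 = 2 * int ((l - 1) div 2)" by (auto elim!: oddE)
  then have "2 * (\<Sum>t<l. int t) = 2 * (int l * int ((l - 1) div 2))"
    unfolding * by (simp add: algebra_simps)
  then show ?thesis by simp
qed

context lattice_rep
begin

lemma qp_multiple: "q ^ l = 1 \<Longrightarrow> qp (int l * z) = 1"
proof -
  assume "q ^ l = 1"
  moreover from this have "q' ^ l = 1" using qq' by (metis mult_1 power_mult_distrib power_one)
  moreover have "(x ^ k) ^ l = (x ^ l) ^ k" for x :: 'k and k
    by (metis power_mult mult.commute)
  ultimately have "qp z ^ l = 1" by (simp add: qp_def)
  then show ?thesis by (simp add: qp_power)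
qed

lemma qp_sum: "finite A \<Longrightarrow> (\<Prod>t\<in>A. qp (f t)) = qp (\<Sum>t\<in>A. f t)"
  by (induction A rule: finite_induct) (simp_all add: qp_add)

text \<open>Over l steps the exponent runs through an arithmetic progression of difference
  \<open>s\<close>. For odd l its sum is a multiple of l, so the base point and \<open>mu\<close>
  leave no trace.\<close>

lemma mono_power:
  assumes "q ^ l = 1" "odd l" "(i, k) \<in> positions n"
  shows "mono (s, i, k) ^ l = T (\<lambda>p. int l * yv n i k p) (\<lambda>M. (of_int s * d) ^ l)"
proof -
  have "(\<Prod>t<l. of_int s * d * qp (s * (cx n i k (\<lambda>p. M p + int t * yv n i k p) + mu i))) = (of_int s * d) ^ l"
    for M
  proof -
    have "cx n i k (\<lambda>p. M p + int t * yv n i k p) = cx n i k M + int t" for t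
      using cx_add[of n i k M "\<lambda>p. int t * yv n i k p"] cx_yv_multiple[of n i k "int t" "yv n i k"]
        cx_yv[OF assms(3,3)] by (simp add: plus_fun_def om_def)
    then have "(\<Prod>t<l. qp (s * (cx n i k (\<lambda>p. M p + int t * yv n i k p) + mu i)))
        = qp (\<Sum>t<l. s * (cx n i k M + mu i) + s * int t)"
      by (simp add: qp_sum algebra_simps)
    also have "(\<Sum>t<l. s * (cx n i k M + mu i) + s * int t) =
        int l * (s * (cx n i k M + mu i) + s * int ((l - 1) div 2))"
      unfolding sum.distrib sum_distrib_left[symmetric] sum_int_odd[OF assms(2)]
      by (simp add: algebra_simps)
    also have "qp \<dots> = 1" by (rule qp_multiple[OF assms(1)])
    finally show ?thesis by (simp add: prod.distrib)
  qed
  then show ?thesis by (simp add: mono_def T_power)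
qed

text \<open>By the q-Frobenius rule only l-th powers of monomials remain. The two halves of a
  bracket contribute \<open>d ^ l\<close> and \<open>(- d) ^ l\<close> on the same shift, and these
  cancel because l is odd.\<close>

lemma e_power_l:
  assumes "q ^ l = 1" "odd l" "\<And>k. 0 < k \<Longrightarrow> k < l \<Longrightarrow> gbin (q * q) l k = 0" "1 \<le> i"
  shows "e i ^ l = 0"
proof -
  have l: "0 < l" using assms(2) by (cases l) auto
  have "e i ^ l = (\<Sum>x\<in>mono_index i. mono x ^ l)"
    unfolding e_mono
    by (rule q_frobenius_sum[where key = "mono_key i" and p = "q * q"])
      (use finite_mono_index l assms(3) mono_q_commute[OF assms(4)] in \<open>auto simp: mono_index_def\<close>)
  also have "\<dots> = (\<Sum>k=i..n. mono (1, i, k) ^ l + mono (- 1, i, k) ^ l)"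
    unfolding sum_mono_index by (simp add: sum.distrib)
  also have "\<dots> = 0"
    using assms(2,4) by (intro sum.neutral) (auto simp: mono_power[OF assms(1,2)] positions_def T_add)
  finally show ?thesis .
qed

end

lemma primitive_square:
  fixes \<epsilon> :: complex
  assumes "odd l" "\<epsilon> ^ l = 1" "\<forall>k. 0 < k \<and> k < l \<longrightarrow> \<epsilon> ^ k \<noteq> 1"
  shows "(\<epsilon> * \<epsilon>) ^ l = 1" "\<And>k. 0 < k \<Longrightarrow> k < l \<Longrightarrow> (\<epsilon> * \<epsilon>) ^ k \<noteq> 1"
proof -
  show "(\<epsilon> * \<epsilon>) ^ l = 1" using assms(2) by (simp add: power_mult_distrib)
  fix k assume k: "0 < k" "k < l"
  show "(\<epsilon> * \<epsilon>) ^ k \<noteq> 1"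
  proof
    assume "(\<epsilon> * \<epsilon>) ^ k = 1"
    then have *: "\<epsilon> ^ (2 * k) = 1" by (simp add: power_mult power2_eq_square)
    show False
    proof (cases "2 * k < l")
      case True
      then show False using * assms(3) k by auto
    next
      case False
      then have "\<epsilon> ^ (2 * k) = \<epsilon> ^ l * \<epsilon> ^ (2 * k - l)" by (simp flip: power_add)
      then have "\<epsilon> ^ (2 * k - l) = 1" using * assms(2) by simp
      moreover have "2 * k \<noteq> l" using assms(1) by auto
      then have "0 < 2 * k - l" "2 * k - l < l" using False k by auto
      ultimately show False using assms(3) by auto
    qed
  qed
qed

section \<open>Iterated twisted commutators over power series in X\<close>

text \<open>Coefficients of the polynomial \<open>\<Prod>a<m. (1 - r a t)\<close>.\<close>

fun hbin :: "(nat \<Rightarrow> 'k::comm_ring_1) \<Rightarrow> nat \<Rightarrow> nat \<Rightarrow> 'k" where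
  "hbin r m 0 = 1"
| "hbin r 0 (Suc k) = 0"
| "hbin r (Suc m) (Suc k) = hbin r m (Suc k) - r m * hbin r m k"

lemma hbin_eq_0: "m < k \<Longrightarrow> hbin r m k = 0"
  by (induction r m k rule: hbin.induct) auto

text \<open>The ratio of consecutive coefficients when the roots form a geometric progression. For
  \<open>z ^ m = 1\<close> the right factor is 0 at k = 0, and the vanishing propagates as long as
  \<open>z ^ Suc k\<close> differs from 1; this is why the product becomes \<open>1 - t ^ l\<close>
  for z of order l.\<close>

lemma hbin_power:
  fixes z :: "'k::comm_ring_1"
  shows "(1 - z ^ Suc k) * hbin (\<lambda>a. z ^ a) m (Suc k) = (z ^ m - z ^ k) * hbin (\<lambda>a. z ^ a) m k"
proof (induction m arbitrary: k)
  case 0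
  then show ?case by (cases k) auto
next
  case (Suc m)
  let ?h = "hbin (\<lambda>a. z ^ a)"
  have "(1 - z ^ Suc k) * ?h (Suc m) (Suc k) =
      (1 - z ^ Suc k) * ?h m (Suc k) - z ^ m * (1 - z ^ Suc k) * ?h m k"
    by (simp add: algebra_simps)
  also have "\<dots> = (z ^ (m + Suc k) - z ^ k) * ?h m k"
    unfolding Suc[of k] by (simp add: algebra_simps power_add)
  finally have 1: "(1 - z ^ Suc k) * ?h (Suc m) (Suc k) = (z ^ (m + Suc k) - z ^ k) * ?h m k" .
  show ?case
  proof (cases k)
    case 0
    then show ?thesis using 1 by simp
  next
    case (Suc k')
    have "(z ^ Suc m - z ^ k) * ?h (Suc m) k =
        (z ^ Suc m - z ^ k) * ?h m k - z ^ Suc m * ((z ^ m - z ^ k') * ?h m k')"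
      using Suc by (simp add: algebra_simps)
    also have "\<dots> = (z ^ Suc m - z ^ k) * ?h m k - z ^ Suc m * ((1 - z ^ k) * ?h m k)"
      unfolding Suc Suc.IH[symmetric] ..
    also have "\<dots> = (z ^ (m + Suc k) - z ^ k) * ?h m k"
      by (simp add: algebra_simps power_add)
    finally show ?thesis using 1 by simp
  qed
qed

lemma hbin_root_of_unity:
  fixes z :: "'k::idom"
  assumes "z ^ l = 1" and "\<And>k. 0 < k \<Longrightarrow> k < l \<Longrightarrow> z ^ k \<noteq> 1" and "0 < k" "k < l"
  shows "hbin (\<lambda>a. z ^ a) l k = 0"
proof -
  have "Suc k < l \<Longrightarrow> hbin (\<lambda>a. z ^ a) l (Suc k) = 0" for k
  proof (induction k)
    case 0
    then show ?case using hbin_power[where z = z and k = 0 and m = l] assms(1) assms(2)[of 1] by auto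
  next
    case (Suc k)
    then show ?case using hbin_power[where z = z and k = "Suc k" and m = l] assms(2)[of "Suc (Suc k)"] by auto
  qed
  from this[of "k - 1"] show ?thesis using assms(3,4) by simp
qed

lemma hbin_fps_nth_0: "fps_nth (hbin r m k) 0 = hbin (\<lambda>a. fps_nth (r a) 0) m k"
  by (induction r m k rule: hbin.induct) (simp_all add: fps_mult_nth_0)

lemma fps_nth_0_eq_0: "fps_nth f 0 = 0 \<Longrightarrow> \<exists>g. f = fps_X * (g :: 'k::comm_ring_1 fps)"
  by (rule exI[of _ "fps_shift 1 f"]) (simp add: fps_eq_iff)

lemma fps_prod_nth_0: "fps_nth (\<Prod>x\<in>A. f x) 0 = (\<Prod>x\<in>A. fps_nth (f x :: 'k::comm_ring_1 fps) 0)"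
  by (induction A rule: infinite_finite_induct) (simp_all add: fps_mult_nth_0)

text \<open>An algebra over power series without X-torsion: cancelling X is the substitute for
  dividing by a quantity that vanishes at the root of unity.\<close>

locale deformed_qalg = qalg scale q q' h
  for scale :: "complex fps \<Rightarrow> 'r::ring_1 \<Rightarrow> 'r" (infixr \<open>\<star>\<close> 75) and q q' h +
  fixes \<epsilon> :: complex and l :: nat
  assumes q_eq: "q = fps_const \<epsilon> + fps_X"
    and X_cancel: "fps_X \<star> A = 0 \<Longrightarrow> A = 0"
    and l: "1 < l" "odd l" "\<epsilon> ^ l = 1" "\<forall>k. 0 < k \<and> k < l \<longrightarrow> \<epsilon> ^ k \<noteq> 1"
begin

definition X_dvd :: "'r \<Rightarrow> bool" where
  "X_dvd A \<longleftrightarrow> (\<exists>B. A = fps_X \<star> B)"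

lemma X_dvd_add: "X_dvd A \<Longrightarrow> X_dvd B \<Longrightarrow> X_dvd (A + B)"
  unfolding X_dvd_def by (metis scale_right_distrib)

lemma X_dvd_mult_left: "X_dvd A \<Longrightarrow> X_dvd (B * A)"
  unfolding X_dvd_def by (metis scale_times_right)

lemma X_dvd_mult_right: "X_dvd A \<Longrightarrow> X_dvd (A * B)"
  unfolding X_dvd_def by (metis scale_times_left)

lemma X_dvd_scale: "X_dvd A \<Longrightarrow> X_dvd (c \<star> A)"
  unfolding X_dvd_def by (metis scale_left_commute)

lemma X_dvd_scale_0: "fps_nth c 0 = 0 \<Longrightarrow> X_dvd (c \<star> A)"
  unfolding X_dvd_def using fps_nth_0_eq_0[of c] by (metis scale_scale)

lemma X_dvd_sum: "(\<And>x. x \<in> S \<Longrightarrow> X_dvd (f x)) \<Longrightarrow> X_dvd (\<Sum>x\<in>S. f x)"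
proof -
  have "X_dvd 0" unfolding X_dvd_def by (rule exI[of _ 0]) simp
  then show "(\<And>x. x \<in> S \<Longrightarrow> X_dvd (f x)) \<Longrightarrow> X_dvd (\<Sum>x\<in>S. f x)"
    by (induction S rule: infinite_finite_induct) (auto intro: X_dvd_add)
qed

text \<open>This is \<open>q ^ m\<close> times the quantum integer [m], the scalar that appears when
  \<open>x\<close> is moved past \<open>y ^ m\<close>.\<close>

definition cfac :: "nat \<Rightarrow> complex fps" where
  "cfac m = (\<Sum>t<m. q ^ (2 * t + 1))"

lemma q_0: "fps_nth q 0 = \<epsilon>" and q'_0: "fps_nth q' 0 = inverse \<epsilon>" and \<epsilon>_nz: "\<epsilon> \<noteq> 0"
proof -
  show 1: "fps_nth q 0 = \<epsilon>" by (simp add: q_eq)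
  have "\<epsilon> * fps_nth q' 0 = 1" using qq' 1 by (metis fps_mult_nth_0 fps_one_nth)
  then show "fps_nth q' 0 = inverse \<epsilon>" "\<epsilon> \<noteq> 0" by (auto simp: inverse_unique)
qed

lemma cfac_mult: "cfac m * (q * q - 1) = q * ((q * q) ^ m - 1)"
  unfolding cfac_def by (induction m) (simp_all add: algebra_simps power_mult power_mult_distrib power2_eq_square)

lemma \<epsilon>2_ne_1: "\<epsilon> * \<epsilon> - 1 \<noteq> 0"
  using primitive_square(2)[OF l(2-4), of 1] l(1) by simp

lemma cfac_nz: "0 < m \<Longrightarrow> m < l \<Longrightarrow> fps_nth (cfac m) 0 \<noteq> 0"
proof
  assume m: "0 < m" "m < l" and "fps_nth (cfac m) 0 = 0"
  then have "fps_nth (q * ((q * q) ^ m - 1)) 0 = 0" using cfac_mult[of m] by (metis fps_mult_nth_0 mult_zero_left)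
  then have "(\<epsilon> * \<epsilon>) ^ m = 1" by (simp add: fps_mult_nth_0 q_0 \<epsilon>_nz fps_power_zeroth)
  then show False using primitive_square(2)[OF l(2-4) m] by simp
qed

text \<open>The zero at X = 0 is simple because the derivative of
  \<open>q * ((q * q) ^ l - 1)\<close> there is 2l, while \<open>q * q - 1\<close> has a nonzero
  constant term.\<close>

lemma cfac_l: "\<exists>u. cfac l = fps_X * u \<and> fps_nth u 0 \<noteq> 0"
proof -
  have "fps_nth (cfac l * (q * q - 1)) 0 = 0"
    unfolding cfac_mult using primitive_square(1)[OF l(2-4)] by (simp add: fps_mult_nth_0 q_0 fps_power_zeroth)
  then have "fps_nth (cfac l) 0 = 0" using \<epsilon>2_ne_1 by (simp add: fps_mult_nth_0 q_0)
  then obtain u where u: "cfac l = fps_X * u" using fps_nth_0_eq_0 by blast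
  have eq: "fps_X * u * (q * q - 1) = q * ((q * q) ^ l - 1)" using cfac_mult[of l] u by simp
  have "fps_nth (fps_deriv (fps_X * u * (q * q - 1))) 0 = fps_nth u 0 * (\<epsilon> * \<epsilon> - 1)"
    by (simp add: fps_mult_nth_0 q_0)
  moreover have "fps_nth (fps_deriv (q * ((q * q) ^ l - 1))) 0 = of_nat (2 * l)"
  proof -
    have "\<epsilon> * \<epsilon> ^ (l - Suc 0) = 1" using l(1,3) by (simp flip: power_Suc)
    moreover have "fps_deriv q = 1" by (simp add: q_eq)
    ultimately show ?thesis
      using l(3) by (simp add: fps_mult_nth_0 q_0 fps_deriv_power fps_power_zeroth algebra_simps)
  qed
  moreover have "(of_nat (2 * l) :: complex) \<noteq> 0" using l(1) by simp
  ultimately have "fps_nth u 0 \<noteq> 0" unfolding eq by auto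
  with u show ?thesis by blast
qed

context
  fixes x y w :: 'r
  assumes w: "w = qcomm x y" and xy: "srr x y = 0" and yx: "srr y x = 0"
begin

lemma root_commute:
  "x * y = q \<star> (y * x) + q \<star> w" "x * w = q' \<star> (w * x)" "y * w = q \<star> (w * y)"
proof -
  show "x * y = q \<star> (y * x) + q \<star> w"
    by (simp add: w qcomm_def expand)
  have "w * x = q \<star> (x * w)" using qcomm_left[of x y] xy w by simp
  then show "x * w = q' \<star> (w * x)" by (simp add: qq'_simps)
  show "y * w = q \<star> (w * y)" using qcomm_right[of x y] yx w by simp
qed

lemma x_power_y:
  "x * y ^ Suc m = q ^ Suc m \<star> (y ^ Suc m * x) + cfac (Suc m) \<star> (w * y ^ m)"
proof (induction m)
  case 0
  then show ?case using root_commute(1) by (simp add: cfac_def)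
next
  case (Suc m)
  have yw: "y ^ k * w = q ^ k \<star> (w * y ^ k)" for k
  proof (induction k)
    case (Suc k)
    have "y ^ Suc k * w = q ^ k \<star> ((y * w) * y ^ k)"
      by (simp add: mult.assoc Suc scale_times_right)
    then show ?case by (simp add: root_commute scale_times_left mult.assoc mult.commute)
  qed simp
  have y: "y ^ Suc m * y = y ^ Suc (Suc m)" "y ^ m * y = y ^ Suc m"
    by (simp_all only: power_Suc2)
  have "x * y ^ Suc (Suc m) = (x * y ^ Suc m) * y"
    by (metis mult.assoc power_Suc2)
  also have "\<dots> = q ^ Suc m \<star> (y ^ Suc m * (x * y)) + cfac (Suc m) \<star> (w * (y ^ m * y))"
    unfolding Suc by (simp only: expand)
  also have "y ^ Suc m * (x * y) = q \<star> (y ^ Suc (Suc m) * x) + (q * q ^ Suc m) \<star> (w * y ^ Suc m)"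
    unfolding root_commute(1) distrib_left scale_times_right mult.assoc[symmetric] yw y
    by (simp del: power_Suc)
  finally show ?case unfolding y
    by (simp add: expand cfac_def power_add[symmetric] algebra_simps mult_2_right flip: power_Suc power_Suc2)
qed

lemma x_power_w: "x * w ^ a = q' ^ a \<star> (w ^ a * x)"
proof (induction a)
  case (Suc a)
  have "x * w ^ Suc a = q' \<star> (w * (x * w ^ a))"
    by (simp add: root_commute(2) scale_times_left flip: mult.assoc)
  then show ?case by (simp add: Suc scale_times_right mult.assoc)
qed simp

text \<open>The scalar that \<open>x\<close> picks up on passing \<open>w ^ a * y ^ (l - a)\<close>.
  Subtracting this term in each commutator leaves the one where a factor \<open>y\<close> has been
  traded for \<open>w\<close>.\<close>

definition twist :: "nat \<Rightarrow> complex fps" where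
  "twist a = q ^ (l - a) * q' ^ a"

fun dd :: "'r \<Rightarrow> nat \<Rightarrow> 'r" where
  "dd A 0 = A"
| "dd A (Suc a) = x * dd A a - twist a \<star> (dd A a * x)"

lemma dd_power:
  "a \<le> l \<Longrightarrow> dd (y ^ l) a = (\<Prod>t<a. q' ^ t * cfac (l - t)) \<star> (w ^ a * y ^ (l - a))"
proof (induction a)
  case (Suc a)
  then obtain m where m: "l - a = Suc m" "l - Suc a = m" by (metis Suc_diff_Suc Suc_le_lessD)
  have "x * (w ^ a * y ^ Suc m) = q' ^ a \<star> (w ^ a * (x * y ^ Suc m))"
    by (simp add: x_power_w scale_times_left flip: mult.assoc)
  also have "\<dots> = (q' ^ a * q ^ Suc m) \<star> (w ^ a * y ^ Suc m * x)
      + (q' ^ a * cfac (Suc m)) \<star> (w ^ Suc a * y ^ m)"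
    unfolding x_power_y by (simp add: expand power_commutes flip: mult.assoc)
  finally have "x * (w ^ a * y ^ Suc m) - twist a \<star> (w ^ a * y ^ Suc m * x) =
      (q' ^ a * cfac (Suc m)) \<star> (w ^ Suc a * y ^ m)"
    by (simp add: twist_def m mult.commute)
  moreover have "dd (y ^ l) (Suc a) = (\<Prod>t<a. q' ^ t * cfac (l - t)) \<star>
      (x * (w ^ a * y ^ Suc m) - twist a \<star> (w ^ a * y ^ Suc m * x))"
    using Suc m by (simp add: expand mult.commute del: power_Suc)
  ultimately show ?case using m by (simp del: power_Suc)
qed simp

lemma dd_scale: "dd (c \<star> A) a = c \<star> dd A a"
  by (induction a) (simp_all add: expand mult.commute)

text \<open>Left and right multiplication by \<open>x\<close> commute, so the iterated commutator
  expands like the product of the factors \<open>1 - twist a * t\<close>, with t counting the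
  letters that go to the right.\<close>

lemma dd_expand: "dd A m = (\<Sum>k\<le>m. hbin twist m k \<star> (x ^ (m - k) * A * x ^ k))"
proof (induction m)
  case (Suc m)
  have x: "x ^ k * x = x ^ Suc k" for k by (simp add: power_commutes)
  have "dd A (Suc m) = (\<Sum>k\<le>m. hbin twist m k \<star> (x * (x ^ (m - k) * A * x ^ k)))
     - (\<Sum>k\<le>m. (twist m * hbin twist m k) \<star> (x ^ (m - k) * A * x ^ Suc k))"
    by (simp add: Suc sum_distrib_left sum_distrib_right scale_sum_right scale_times_left
        scale_times_right mult.assoc x del: power_Suc)
  also have "(\<Sum>k\<le>m. hbin twist m k \<star> (x * (x ^ (m - k) * A * x ^ k))) =
     (\<Sum>k\<le>Suc m. hbin twist m k \<star> (x ^ (Suc m - k) * A * x ^ k))"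
    by (simp add: hbin_eq_0 Suc_diff_le mult.assoc)
  also have "\<dots> = x ^ Suc m * A + (\<Sum>k\<le>m. hbin twist m (Suc k) \<star> (x ^ (m - k) * A * x ^ Suc k))"
    by (subst sum.atMost_Suc_shift) simp
  also have "x ^ Suc m * A + (\<Sum>k\<le>m. hbin twist m (Suc k) \<star> (x ^ (m - k) * A * x ^ Suc k))
     - (\<Sum>k\<le>m. (twist m * hbin twist m k) \<star> (x ^ (m - k) * A * x ^ Suc k))
     = x ^ Suc m * A + (\<Sum>k\<le>m. hbin twist (Suc m) (Suc k) \<star> (x ^ (Suc m - Suc k) * A * x ^ Suc k))"
    by (simp add: sum_subtractf scale_left_diff_distrib del: power_Suc)
  also have "\<dots> = (\<Sum>k\<le>Suc m. hbin twist (Suc m) k \<star> (x ^ (Suc m - k) * A * x ^ k))"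
    by (subst sum.atMost_Suc_shift) simp
  finally show ?case .
qed simp

text \<open>At X = 0 the twists are \<epsilon> to the power l - 2a, that is, the geometric
  progression of the inverse square of \<epsilon>, again of order l because l is odd.\<close>

lemma hbin_twist: "0 < k \<Longrightarrow> k < l \<Longrightarrow> fps_nth (hbin twist l k) 0 = 0"
proof -
  assume k: "0 < k" "k < l"
  let ?z = "inverse (\<epsilon> * \<epsilon>)"
  \<comment> \<open>Row l reads only the roots of index below l; beyond that the subtraction in
    \<open>twist\<close> is truncated and the comparison would fail.\<close>
  have hbin_cong: "hbin r m k = hbin s m k" if "\<And>a. a < m \<Longrightarrow> r a = s a" for r s :: "nat \<Rightarrow> complex" and m k
    using that by (induction r m k rule: hbin.induct) auto
  have twist: "fps_nth (twist a) 0 = ?z ^ a" if "a < l" for a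
  proof -
    have "\<epsilon> ^ (l - a) * \<epsilon> ^ a = 1" using that l(3) by (simp flip: power_add)
    then have "inverse (\<epsilon> ^ a) = \<epsilon> ^ (l - a)" by (intro inverse_unique) (simp add: mult.commute)
    then have "\<epsilon> ^ (l - a) = inverse \<epsilon> ^ a" by (simp add: power_inverse)
    then show ?thesis
      by (simp add: twist_def fps_mult_nth_0 fps_power_zeroth q_0 q'_0 power_mult_distrib)
  qed
  have "fps_nth (hbin twist l k) 0 = hbin (\<lambda>a. ?z ^ a) l k"
    unfolding hbin_fps_nth_0 by (rule hbin_cong[OF twist])
  also have "\<dots> = 0"
  proof (rule hbin_root_of_unity[OF _ _ k])
    show "?z ^ l = 1" using primitive_square(1)[OF l(2-4)] by (simp add: power_inverse del: inverse_mult_distrib)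
    show "?z ^ k \<noteq> 1" if "0 < k" "k < l" for k
      using primitive_square(2)[OF l(2-4) that] by (simp add: power_inverse del: inverse_mult_distrib)
  qed
  finally show ?thesis .
qed

text \<open>
  Modulo \<open>X\<close> the iterated twisted commutator \<open>dd A l\<close> collapses to \<open>x\<^sup>l A - A x\<^sup>l\<close>. For \<open>A = y\<^sup>l\<close> it is
  \<open>w\<^sup>l\<close> times a scalar with a simple zero at \<open>X = 0\<close>, which cancels against that of \<open>y\<^sup>l\<close>.
\<close>

lemma X_dvd_power_qcomm:
  assumes "X_dvd (x ^ l)" and "X_dvd (y ^ l)"
  shows "X_dvd (w ^ l)"
proof -
  obtain Y where Y: "y ^ l = fps_X \<star> Y" using assms(2) X_dvd_def by blast
  obtain u where u: "cfac l = fps_X * u" "fps_nth u 0 \<noteq> 0" using cfac_l by blast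
  \<comment> \<open>The factor at t = 0 contains \<open>cfac l\<close> and with it the only zero at
    X = 0; what is left is a unit.\<close>
  define U where "U = u * (\<Prod>t\<in>{1..<l}. q' ^ t * cfac (l - t))"
  have U: "(\<Prod>t<l. q' ^ t * cfac (l - t)) = fps_X * U"
  proof -
    have "{..<l} = insert 0 {1..<l}" using l(1) by auto
    then show ?thesis by (simp add: U_def u(1) mult.assoc)
  qed
  have "fps_nth U 0 \<noteq> 0"
    using u(2) cfac_nz \<epsilon>_nz by (auto simp: U_def fps_mult_nth_0 fps_prod_nth_0 fps_power_zeroth q'_0)
  then have inv: "inverse U * U = 1" by (rule inverse_mult_eq_1)
  have "fps_X \<star> dd Y l = dd (y ^ l) l" by (simp add: Y dd_scale)
  also have "\<dots> = (fps_X * U) \<star> w ^ l" using dd_power[of l] U by simp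
  finally have "fps_X \<star> (dd Y l - U \<star> w ^ l) = 0" by (simp add: scale_right_diff_distrib)
  then have "U \<star> w ^ l = dd Y l" using X_cancel by fastforce
  then have "w ^ l = inverse U \<star> dd Y l" using inv by (metis scale_one scale_scale)
  moreover have "X_dvd (dd Y l)"
    unfolding dd_expand
  proof (rule X_dvd_sum)
    fix k assume "k \<in> {..l}"
    then consider "k = 0" | "k = l" | "0 < k" "k < l" by fastforce
    then show "X_dvd (hbin twist l k \<star> (x ^ (l - k) * Y * x ^ k))"
    proof cases
      case 3
      then show ?thesis by (intro X_dvd_scale_0 hbin_twist)
    next
      case 1
      then show ?thesis using assms(1) by (auto intro: X_dvd_scale X_dvd_mult_right)
    next
      case 2
      then show ?thesis using assms(1) by (auto intro: X_dvd_scale X_dvd_mult_left)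
    qed
  qed
  ultimately show ?thesis by (simp add: X_dvd_scale)
qed

end

end

section \<open>Specialization of lattice operators at X = 0\<close>

text \<open>\<open>red A B\<close>: the operator \<open>A\<close> over power series becomes \<open>B\<close> at \<open>X = 0\<close>.\<close>

definition red :: "complex fps lop \<Rightarrow> complex lop \<Rightarrow> bool" where
  "red A B \<longleftrightarrow> (\<forall>f M. fps_nth (app A f M) 0 = app B (\<lambda>M. fps_nth (f M) 0) M)"

lemma red_mult: "red A A' \<Longrightarrow> red B B' \<Longrightarrow> red (A * B) (A' * B')"
  by (simp add: red_def)

lemma red_minus: "red A A' \<Longrightarrow> red B B' \<Longrightarrow> red (A - B) (A' - B')"
  by (simp add: red_def)

lemma red_power: "red A A' \<Longrightarrow> red (A ^ m) (A' ^ m)"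
  by (induction m) (auto intro: red_mult simp: red_def[of 1])

lemma red_sum: "(\<And>x. x \<in> S \<Longrightarrow> red (A x) (A' x)) \<Longrightarrow> red (\<Sum>x\<in>S. A x) (\<Sum>x\<in>S. A' x)"
  by (simp add: red_def app_sum fps_sum_nth)

lemma red_sc: "red (sc c) (sc (fps_nth c 0))"
  by (simp add: red_def fps_mult_nth_0)

lemma red_T: "(\<And>M. fps_nth (\<phi> M) 0 = \<psi> M) \<Longrightarrow> red (T y \<phi>) (T y \<psi>)"
  by (simp add: red_def fps_mult_nth_0)

lemma red_0_eq_0: "red 0 B \<Longrightarrow> B = 0"
proof (rule lop_eqI)
  fix f M
  assume "red 0 B"
  then have "fps_nth (app 0 (\<lambda>M. fps_const (f M)) M) 0 = app B (\<lambda>M. fps_nth (fps_const (f M)) 0) M"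
    unfolding red_def by blast
  then show "app B f M = app 0 f M" by simp
qed

lemma red_X_mult: "red (sc fps_X * A) B \<Longrightarrow> B = 0"
proof -
  assume "red (sc fps_X * A) B"
  then have "red 0 B" by (simp add: red_def fps_mult_nth_0)
  then show ?thesis by (rule red_0_eq_0)
qed

text \<open>All values have zero constant term and can be divided by X; homogeneity of the quotient
  over power series follows by cancelling X.\<close>

lemma red_0_imp_X_mult:
  assumes "red A 0"
  shows "\<exists>B. A = sc fps_X * B"
proof -
  define F where "F f M = fps_shift 1 (app A f M)" for f M
  have X: "fps_X * F f M = app A f M" for f M
    using assms by (simp add: F_def red_def fps_eq_iff)
  have "F (f + g) = F f + F g" for f g
    by (simp add: F_def fun_eq_iff app_add fps_shift_add)
  moreover have "F (\<lambda>M. c * f M) = (\<lambda>M. c * F f M)" for c f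
  proof
    fix M
    have "fps_X * F (\<lambda>M. c * f M) M = fps_X * (c * F f M)"
      unfolding X app_scale mult.left_commute[of fps_X] ..
    then show "F (\<lambda>M. c * f M) M = c * F f M" by simp
  qed
  ultimately have "app (Abs_lop F) = F" by (intro Abs_lop_inverse) auto
  then have "A = sc fps_X * Abs_lop F" by (intro lop_eqI) (simp add: X)
  then show ?thesis ..
qed

text \<open>Stated for any Serre family with a lift to power series, so that it serves both the e
  and the f.\<close>

locale deformation =
  C: serre_family "\<lambda>c A. sc c * (A :: complex lop)" \<epsilon> q0' h0 n f0 +
  P: serre_family "\<lambda>c A. sc c * (A :: complex fps lop)" q q' h n f
  for \<epsilon> q0' h0 n f0 q q' h f +
  fixes l :: nat
  assumes q_eq: "q = fps_const \<epsilon> + fps_X" and q0': "fps_nth q' 0 = q0'"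
    and l: "1 < l" "odd l" "\<epsilon> ^ l = 1" "\<forall>k. 0 < k \<and> k < l \<longrightarrow> \<epsilon> ^ k \<noteq> 1"
    and red_f: "red (f i) (f0 i)" and f0_power: "i \<in> {1..n} \<Longrightarrow> f0 i ^ l = 0"
begin

sublocale D: deformed_qalg "\<lambda>c A. sc c * (A :: complex fps lop)" q q' h \<epsilon> l
proof
  fix A :: "complex fps lop"
  assume A: "sc fps_X * A = 0"
  show "A = 0"
  proof (rule lop_eqI)
    fix f M
    have "app (sc fps_X * A) f M = 0" unfolding A by simp
    then show "app A f M = app 0 f M" by simp
  qed
qed (use q_eq l in auto)

lemma red_rv: "red (P.rv i d) (C.rv i d)"
proof (induction d arbitrary: i)
  case (Suc d)
  then show ?case
    using red_sc[of q'] by (auto simp: P.qcomm_def C.qcomm_def q0' intro!: red_minus red_mult red_f)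
qed (simp add: red_f)

text \<open>For generic q these l-th powers need not vanish; divisibility by X is the property that
  passes from the two factors of a bracket to the bracket.\<close>

lemma X_dvd_rv: "\<lbrakk>1 \<le> i; i + d \<le> n\<rbrakk> \<Longrightarrow> D.X_dvd (P.rv i d ^ l)"
proof (induction d arbitrary: i)
  case 0
  then have "red (P.rv i 0 ^ l) 0" using red_power[OF red_f[of i], of l] f0_power[of i] by simp
  then show ?case unfolding D.X_dvd_def by (rule red_0_imp_X_mult)
next
  case (Suc d)
  have "red (f i ^ l) 0" using Suc.prems red_power[OF red_f[of i], of l] f0_power[of i] by simp
  then have "D.X_dvd (f i ^ l)" unfolding D.X_dvd_def by (rule red_0_imp_X_mult)
  moreover have "D.X_dvd (P.rv (Suc i) d ^ l)" using Suc by simp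
  moreover have "P.srr (f i) (P.rv (Suc i) d) = 0" "P.srr (P.rv (Suc i) d) (f i) = 0"
    using Suc.prems by (auto intro!: P.srr_e_rv P.srr_rv_e)
  ultimately show ?case using D.X_dvd_power_qcomm[OF refl] by simp
qed

lemma rv_power: "\<lbrakk>1 \<le> i; i + d \<le> n\<rbrakk> \<Longrightarrow> C.rv i d ^ l = 0"
proof -
  assume "1 \<le> i" "i + d \<le> n"
  then obtain B where "P.rv i d ^ l = sc fps_X * B" using X_dvd_rv D.X_dvd_def by blast
  then have "red (sc fps_X * B) (C.rv i d ^ l)" using red_power[OF red_rv] by metis
  then show ?thesis by (rule red_X_mult)
qed

end

section \<open>The duality exchanging the two halves of the representation\<close>

text \<open>
  Under this symmetry of the lattice the formula for \<open>f\<^sub>i\<close> becomes that for \<open>e\<^sub>j\<close> with \<open>i + j = n + 1\<close>,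
  up to a shift of the exponents.
\<close>

definition flip :: "nat \<Rightarrow> lat \<Rightarrow> lat" where
  "flip n M = (\<lambda>(i, k). if (i, k) \<in> positions n then - M (k + 1 - i, k) else M (i, k))"

lemma flip_flip [simp]: "flip n (flip n M) = M"
  by (auto simp: flip_def positions_def fun_eq_iff)

lemma flip_add: "flip n (M + N) = flip n M + flip n N"
  and flip_diff: "flip n (M - N) = flip n M - flip n N"
  by (auto simp: flip_def fun_eq_iff)

lift_definition conj_flip :: "nat \<Rightarrow> 'k::comm_ring_1 lop \<Rightarrow> 'k lop" is
  "\<lambda>n F f M. F (\<lambda>N. f (flip n N)) (flip n M)"
proof -
  fix n and F :: "(lat \<Rightarrow> 'k) \<Rightarrow> lat \<Rightarrow> 'k"
  assume *: "(\<forall>f g. F (f + g) = F f + F g) \<and> (\<forall>c f. F (\<lambda>M. c * f M) = (\<lambda>M. c * F f M))"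
  have 1: "F ((\<lambda>N. f (flip n N)) + (\<lambda>N. g (flip n N))) = F (\<lambda>N. f (flip n N)) + F (\<lambda>N. g (flip n N))" for f g
    using * by blast
  have 2: "F (\<lambda>N. c * f (flip n N)) = (\<lambda>M. c * F (\<lambda>N. f (flip n N)) M)" for c f
    by (rule conjunct2[OF *, rule_format])
  have 3: "(\<lambda>N. (f + g) (flip n N)) = (\<lambda>N. f (flip n N)) + (\<lambda>N. g (flip n N))" for f g :: "lat \<Rightarrow> 'k"
    by (rule ext) simp
  show "(\<forall>f g. (\<lambda>M. F (\<lambda>N. (f + g) (flip n N)) (flip n M)) =
      (\<lambda>M. F (\<lambda>N. f (flip n N)) (flip n M)) + (\<lambda>M. F (\<lambda>N. g (flip n N)) (flip n M))) \<and>
    (\<forall>c f. (\<lambda>M. F (\<lambda>N. c * f (flip n N)) (flip n M)) = (\<lambda>M. c * F (\<lambda>N. f (flip n N)) (flip n M)))"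
    unfolding 3 1 2 by (simp add: plus_fun_def)
qed

lemma app_conj_flip [simp]: "app (conj_flip n A) f = (\<lambda>M. app A (\<lambda>N. f (flip n N)) (flip n M))"
  by transfer simp

lemma conj_flip_simps:
  "conj_flip n (A * B) = conj_flip n A * conj_flip n B"
  "conj_flip n (A + B) = conj_flip n A + conj_flip n B"
  "conj_flip n (A - B) = conj_flip n A - conj_flip n B"
  "conj_flip n 0 = 0" "conj_flip n 1 = 1" "conj_flip n (sc c) = sc c"
  by (rule lop_eqI; simp)+

lemma conj_flip_power: "conj_flip n (A ^ m) = conj_flip n A ^ m"
  by (induction m) (simp_all add: conj_flip_simps)

lemma conj_flip_sum: "conj_flip n (\<Sum>x\<in>S. A x) = (\<Sum>x\<in>S. conj_flip n (A x))"
  by (induction S rule: infinite_finite_induct) (simp_all add: conj_flip_simps)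

lemma conj_flip_T: "conj_flip n (T y \<phi>) = T (flip n y) (\<lambda>M. \<phi> (flip n M))"
  by (rule lop_eqI) (simp add: flip_diff)

lemma red_conj_flip: "red A B \<Longrightarrow> red (conj_flip n A) (conj_flip n B)"
  by (simp add: red_def)

text \<open>The exponents of e change under the shifts of f only on two adjacent antidiagonals with
  \<open>k = k'\<close>. Hence almost all terms of the commutator of e and f are 0.\<close>

lemma cx_flip_yv:
  assumes "(i, k) \<in> positions n" and "(j, k') \<in> positions n"
  shows "cx n i k (flip n (yv n j k')) =
    (if k = k' \<and> i + j = k + 1 then - 1 else if k = k' \<and> i + j = k then 1 else 0)"
proof -
  have e: "ext n (flip n (yv n j k')) a b =
      (if (a, b) \<in> positions n \<and> b + 1 = a + j \<and> k' \<le> b then - 1 else 0)" for a b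
    by (auto simp: ext_def flip_def yv_def positions_def)
  have pos: "1 \<le> i" "i \<le> k" "k \<le> n" "1 \<le> j" "j \<le> k'" "k' \<le> n"
    using assms by (auto simp: positions_def)
  have "ext n (flip n (yv n j k')) i k = (if k + 1 = i + j \<and> k' \<le> k then - 1 else 0)"
    "ext n (flip n (yv n j k')) i (k - 1) = (if k = i + j \<and> k' < k then - 1 else 0)"
    "ext n (flip n (yv n j k')) (i - 1) (k - 1) = (if k + 1 = i + j \<and> k' < k then - 1 else 0)"
    "ext n (flip n (yv n j k')) (i + 1) k = (if k = i + j \<and> k' \<le> k then - 1 else 0)"
    unfolding e positions_def mem_Collect_eq prod.case using pos
    by (intro if_cong refl; linarith)+
  then show ?thesis unfolding cx_def by auto
qed

context lattice_rep
begin

definition fl :: "nat \<Rightarrow> 'k lop" where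
  "fl i = conj_flip n (e (n + 1 - i))"

sublocale fl: serre_family "\<lambda>c A. sc c * (A::'k lop)" q q' h n fl
proof
  have srr: "srr (conj_flip n A) (conj_flip n B) = conj_flip n (srr A B)" for A B
    by (simp add: srr_def conj_flip_simps)
  fix i
  assume i: "i \<in> {1..n}"
  {
    fix j
    assume "j \<in> {1..n}" "i + 2 \<le> j"
    then have "e (n + 1 - j) * e (n + 1 - i) = e (n + 1 - i) * e (n + 1 - j)"
      by (intro e_far) auto
    then show "fl i * fl j = fl j * fl i" by (simp add: fl_def flip: conj_flip_simps)
  }
  assume "Suc i \<in> {1..n}"
  then have "n + 1 - i = Suc (n + 1 - Suc i)" "1 \<le> n + 1 - Suc i" by auto
  then show "srr (fl i) (fl (Suc i)) = 0" "srr (fl (Suc i)) (fl i) = 0"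
    using e_serre[of "n + 1 - Suc i"] by (simp_all add: fl_def srr conj_flip_simps)
qed

lemma fl_eq: "fl i = (\<Sum>k=n+1-i..n. T (flip n (yv n (n + 1 - i) k))
    (\<lambda>M. br (cx n (n + 1 - i) k (flip n M) + mu (n + 1 - i))))"
  by (simp add: fl_def e_def conj_flip_sum conj_flip_T)

end

section \<open>The lattice operators at a root of unity\<close>

locale cyclic_family =
  fixes \<epsilon> :: complex and l n :: nat and mu :: "nat \<Rightarrow> int"
  assumes l: "1 < l" "odd l" "\<epsilon> ^ l = 1" "\<forall>k. 0 < k \<and> k < l \<longrightarrow> \<epsilon> ^ k \<noteq> 1"
begin

lemma \<epsilon>_nz: "\<epsilon> \<noteq> 0"
  using l(1,3) by (auto simp: power_0_left)

lemma diff_nz: "\<epsilon> - inverse \<epsilon> \<noteq> 0"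
proof
  assume "\<epsilon> - inverse \<epsilon> = 0"
  then have "\<epsilon> * \<epsilon> = 1" using \<epsilon>_nz by (simp add: field_simps)
  then show False using primitive_square(2)[OF l(2-4), of 1] l(1) by simp
qed

lemma sum_nz: "\<epsilon> + inverse \<epsilon> \<noteq> 0"
proof
  assume "\<epsilon> + inverse \<epsilon> = 0"
  then have "\<epsilon> * \<epsilon> = - 1" using \<epsilon>_nz by (simp add: field_simps eq_neg_iff_add_eq_0)
  then have "(\<epsilon> * \<epsilon>) ^ 2 = 1" by simp
  moreover have "2 < l" using l(1,2) by (cases "l = 2") auto
  ultimately show False using primitive_square(2)[OF l(2-4), of 2] by simp
qed

sublocale lattice_rep \<epsilon> "inverse \<epsilon>" "inverse (\<epsilon> + inverse \<epsilon>)" "inverse (\<epsilon> - inverse \<epsilon>)" n mu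
  by standard (use \<epsilon>_nz diff_nz sum_nz in auto)

lemma qp_eq: "qp z = \<epsilon> powi z"
  by (simp add: qp_def power_int_def)

lemma qp_eq_1_iff: "qp z = 1 \<longleftrightarrow> int l dvd z"
proof -
  have "qp z = qp (int l * (z div int l)) * qp (z mod int l)"
    by (simp flip: qp_add)
  also have "\<dots> = \<epsilon> ^ nat (z mod int l)"
    by (subst qp_multiple[OF l(3)]) (use l(1) in \<open>simp add: qp_def\<close>)
  finally have eq: "qp z = \<epsilon> ^ nat (z mod int l)" .
  have less: "nat (z mod int l) < l" using l(1) by (simp add: nat_less_iff)
  show ?thesis
  proof (cases "z mod int l = 0")
    case True
    then show ?thesis using eq by (simp add: dvd_eq_mod_eq_0)
  next
    case False
    moreover have "0 \<le> z mod int l" using l(1) by simp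
    ultimately have "0 < nat (z mod int l)" by linarith
    then show ?thesis using l(4) less eq False by (auto simp: dvd_eq_mod_eq_0)
  qed
qed

text \<open>The bracket vanishes when \<epsilon> to the power 2z is 1; the factor 2 is invertible
  modulo the odd l.\<close>

lemma br_eq_0_iff: "br z = 0 \<longleftrightarrow> int l dvd z"
proof -
  have "br z = 0 \<longleftrightarrow> qp z = qp (- z)" using diff_nz by (simp add: br_def)
  also have "\<dots> \<longleftrightarrow> qp (z + z) = 1"
    using qp_inverse[of z] by (metis mult_cancel_left mult_zero_left qp_add zero_neq_one)
  also have "\<dots> \<longleftrightarrow> int l dvd 2 * z" by (simp add: qp_eq_1_iff)
  also have "\<dots> \<longleftrightarrow> int l dvd z"
    using l(2) by (intro coprime_dvd_mult_right_iff) simp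
  finally show ?thesis .
qed

lemma e_nilpotent: "1 \<le> i \<Longrightarrow> e i ^ l = 0"
  by (rule e_power_l[OF l(3,2)])
    (auto intro!: gbin_root_of_unity primitive_square(1)[OF l(2-4)] dest: primitive_square(2)[OF l(2-4)])

abbreviation (input) qX :: "complex fps" where "qX \<equiv> fps_const \<epsilon> + fps_X"

text \<open>All three series inverted here are units because their constant terms, known from the
  undeformed case, are nonzero.\<close>

lemma deformed: "lattice_rep qX (inverse qX) (inverse (qX + inverse qX)) (inverse (qX - inverse qX))"
  by standard (use \<epsilon>_nz diff_nz sum_nz in \<open>auto simp: mult.commute[of qX] inverse_mult_eq_1\<close>)

lemma deformed_e: 
  "red (lattice_rep.e qX (inverse qX) (inverse (qX - inverse qX)) n mu i) (e i)"
proof -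
  interpret P: lattice_rep qX "inverse qX" "inverse (qX + inverse qX)" "inverse (qX - inverse qX)" n mu
    by (rule deformed)
  have qp: "fps_nth (P.qp z) 0 = qp z" for z
    by (simp add: P.qp_def qp_def fps_power_zeroth)
  have "fps_nth (P.br z) 0 = br z" for z
    by (simp add: P.br_def br_def qp fps_mult_nth_0)
  then show ?thesis unfolding P.e_def e_def by (intro red_sum red_T)
qed

lemma rv_power:
  assumes "1 \<le> i" "i + d \<le> n"
  shows "rv i d ^ l = 0" "fl.rv i d ^ l = 0"
proof -
  interpret P: lattice_rep qX "inverse qX" "inverse (qX + inverse qX)" "inverse (qX - inverse qX)" n mu
    by (rule deformed)
  interpret D: deformation \<epsilon> "inverse \<epsilon>" "inverse (\<epsilon> + inverse \<epsilon>)" n e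
      qX "inverse qX" "inverse (qX + inverse qX)" P.e l
    by unfold_locales (use l deformed_e e_nilpotent in auto)
  show "rv i d ^ l = 0" using D.rv_power[OF assms] .
  interpret D': deformation \<epsilon> "inverse \<epsilon>" "inverse (\<epsilon> + inverse \<epsilon>)" n fl
      qX "inverse qX" "inverse (qX + inverse qX)" P.fl l
  proof unfold_locales
    fix i
    show "red (P.fl i) (fl i)" unfolding P.fl_def fl_def by (intro red_conj_flip deformed_e)
    show "i \<in> {1..n} \<Longrightarrow> fl i ^ l = 0"
      using e_nilpotent[of "n + 1 - i"] by (auto simp: fl_def conj_flip_simps simp flip: conj_flip_power)
  qed (use l in auto)
  show "fl.rv i d ^ l = 0" using D'.rv_power[OF assms] .
qed

end

section \<open>Singular vectors\<close>

text \<open>The forms \<open>cx\<close> are unitriangular in the coordinates: the three entries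
  other than \<open>(i, k)\<close> have a smaller value of \<open>2 * k - i\<close>.\<close>

lemma dvd_cx_imp_dvd:
  assumes "\<And>i k. (i, k) \<in> positions n \<Longrightarrow> m dvd cx n i k M"
  shows "m dvd ext n M i k"
proof (induction "2 * k - i" arbitrary: i k rule: less_induct)
  case less
  show ?case
  proof (cases "(i, k) \<in> positions n")
    case True
    then have ik: "1 \<le> i" "i \<le> k" "k \<le> n" by (auto simp: positions_def)
    have "m dvd ext n M i (k - 1)" "m dvd ext n M (i - 1) (k - 1)" "m dvd ext n M (i + 1) k"
      using ik by (auto intro!: less)
    then have "m dvd cx n i k M - ext n M i (k - 1) + ext n M (i - 1) (k - 1) + ext n M (i + 1) k"
      using assms[OF True] by (intro dvd_add dvd_diff)
    then show ?thesis by (simp add: cx_def)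
  qed (simp add: ext_def)
qed

lemma sum_digits_less: "0 < b \<Longrightarrow> (\<Sum>j<m. (b - 1) * b ^ j) < (b :: nat) ^ m"
proof (induction m)
  case (Suc m)
  obtain c where "b = Suc c" using Suc.prems by (cases b) auto
  then show ?case using Suc by simp
qed simp

text \<open>Comparison of numerals in base \<open>b\<close>: one digit rises by one, and all less
  significant digits of \<open>a\<close> together are worth less than that, whatever replaces them
  in \<open>c\<close>.\<close>

lemma digits_less:
  fixes a c w :: "'x \<Rightarrow> nat"
  assumes "finite A" "inj_on w A" "p \<in> A" "c p = a p + 1"
    and "\<And>x. x \<in> A \<Longrightarrow> a x < b" and "\<And>x. x \<in> A \<Longrightarrow> w p < w x \<Longrightarrow> c x = a x"
  shows "(\<Sum>x\<in>A. a x * b ^ w x) < (\<Sum>x\<in>A. c x * b ^ w x)"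
proof -
  define Hi Lo where "Hi = {x\<in>A. w p < w x}" and "Lo = {x\<in>A. w x < w p}"
  have split: "(\<Sum>x\<in>A. g x) = (\<Sum>x\<in>Hi. g x) + (g p + (\<Sum>x\<in>Lo. g x))" for g :: "'x \<Rightarrow> nat"
  proof -
    have "x = p \<or> w p < w x \<or> w x < w p" if "x \<in> A" for x
      using inj_onD[OF assms(2) _ that assms(3)] by linarith
    then have "A = Hi \<union> insert p Lo" using assms(3) by (auto simp: Hi_def Lo_def)
    moreover have "finite Hi" "finite Lo" "Hi \<inter> insert p Lo = {}" "p \<notin> Lo"
      using assms(1) by (auto simp: Hi_def Lo_def)
    ultimately show ?thesis by (simp add: sum.union_disjoint)
  qed
  have "0 < b" using assms(5)[OF assms(3)] by linarith
  have "a x \<le> b - 1" if "x \<in> Lo" for x using assms(5)[of x] that by (simp add: Lo_def)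
  then have "(\<Sum>x\<in>Lo. a x * b ^ w x) \<le> (\<Sum>x\<in>Lo. (b - 1) * b ^ w x)"
    by (intro sum_mono mult_right_mono) auto
  also have "\<dots> = (\<Sum>j\<in>w ` Lo. (b - 1) * b ^ j)"
    using assms(2) by (subst sum.reindex) (auto simp: Lo_def inj_on_def)
  also have "\<dots> \<le> (\<Sum>j<w p. (b - 1) * b ^ j)"
    by (intro sum_mono2) (auto simp: Lo_def)
  also have "\<dots> < b ^ w p" using \<open>0 < b\<close> by (rule sum_digits_less)
  finally have "(\<Sum>x\<in>Lo. a x * b ^ w x) < b ^ w p" .
  moreover have "(\<Sum>x\<in>Hi. a x * b ^ w x) = (\<Sum>x\<in>Hi. c x * b ^ w x)"
    using assms(6) by (intro sum.cong) (auto simp: Hi_def)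
  ultimately show ?thesis unfolding split using assms(4) by (simp add: algebra_simps)
qed

locale cyclic_family_0 = cyclic_family \<epsilon> l n "\<lambda>_. 0" for \<epsilon> l n
begin

lemma app_e: "app (e i) g N = (\<Sum>k=i..n. br (cx n i k (N - yv n i k)) * g (N - yv n i k))"
  by (simp add: e_def app_sum)

text \<open>Induction from \<open>i = n\<close> downwards. At \<open>N = M + yv n i k\<close> the
  summand \<open>k\<close> of \<open>e i\<close> reads \<open>g M\<close>. If another summand
  \<open>k'\<close> read a nonzero value, the divisibility already known for \<open>i + 1\<close>
  would hold at two points on which a form differs by 1. So one summand is left, and its bracket
  must vanish.\<close>

lemma singular_support:
  assumes sing: "\<And>i. i \<in> {1..n} \<Longrightarrow> app (e i) g = (\<lambda>M. 0)"
    and "g M \<noteq> 0" "(i, k) \<in> positions n"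
  shows "int l dvd cx n i k M"
  using assms(2,3)
proof (induction "n - i" arbitrary: i k M rule: less_induct)
  case less
  then have ik: "1 \<le> i" "i \<le> k" "k \<le> n" by (auto simp: positions_def)
  define N where "N = M + yv n i k"
  have other: "g (N - yv n i k') = 0" if k': "k' \<in> {i..n}" "k' \<noteq> k" for k'
  proof (rule ccontr)
    assume g: "g (N - yv n i k') \<noteq> 0"
    \<comment> \<open>With this index, \<open>yv n i k\<close> and \<open>yv n i k'\<close> have
      pairings 0 and -1, in some order, with the form \<open>cx n (Suc i) m\<close>.\<close>
    define m where "m = max k k'"
    have m: "(Suc i, m) \<in> positions n" "n - Suc i < n - i"
      using ik k' by (auto simp: m_def positions_def)
    have dvd: "int l dvd cx n (Suc i) m (N - yv n i k')" "int l dvd cx n (Suc i) m M"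
      using less.hyps[OF m(2)] g less.prems m(1) by blast+
    have "cx n (Suc i) m (N - yv n i k') + cx n (Suc i) m (yv n i k') =
        cx n (Suc i) m M + cx n (Suc i) m (yv n i k)"
      by (simp add: N_def flip: cx_add)
    moreover have "cx n (Suc i) m (yv n i k') = om (Suc i) m i k'"
      "cx n (Suc i) m (yv n i k) = om (Suc i) m i k"
      using ik k' m by (auto intro!: cx_yv simp: positions_def)
    ultimately have "om (Suc i) m i k - om (Suc i) m i k' = cx n (Suc i) m (N - yv n i k') - cx n (Suc i) m M"
      by linarith
    then have "int l dvd om (Suc i) m i k - om (Suc i) m i k'" by (simp only: dvd_diff dvd)
    then have "int l dvd 1" using k' by (auto simp: om_def m_def max_def split: if_splits)
    then show False using l(1) by simp
  qed
  have "0 = app (e i) g N" using sing[of i] ik by simp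
  also have "\<dots> = (\<Sum>k'\<in>{k}. br (cx n i k' (N - yv n i k')) * g (N - yv n i k'))"
    unfolding app_e by (rule sum.mono_neutral_right) (use ik other in auto)
  finally have "br (cx n i k M) * g M = 0" by (simp add: N_def)
  then show ?case using less.prems by (simp add: br_eq_0_iff)
qed

lemma singular_support_0:
  assumes "\<And>i. i \<in> {1..n} \<Longrightarrow> app (e i) g = (\<lambda>M. 0)" and "g M \<noteq> 0" and "p \<in> positions n"
  shows "int l dvd M p"
proof -
  obtain i k where p: "p = (i, k)" by (cases p)
  have "int l dvd ext n M i k"
    using singular_support[OF assms(1,2)] by (rule dvd_cx_imp_dvd)
  then show ?thesis using assms(3) by (simp add: p ext_def)
qed

text \<open>
  A basis vector is ranked by its digits \<open>c\<^sub>i\<^sub>k - 1\<close> modulo \<open>l\<close>, the most significant ones being those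
  with small \<open>k\<close> and then large \<open>i\<close>: a term of \<open>e i\<close> that moves it increments one digit without
  carry and only disturbs less significant ones.
\<close>

definition weight :: "nat \<times> nat \<Rightarrow> nat" where
  "weight = (\<lambda>(i, k). (n - k) * (n + 1) + i)"

definition digit :: "lat \<Rightarrow> nat \<times> nat \<Rightarrow> nat" where
  "digit M = (\<lambda>(i, k). nat ((cx n i k M - 1) mod int l))"

definition height :: "lat \<Rightarrow> nat" where
  "height M = (\<Sum>p\<in>positions n. digit M p * l ^ weight p)"

lemma finite_positions: "finite (positions n)"
  by (rule finite_subset[of _ "{1..n} \<times> {1..n}"]) (auto simp: positions_def)

lemma digit_less: "digit M p < l"
  using l(1) by (cases p) (simp add: digit_def nat_less_iff)

lemma weight_less:
  assumes "(i, k) \<in> positions n" "(j, k') \<in> positions n"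
  shows "weight (i, k) < weight (j, k') \<longleftrightarrow> k' < k \<or> k' = k \<and> i < j"
proof -
  have lt: "a * (n + 1) + x < b * (n + 1) + y" if "a < b" "x \<le> n" for a b x y
  proof -
    have "(a + 1) * (n + 1) \<le> b * (n + 1)" using that by (intro mult_right_mono) auto
    then show ?thesis using that by simp
  qed
  have le: "i \<le> n" "j \<le> n" "k \<le> n" "k' \<le> n" using assms by (auto simp: positions_def)
  show ?thesis
  proof (cases k k' rule: linorder_cases)
    case less
    then have "n - k' < n - k" using le by linarith
    then show ?thesis using lt[of "n - k'" "n - k" j i] le less by (simp add: weight_def)
  next
    case greater
    then have "n - k < n - k'" using le by linarith
    then show ?thesis using lt[of "n - k" "n - k'" i j] le greater by (simp add: weight_def)
  qed (simp add: weight_def)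
qed

lemma inj_weight: "inj_on weight (positions n)"
proof (rule inj_onI)
  fix p p' assume *: "p \<in> positions n" "p' \<in> positions n" "weight p = weight p'"
  obtain i k j k' where "p = (i, k)" "p' = (j, k')" by (cases p; cases p')
  then show "p = p'" using * weight_less[of i k j k'] weight_less[of j k' i k] by auto
qed

text \<open>The excluded case, \<open>cx\<close> divisible by l, is the one where the digit is l - 1
  and raising it would carry. More significant digits are unchanged because their entry in
  \<open>om\<close> is 0.\<close>

lemma height_less:
  assumes p: "(i, k) \<in> positions n" and c: "\<not> int l dvd cx n i k M"
  shows "height M < height (M + yv n i k)"
  unfolding height_def
proof (rule digits_less[where p = "(i, k)"])
  have cxM: "cx n j k' (M + yv n i k) = cx n j k' M + om j k' i k" if "(j, k') \<in> positions n" for j k'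
    using that p by (simp add: cx_add cx_yv)
  have "cx n i k M mod int l \<noteq> 0" using c by (simp add: dvd_eq_mod_eq_0)
  moreover have "0 \<le> cx n i k M mod int l" "cx n i k M mod int l < int l" using l(1) by simp_all
  ultimately have "(cx n i k M - 1) mod int l = cx n i k M mod int l - 1"
    by (smt (verit) mod_diff_left_eq mod_pos_pos_trivial)
  then show "digit (M + yv n i k) (i, k) = digit M (i, k) + 1"
    using cxM[OF p] \<open>cx n i k M mod int l \<noteq> 0\<close> \<open>0 \<le> cx n i k M mod int l\<close>
    by (simp add: digit_def om_def nat_diff_distrib)
  fix x
  assume x: "x \<in> positions n" "weight (i, k) < weight x"
  obtain j k' where jk: "x = (j, k')" by (cases x)
  have "k' < k \<or> k' = k \<and> i < j" using weight_less[of i k j k'] p x jk by simp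
  then have "om j k' i k = 0" by (auto simp: om_def)
  then show "digit (M + yv n i k) x = digit M x" using cxM[of j k'] x jk by (simp add: digit_def)
qed (use p finite_positions inj_weight digit_less in auto)

lemma singular_vector_exists:
  assumes S: "\<And>g i. g \<in> S \<Longrightarrow> i \<in> {1..n} \<Longrightarrow> app (e i) g \<in> S"
    and g: "g \<in> S" "g \<noteq> (\<lambda>M. 0)"
  shows "\<exists>g\<in>S. g \<noteq> (\<lambda>M. 0) \<and> (\<forall>i\<in>{1..n}. app (e i) g = (\<lambda>M. 0))"
proof -
  \<comment> \<open>Heights are bounded, so there is a greatest lower bound \<open>h\<close>
    attained by a nonzero element; any nonzero image under \<open>e i\<close> would improve
    it.\<close>
  define Q where "Q h \<longleftrightarrow> (\<exists>g\<in>S. g \<noteq> (\<lambda>M. 0) \<and> (\<forall>M. g M \<noteq> 0 \<longrightarrow> h \<le> height M))" for h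
  have "Q 0" using g by (auto simp: Q_def)
  moreover have "h \<le> (\<Sum>p\<in>positions n. l * l ^ weight p)" if "Q h" for h
  proof -
    obtain g :: "lat \<Rightarrow> complex" and M where "g M \<noteq> 0" "\<forall>M. g M \<noteq> 0 \<longrightarrow> h \<le> height M"
      using \<open>Q h\<close> unfolding Q_def fun_eq_iff by blast
    then have "h \<le> height M" by blast
    also have "\<dots> \<le> (\<Sum>p\<in>positions n. l * l ^ weight p)"
      unfolding height_def by (intro sum_mono mult_right_mono less_imp_le digit_less) (use l(1) in auto)
    finally show ?thesis .
  qed
  ultimately obtain h where h: "Q h" "\<And>h'. Q h' \<Longrightarrow> h' \<le> h"
    using Nat.ex_has_greatest_nat[of Q 0 "\<Sum>p\<in>positions n. l * l ^ weight p"] by auto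
  then obtain g where g: "g \<in> S" "g \<noteq> (\<lambda>M. 0)" "\<And>M. g M \<noteq> 0 \<Longrightarrow> h \<le> height M"
    unfolding Q_def by blast
  have "app (e i) g = (\<lambda>M. 0)" if i: "i \<in> {1..n}" for i
  proof (rule ccontr)
    assume nz: "app (e i) g \<noteq> (\<lambda>M. 0)"
    have "Suc h \<le> height N" if "app (e i) g N \<noteq> 0" for N
    proof -
      from that[unfolded app_e] obtain k where k: "k \<in> {i..n}" "br (cx n i k (N - yv n i k)) * g (N - yv n i k) \<noteq> 0"
        by (rule sum.not_neutral_contains_not_neutral)
      then have "h \<le> height (N - yv n i k)" using g(3) by simp
      also have "\<dots> < height (N - yv n i k + yv n i k)"
        using k i by (intro height_less) (auto simp: br_eq_0_iff positions_def)
      finally show ?thesis by simp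
    qed
    then have "Q (Suc h)" using nz S[OF g(1) i] unfolding Q_def by blast
    then show False using h(2) by fastforce
  qed
  then show ?thesis using g by blast
qed

end

section \<open>Commutation relations on the lattice\<close>

lemma ext_flip: "a \<le> b + 1 \<Longrightarrow> ext n (flip n M) a b = - ext n M (b + 1 - a) b"
  by (auto simp: ext_def flip_def positions_def)

lemma cx_flip:
  assumes "(j, k) \<in> positions n"
  shows "cx n j k (flip n M) =
    ext n M (k + 1 - j) (k - 1) + ext n M (k - j) k - ext n M (k + 1 - j) k - ext n M (k - j) (k - 1)"
proof -
  have jk: "1 \<le> j" "j \<le> k" using assms by (auto simp: positions_def)
  then have "ext n (flip n M) j k = - ext n M (k + 1 - j) k"
    "ext n (flip n M) j (k - 1) = - ext n M (k - j) (k - 1)"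
    "ext n (flip n M) (j - 1) (k - 1) = - ext n M (k + 1 - j) (k - 1)"
    "ext n (flip n M) (j + 1) k = - ext n M (k - j) k"
    using ext_flip[of j k n M] ext_flip[of j "k - 1" n M] ext_flip[of "j - 1" "k - 1" n M]
      ext_flip[of "j + 1" k n M] by (simp_all add: Suc_diff_le)
  then show ?thesis by (simp add: cx_def)
qed

text \<open>The non-constant part of the exponent of \<epsilon> in \<open>t_i\<close>; on the shifts
  of e and f it takes the Cartan integers up to sign.\<close>

definition tau :: "nat \<Rightarrow> nat \<Rightarrow> lat \<Rightarrow> int" where
  "tau n i M = 2 * ext n M i n - ext n M (i - 1) n - ext n M (i + 1) n"

lemma tau_add: "tau n i (M + N) = tau n i M + tau n i N"
  by (simp add: tau_def ext_def)

lemma tau_yv: "i \<in> {1..n} \<Longrightarrow> (j, k) \<in> positions n \<Longrightarrow> tau n i (yv n j k) = cartan i j"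
  by (auto simp: tau_def ext_def yv_def cartan_def positions_def)

lemma tau_flip_yv:
  assumes i: "i \<in> {1..n}" and j: "j \<in> {1..n}" and k: "(n + 1 - j, k) \<in> positions n"
  shows "tau n i (flip n (yv n (n + 1 - j) k)) = - cartan i j"
proof -
  have "ext n (yv n (n + 1 - j) k) (n + 1 - a) n = (if a = j then 1 else 0)" if "a \<le> n + 1" for a
    using that j k by (auto simp: ext_def yv_def positions_def)
  then have "ext n (flip n (yv n (n + 1 - j) k)) a n = - (if a = j then 1 else 0)" if "a \<le> n + 1" for a
    using that by (simp add: ext_flip)
  then show ?thesis using i j by (auto simp: tau_def cartan_def)
qed

lemma T_0_mult: "T 0 \<phi> * T 0 \<psi> = T 0 (\<lambda>M. \<phi> M * \<psi> M)"
  by (rule lop_eqI) (simp add: mult.assoc)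

lemma T_0_commute: "T 0 \<phi> * T 0 \<psi> = T 0 \<psi> * T 0 \<phi>"
  by (simp add: T_0_mult mult.commute)

lemma T_0_power: "T 0 \<phi> ^ m = T 0 (\<lambda>M. \<phi> M ^ m)"
  by (induction m) (simp_all only: power_0 power_Suc T_one T_0_mult)

text \<open>Indexed by the dual node, since \<open>fl i\<close> is the flip of
  \<open>e (n + 1 - i)\<close>: the shift seen by \<open>fl i\<close> is then minus
  \<open>lam i\<close>.\<close>

definition dual_weight :: "nat \<Rightarrow> (nat \<Rightarrow> nat) \<Rightarrow> nat \<Rightarrow> int" where
  "dual_weight n lam i = - int (lam (n + 1 - i))"

locale cyclic_lattice =
  fixes \<epsilon> :: complex and l n :: nat and lam :: "nat \<Rightarrow> nat"
  assumes root: "1 < l" "odd l" "\<epsilon> ^ l = 1" "\<forall>k. 0 < k \<and> k < l \<longrightarrow> \<epsilon> ^ k \<noteq> 1"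
begin

sublocale E: cyclic_family_0 \<epsilon> l n
  by unfold_locales (use root in auto)

sublocale F: cyclic_family \<epsilon> l n "dual_weight n lam"
  by unfold_locales (use root in auto)

definition tl :: "nat \<Rightarrow> complex lop" where
  "tl i = T 0 (\<lambda>M. E.qp (tau n i M + int (lam i)))"

definition tl' :: "nat \<Rightarrow> complex lop" where
  "tl' i = T 0 (\<lambda>M. E.qp (- (tau n i M + int (lam i))))"

lemma br_minus: "E.br (- z) = - E.br z"
  by (simp add: E.br_def algebra_simps)

lemma fl_eq:
  "i \<in> {1..n} \<Longrightarrow> F.fl i = (\<Sum>k=n+1-i..n. T (flip n (yv n (n + 1 - i) k))
    (\<lambda>M. E.br (cx n (n + 1 - i) k (flip n M) - int (lam i))))"
  unfolding F.fl_eq by (intro sum.cong refl) (auto simp: dual_weight_def)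

text \<open>Both forms change by the same amount \<open>s\<close> under the shift of the other, so
  the difference is [x + s][y] - [y + s][x] with \<open>s\<close> in {-1, 0, 1}, and
  \<open>br_mult_diff\<close> evaluates it.\<close>

lemma commutator_term:
  fixes m :: int
  assumes "(i, k) \<in> positions n" and "(j, k') \<in> positions n"
  defines "A \<equiv> T (yv n i k) (\<lambda>M. E.br (cx n i k M))"
    and "B \<equiv> T (flip n (yv n j k')) (\<lambda>M. E.br (cx n j k' (flip n M) - m))"
  shows "A * B - B * A =
    (if k = k' \<and> i + j = k + 1
     then T (yv n i k + flip n (yv n j k)) (\<lambda>M. E.br (cx n i k M - (cx n j k (flip n M) - m)))
     else if k = k' \<and> i + j = k
     then T (yv n i k + flip n (yv n j k)) (\<lambda>M. E.br (cx n j k (flip n M) - m - cx n i k M))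
     else 0)"
proof -
  define W where "W = yv n i k + flip n (yv n j k')"
  define s :: int where "s = (if k = k' \<and> i + j = k + 1 then - 1 else if k = k' \<and> i + j = k then 1 else 0)"
  have W: "yv n i k + flip n (yv n j k') = W" "flip n (yv n j k') + yv n i k = W"
    by (simp_all add: W_def add.commute)
  have s: "cx n i k (flip n (yv n j k')) = s" "cx n j k' (flip n (yv n i k)) = s"
    using cx_flip_yv[OF assms(1,2)] cx_flip_yv[OF assms(2,1)] by (auto simp: s_def add.commute)
  have eq: "A * B - B * A = T W (\<lambda>M. E.br (cx n i k M + s) * E.br (cx n j k' (flip n M) - m) -
      E.br (cx n j k' (flip n M) - m + s) * E.br (cx n i k M))"
    unfolding A_def B_def T_mult W T_minus flip_add cx_add s by (simp add: algebra_simps)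
  consider "s = - 1" | "s = 1" | "s = 0" unfolding s_def by metis
  then show ?thesis
  proof cases
    case 1
    then have c: "k = k' \<and> i + j = k + 1" unfolding s_def by (metis one_neq_neg_one zero_neq_neg_one)
    have "E.br (x - 1) * E.br y - E.br (y - 1) * E.br x = E.br (x - y)" for x y
      using E.br_mult_diff[of x y] by (simp add: mult.commute)
    then show ?thesis using eq c by (simp add: 1 W_def)
  next
    case 2
    then have c: "k = k'" "i + j = k" unfolding s_def by (metis one_neq_neg_one zero_neq_one)+
    have "E.br (x + 1) * E.br y - E.br (y + 1) * E.br x = E.br (y - x)" for x y
      using E.br_mult_diff[of "y + 1" "x + 1"] by (simp add: mult.commute)
    then show ?thesis using eq c by (simp add: 2 W_def)
  next
    case 3
    then have c: "\<not> (k = k' \<and> i + j = k + 1)" "\<not> (k = k' \<and> i + j = k)"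
      unfolding s_def by (metis zero_neq_neg_one zero_neq_one)+
    have "A * B - B * A = 0" using eq by (simp add: 3 mult.commute)
    then show ?thesis by (simp only: c if_False)
  qed
qed

text \<open>Nonzero diagonal terms occur only at k = i + j' - 1 and at k + 1. They have the same
  total shift and opposite brackets, hence cancel. The exception is k = n, which means i = j: the
  partner lies outside the range, and the surviving term has shift 0.\<close>

lemma e_f_commutator:
  assumes i: "i \<in> {1..n}" and j: "j \<in> {1..n}"
  shows "E.e i * F.fl j - F.fl j * E.e i =
    (if i = j then sc (1 / (\<epsilon> - inverse \<epsilon>)) * (tl i - tl' i) else 0)"
proof -
  define j' where "j' = n + 1 - j"
  have j': "1 \<le> j'" "j' \<le> n" "i = j \<longleftrightarrow> i + j' = n + 1" using i j by (auto simp: j'_def)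
  define A where "A k = T (yv n i k) (\<lambda>M. E.br (cx n i k M))" for k
  define B where "B k = T (flip n (yv n j' k)) (\<lambda>M. E.br (cx n j' k (flip n M) - int (lam j)))" for k
  define W where "W k = yv n i k + flip n (yv n j' k)" for k
  define G where "G k M = cx n i k M - (cx n j' k (flip n M) - int (lam j))" for k M
  define C where "C k = (if i + j' = k + 1 then T (W k) (\<lambda>M. E.br (G k M))
    else if i + j' = k then T (W k) (\<lambda>M. E.br (- G k M)) else 0)" for k
  have "E.e i * F.fl j - F.fl j * E.e i = (\<Sum>k=i..n. \<Sum>k'=j'..n. A k * B k' - B k' * A k)"
  proof -
    have "F.fl j * E.e i = (\<Sum>k=i..n. \<Sum>k'=j'..n. B k' * A k)"
      unfolding fl_eq[OF j] E.e_def sum_product by (subst sum.swap) (simp add: A_def B_def j'_def)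
    moreover have "E.e i * F.fl j = (\<Sum>k=i..n. \<Sum>k'=j'..n. A k * B k')"
      unfolding fl_eq[OF j] E.e_def sum_product by (simp add: A_def B_def j'_def)
    ultimately show ?thesis by (simp add: sum_subtractf)
  qed
  also have "\<dots> = (\<Sum>k=i..n. \<Sum>k'=j'..n. if k = k' then C k else 0)"
  proof (intro sum.cong refl)
    fix k k' assume "k \<in> {i..n}" "k' \<in> {j'..n}"
    then have "(i, k) \<in> positions n" "(j', k') \<in> positions n" using i j' by (auto simp: positions_def)
    from commutator_term[OF this, of "int (lam j)"]
    show "A k * B k' - B k' * A k = (if k = k' then C k else 0)"
      by (simp add: A_def B_def C_def W_def G_def)
  qed
  also have "\<dots> = (\<Sum>k\<in>{i..n} \<inter> {j'..n}. C k)"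
    by (subst sum.inter_restrict) (auto intro!: sum.cong)
  also have "\<dots> = (if i = j then sc (1 / (\<epsilon> - inverse \<epsilon>)) * (tl i - tl' i) else 0)"
  proof -
    consider "i + j' = n + 1" | "i + j' > n + 1" | "i + j' \<le> n" by linarith
    then show ?thesis
    proof cases
      case 1
      have "(\<Sum>k\<in>{i..n} \<inter> {j'..n}. C k) = (\<Sum>k\<in>{n}. C k)"
        by (rule sum.mono_neutral_right) (use i j' 1 in \<open>auto simp: C_def\<close>)
      moreover have "W n = 0"
        using 1 i j' by (auto simp: W_def yv_def flip_def positions_def fun_eq_iff)
      moreover have "G n M = tau n i M + int (lam i)" for M
      proof -
        have "n + 1 - j' = i" "n - j' = i - 1" "i = j" using 1 i j' by auto
        then show ?thesis using cx_flip[of j' n n M] j' by (simp add: G_def cx_def tau_def positions_def)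
      qed
      moreover have "T 0 (\<lambda>M. E.br (f M)) =
          sc (1 / (\<epsilon> - inverse \<epsilon>)) * (T 0 (\<lambda>M. E.qp (f M)) - T 0 (\<lambda>M. E.qp (- f M)))" for f
        unfolding T_minus sc_T E.br_def by (simp add: inverse_eq_divide)
      ultimately show ?thesis using 1 j' by (simp add: C_def tl_def tl'_def)
    next
      case 2
      then have "(\<Sum>k\<in>{i..n} \<inter> {j'..n}. C k) = 0"
        by (intro sum.neutral) (auto simp: C_def)
      then show ?thesis using 2 j' by simp
    next
      case 3
      define k where "k = i + j' - 1"
      have k: "i + j' = k + 1" "k + 1 \<le> n" "i \<le> k" "j' \<le> k" using 3 i j' by (auto simp: k_def)
      have "(\<Sum>k\<in>{i..n} \<inter> {j'..n}. C k) = (\<Sum>k\<in>{k, k + 1}. C k)"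
        by (rule sum.mono_neutral_right) (use k in \<open>auto simp: C_def\<close>)
      moreover have "W (k + 1) = W k"
        using k i j' by (auto simp: W_def yv_def flip_def positions_def fun_eq_iff)
      moreover have "G (k + 1) M = G k M" for M
      proof -
        have "k + 1 - j' = i" "k - j' = i - 1" "k + 1 + 1 - j' = i + 1" "1 \<le> k" using k i j' by auto
        moreover have "(j', k) \<in> positions n" "(j', k + 1) \<in> positions n"
          using k j' by (auto simp: positions_def)
        ultimately show ?thesis
          using cx_flip[of j' k n M] cx_flip[of j' "k + 1" n M] by (simp add: G_def cx_def)
      qed
      ultimately have "(\<Sum>k\<in>{i..n} \<inter> {j'..n}. C k) = 0"
        using k by (simp add: C_def T_add br_minus)
      then show ?thesis using 3 j' by simp
    qed
  qed
  finally show ?thesis .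
qed

lemma tl_inverse: "tl i * tl' i = 1" "tl' i * tl i = 1"
proof -
  show "tl i * tl' i = 1" unfolding tl_def tl'_def T_0_mult E.qp_inverse by (rule T_one)
  then show "tl' i * tl i = 1" unfolding tl_def tl'_def by (simp only: T_0_commute)
qed

lemma tl_commute: "tl i * tl j = tl j * tl i"
  unfolding tl_def by (rule T_0_commute)

lemma tl_power: "tl i ^ (2 * l) = 1"
proof -
  have "E.qp z ^ (2 * l) = 1" for z
    using E.qp_multiple[OF root(3), of "2 * z"] by (simp add: E.qp_power algebra_simps)
  then show ?thesis by (simp add: tl_def T_0_power T_one)
qed

lemma tl_conj_T:
  assumes "\<And>M. tau n i (M + y) = tau n i M + c"
  shows "tl i * T y \<phi> * tl' i = sc (\<epsilon> powi c) * T y \<phi>"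
proof -
  have eq: "E.qp (tau n i M + c + int (lam i)) * \<phi> M * E.qp (- (tau n i M + int (lam i))) = \<epsilon> powi c * \<phi> M" for M
  proof -
    have "E.qp (tau n i M + c + int (lam i)) * E.qp (- (tau n i M + int (lam i))) = E.qp c"
      by (simp flip: E.qp_add)
    moreover have "x * \<phi> M * y = x * y * \<phi> M" for x y by simp
    ultimately show ?thesis by (simp only: E.qp_eq)
  qed
  show ?thesis
    unfolding tl_def tl'_def by (simp only: T_mult sc_T assms eq add_0_left add_0_right)
qed

lemma tl_e: "i \<in> {1..n} \<Longrightarrow> j \<in> {1..n} \<Longrightarrow> tl i * E.e j * tl' i = sc (\<epsilon> powi cartan i j) * E.e j"
  unfolding E.e_def sum_distrib_left sum_distrib_right
  by (intro sum.cong refl tl_conj_T) (auto simp: tau_add tau_yv positions_def)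

lemma tl_f: "i \<in> {1..n} \<Longrightarrow> j \<in> {1..n} \<Longrightarrow> tl i * F.fl j * tl' i = sc (\<epsilon> powi (- cartan i j)) * F.fl j"
proof -
  assume ij: "i \<in> {1..n}" "j \<in> {1..n}"
  show ?thesis
    unfolding fl_eq[OF ij(2)] sum_distrib_left sum_distrib_right
  proof (intro sum.cong refl tl_conj_T)
    fix k M assume "k \<in> {n + 1 - j..n}"
    then have "(n + 1 - j, k) \<in> positions n" using ij by (auto simp: positions_def)
    then show "tau n i (M + flip n (yv n (n + 1 - j) k)) = tau n i M + - cartan i j"
      by (simp only: tau_add tau_flip_yv[OF ij])
  qed
qed

end

section \<open>Endomorphism algebras and presented algebras\<close>

lemma End_carrier_iff:
  "S \<in> carrier (End_alg W) \<longleftrightarrow> S \<in> W \<rightarrow>\<^sub>E W \<and> (\<forall>v\<in>W. \<forall>w\<in>W. S (v + w) = S v + S w) \<and>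
     (\<forall>c. \<forall>v\<in>W. S (vscale c v) = vscale c (S v))"
  by (simp add: End_alg_def)

lemma End_ops:
  "monoid.mult (End_alg W) = compose W" "monoid.one (End_alg W) = (\<lambda>v\<in>W. v)" "ring.zero (End_alg W) = (\<lambda>v\<in>W. 0)"
  "ring.add (End_alg W) = (\<lambda>S T. \<lambda>v\<in>W. S v + T v)" "module.smult (End_alg W) = (\<lambda>c S. \<lambda>v\<in>W. vscale c (S v))"
  by (simp_all add: End_alg_def)

lemma vscale_simps:
  "vscale c (v + w) = vscale c v + vscale c w" "vscale (c + d) v = vscale c v + vscale d v"
  "vscale c (vscale d v) = vscale (c * d) v" "vscale 1 v = v" "vscale c 0 = 0" "vscale 0 v = 0"
  by (simp_all add: vscale_def fun_eq_iff algebra_simps)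

lemma End_eqI:
  "\<lbrakk>S \<in> carrier (End_alg W); S' \<in> carrier (End_alg W); \<And>v. v \<in> W \<Longrightarrow> S v = S' v\<rbrakk> \<Longrightarrow> S = S'"
  by (meson End_carrier_iff PiE_ext)

context
  fixes W :: "('m \<Rightarrow> complex) set"
  assumes W: "is_subspace W"
begin

lemma W_closed: "0 \<in> W" "v \<in> W \<Longrightarrow> w \<in> W \<Longrightarrow> v + w \<in> W" "v \<in> W \<Longrightarrow> vscale c v \<in> W"
  using W by (auto simp: is_subspace_def)

lemma End_mem: "S \<in> carrier (End_alg W) \<Longrightarrow> v \<in> W \<Longrightarrow> S v \<in> W"
  by (auto simp: End_carrier_iff)

lemma End_closed:
  "monoid.one (End_alg W) \<in> carrier (End_alg W)" "ring.zero (End_alg W) \<in> carrier (End_alg W)"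
  "\<lbrakk>S \<in> carrier (End_alg W); S' \<in> carrier (End_alg W)\<rbrakk> \<Longrightarrow> monoid.mult (End_alg W) S S' \<in> carrier (End_alg W)"
  "\<lbrakk>S \<in> carrier (End_alg W); S' \<in> carrier (End_alg W)\<rbrakk> \<Longrightarrow> ring.add (End_alg W) S S' \<in> carrier (End_alg W)"
  "S \<in> carrier (End_alg W) \<Longrightarrow> module.smult (End_alg W) c S \<in> carrier (End_alg W)"
proof -
  show "monoid.one (End_alg W) \<in> carrier (End_alg W)" "ring.zero (End_alg W) \<in> carrier (End_alg W)"
    by (auto simp: End_carrier_iff End_ops W_closed vscale_simps)
  show "monoid.mult (End_alg W) S S' \<in> carrier (End_alg W)"
    if "S \<in> carrier (End_alg W)" "S' \<in> carrier (End_alg W)"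
    using that End_mem[OF that(1)] End_mem[OF that(2)]
    by (auto simp: End_carrier_iff End_ops W_closed compose_def)
  show "ring.add (End_alg W) S S' \<in> carrier (End_alg W)"
    if "S \<in> carrier (End_alg W)" "S' \<in> carrier (End_alg W)"
    using that End_mem[OF that(1)] End_mem[OF that(2)]
    by (auto simp: End_carrier_iff End_ops W_closed vscale_simps)
  show "module.smult (End_alg W) c S \<in> carrier (End_alg W)" if "S \<in> carrier (End_alg W)"
    using that End_mem[OF that]
    by (auto simp: End_carrier_iff End_ops W_closed vscale_simps mult.commute)
qed

lemma End_apply:
  assumes "v \<in> W"
  shows "monoid.mult (End_alg W) S S' v = S (S' v)" "ring.add (End_alg W) S S' v = S v + S' v"
    "monoid.one (End_alg W) v = v" "ring.zero (End_alg W) v = 0" "module.smult (End_alg W) c S v = vscale c (S v)"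
  using assms by (simp_all add: End_ops compose_def)

lemma End_ring: "ring (End_alg W)"
proof (rule ringI)
  show "abelian_group (End_alg W)"
  proof (rule abelian_groupI)
    fix S assume S: "S \<in> carrier (End_alg W)"
    show "\<exists>S'\<in>carrier (End_alg W). S' \<oplus>\<^bsub>End_alg W\<^esub> S = \<zero>\<^bsub>End_alg W\<^esub>"
    proof (rule bexI[of _ "(- 1) \<odot>\<^bsub>End_alg W\<^esub> S"])
      show "(- 1) \<odot>\<^bsub>End_alg W\<^esub> S \<oplus>\<^bsub>End_alg W\<^esub> S = \<zero>\<^bsub>End_alg W\<^esub>"
        by (rule End_eqI[of _ W]) (auto simp: End_closed S End_apply vscale_def fun_eq_iff)
    qed (use S in \<open>rule End_closed\<close>)
  qed (rule End_eqI[of _ W] End_closed; simp add: End_closed End_apply add.assoc add.commute; fail)+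
  show "Group.monoid (End_alg W)"
    by (rule monoidI) (rule End_eqI[of _ W] End_closed; simp add: End_closed End_apply End_mem; fail)+
  fix x y z
  assume *: "x \<in> carrier (End_alg W)" "y \<in> carrier (End_alg W)" "z \<in> carrier (End_alg W)"
  show "(x \<oplus>\<^bsub>End_alg W\<^esub> y) \<otimes>\<^bsub>End_alg W\<^esub> z = x \<otimes>\<^bsub>End_alg W\<^esub> z \<oplus>\<^bsub>End_alg W\<^esub> y \<otimes>\<^bsub>End_alg W\<^esub> z"
    by (rule End_eqI[of _ W]) (simp_all add: * End_closed End_apply End_mem plus_fun_def)
  have z_add: "z (v + w) = z v + z w" if "v \<in> W" "w \<in> W" for v w
    using *(3) that by (simp add: End_carrier_iff)
  show "z \<otimes>\<^bsub>End_alg W\<^esub> (x \<oplus>\<^bsub>End_alg W\<^esub> y) = z \<otimes>\<^bsub>End_alg W\<^esub> x \<oplus>\<^bsub>End_alg W\<^esub> z \<otimes>\<^bsub>End_alg W\<^esub> y"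
    by (rule End_eqI[of _ W]) (simp_all only: * End_closed End_apply End_mem z_add)
qed

lemma End_a_minus:
  assumes "S \<in> carrier (End_alg W)" "S' \<in> carrier (End_alg W)" "v \<in> W"
  shows "(S \<ominus>\<^bsub>End_alg W\<^esub> S') v = S v - S' v"
proof -
  interpret ring "End_alg W" by (rule End_ring)
  have "\<ominus>\<^bsub>End_alg W\<^esub> S' = (- 1) \<odot>\<^bsub>End_alg W\<^esub> S'"
  proof (rule minus_equality)
    show "(- 1) \<odot>\<^bsub>End_alg W\<^esub> S' \<oplus>\<^bsub>End_alg W\<^esub> S' = \<zero>\<^bsub>End_alg W\<^esub>"
      by (rule End_eqI[of _ W]) (auto simp: End_closed assms End_apply vscale_def fun_eq_iff)
  qed (auto simp: End_closed assms)
  then show ?thesis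
    using assms(3) by (simp add: a_minus_def End_apply) (simp add: vscale_def fun_eq_iff)
qed

end

lemma free_alg_sel:
  "carrier (free_alg G) = {p. Poly_Mapping.keys p \<subseteq> lists G}" "monoid.mult (free_alg G) = (*)"
  "monoid.one (free_alg G) = 1" "ring.zero (free_alg G) = 0" "ring.add (free_alg G) = (+)"
  "module.smult (free_alg G) = (\<lambda>c p. const_free c * p)"
  by (simp_all add: free_alg_def)

lemma keys_const_free: "Poly_Mapping.keys (const_free c) \<subseteq> {[]}"
  by (simp add: const_free_def)

lemma free_closed:
  "0 \<in> carrier (free_alg G)" "1 \<in> carrier (free_alg G)" "const_free c \<in> carrier (free_alg G)"
  "x \<in> G \<Longrightarrow> gen_free x \<in> carrier (free_alg G)"
  "p \<in> carrier (free_alg G) \<Longrightarrow> q \<in> carrier (free_alg G) \<Longrightarrow> p + q \<in> carrier (free_alg G)"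
  "p \<in> carrier (free_alg G) \<Longrightarrow> q \<in> carrier (free_alg G) \<Longrightarrow> p * q \<in> carrier (free_alg G)"
  "p \<in> carrier (free_alg G) \<Longrightarrow> - p \<in> carrier (free_alg G)"
proof -
  show "1 \<in> carrier (free_alg G)"
    by (simp add: free_alg_sel zero_list_def)
  show "const_free c \<in> carrier (free_alg G)"
    using keys_const_free[of c] by (auto simp: free_alg_sel)
  show "p * q \<in> carrier (free_alg G)" if "p \<in> carrier (free_alg G)" "q \<in> carrier (free_alg G)"
    using that keys_mult[of p q] by (fastforce simp: free_alg_sel plus_list_def)
  show "p + q \<in> carrier (free_alg G)" if "p \<in> carrier (free_alg G)" "q \<in> carrier (free_alg G)"
    using that Poly_Mapping.keys_add[of p q] by (auto simp: free_alg_sel)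
qed (auto simp: free_alg_sel gen_free_def)

lemma free_closed':
  "p \<in> carrier (free_alg G) \<Longrightarrow> q \<in> carrier (free_alg G) \<Longrightarrow> p - q \<in> carrier (free_alg G)"
  "p \<in> carrier (free_alg G) \<Longrightarrow> p ^ m \<in> carrier (free_alg G)"
proof -
  show "p - q \<in> carrier (free_alg G)" if "p \<in> carrier (free_alg G)" "q \<in> carrier (free_alg G)"
    using free_closed(5)[OF that(1) free_closed(7)[OF that(2)]] by simp
  show "p ^ m \<in> carrier (free_alg G)" if "p \<in> carrier (free_alg G)"
    using that by (induction m) (simp_all add: free_closed)
qed

lemma free_alg_ring: "ring (free_alg G)"
proof (rule ringI)
  show "abelian_group (free_alg G)"
  proof (rule abelian_groupI)
    fix p assume "p \<in> carrier (free_alg G)"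
    then show "\<exists>q\<in>carrier (free_alg G). q \<oplus>\<^bsub>free_alg G\<^esub> p = \<zero>\<^bsub>free_alg G\<^esub>"
      by (intro bexI[of _ "- p"] free_closed) (simp add: free_alg_sel)
  qed (simp_all add: free_alg_sel(2-) free_closed algebra_simps)
  show "Group.monoid (free_alg G)"
    by (rule monoidI) (simp_all add: free_alg_sel(2-) free_closed algebra_simps)
qed (simp_all add: free_alg_sel(2-) algebra_simps)

lemma poly_mapping_sum_single: "p = (\<Sum>w\<in>Poly_Mapping.keys p. Poly_Mapping.single w (Poly_Mapping.lookup p w))"
proof (rule poly_mapping_eqI)
  fix u
  have "(\<Sum>w\<in>Poly_Mapping.keys p. if w = u then Poly_Mapping.lookup p w else 0) = Poly_Mapping.lookup p u"
    by (simp add: sum.delta' in_keys_iff)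
  then show "Poly_Mapping.lookup p u =
      Poly_Mapping.lookup (\<Sum>w\<in>Poly_Mapping.keys p. Poly_Mapping.single w (Poly_Mapping.lookup p w)) u"
    by (simp add: lookup_sum lookup_single when_def)
qed

lemma single_mult_list:
  "Poly_Mapping.single u a * Poly_Mapping.single w b = Poly_Mapping.single (u @ w) (a * b)"
  by (simp add: mult_single plus_list_def)

lemma free_alg_induct [consumes 1, case_names const gen add mult]:
  assumes p: "p \<in> carrier (free_alg G)"
    and const: "\<And>c. P (const_free c)" and gen: "\<And>x. x \<in> G \<Longrightarrow> P (gen_free x)"
    and add: "\<And>p q. \<lbrakk>p \<in> carrier (free_alg G); q \<in> carrier (free_alg G); P p; P q\<rbrakk> \<Longrightarrow> P (p + q)"
    and mult: "\<And>p q. \<lbrakk>p \<in> carrier (free_alg G); q \<in> carrier (free_alg G); P p; P q\<rbrakk> \<Longrightarrow> P (p * q)"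
  shows "P p"
proof -
  have single: "Poly_Mapping.single w c \<in> carrier (free_alg G) \<and> P (Poly_Mapping.single w c)"
    if "w \<in> lists G" for w c
    using that
  proof (induction w)
    case Nil
    then show ?case using const[of c] free_closed(3)[of c G] by (simp add: const_free_def)
  next
    case (Cons x w)
    then have "P (gen_free x * Poly_Mapping.single w c)"
      "gen_free x * Poly_Mapping.single w c \<in> carrier (free_alg G)"
      using gen by (auto intro!: mult free_closed)
    then show ?case by (simp add: gen_free_def single_mult_list)
  qed
  have "(\<Sum>w\<in>I. Poly_Mapping.single w (Poly_Mapping.lookup p w)) \<in> carrier (free_alg G) \<and>
      P (\<Sum>w\<in>I. Poly_Mapping.single w (Poly_Mapping.lookup p w))"
    if "finite I" "I \<subseteq> Poly_Mapping.keys p" for I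
    using that
  proof (induction I rule: finite_induct)
    case empty
    then show ?case using const[of 0] free_closed by (simp add: const_free_def)
  next
    case (insert w I)
    have "w \<in> lists G" using insert p by (auto simp: free_alg_sel)
    then show ?case using insert single by (auto intro!: add free_closed(5))
  qed
  from this[of "Poly_Mapping.keys p"] show ?thesis using poly_mapping_sum_single[of p] by simp
qed

text \<open>Evaluation in a type of operators needs no carrier conditions, unlike \<^const>\<open>eval_free\<close>.\<close>

definition tev :: "('g \<Rightarrow> complex lop) \<Rightarrow> 'g free \<Rightarrow> complex lop" where
  "tev h p = (\<Sum>w\<in>Poly_Mapping.keys p. sc (Poly_Mapping.lookup p w) * prod_list (map h w))"

lemma tev_superset:
  assumes "finite I" "Poly_Mapping.keys p \<subseteq> I"
  shows "tev h p = (\<Sum>w\<in>I. sc (Poly_Mapping.lookup p w) * prod_list (map h w))"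
  unfolding tev_def using assms by (intro sum.mono_neutral_left) (auto simp: in_keys_iff)

lemma tev_add: "tev h (p + q) = tev h p + tev h q"
proof -
  let ?I = "Poly_Mapping.keys p \<union> Poly_Mapping.keys q"
  have "finite ?I" by simp
  then show ?thesis
    using tev_superset[of ?I p h] tev_superset[of ?I q h] tev_superset[of ?I "p + q" h]
      Poly_Mapping.keys_add[of p q]
    by (simp add: lookup_add sc_add distrib_right sum.distrib)
qed

lemma tev_0: "tev h 0 = 0"
  by (simp add: tev_def)

lemma tev_uminus: "tev h (- p) = - tev h p"
  using tev_add[of h p "- p"] by (simp add: tev_0 eq_neg_iff_add_eq_0 add.commute)

lemma tev_minus: "tev h (p - q) = tev h p - tev h q"
  using tev_add[of h p "- q"] by (simp add: tev_uminus)

lemma tev_sum: "tev h (\<Sum>i\<in>I. f i) = (\<Sum>i\<in>I. tev h (f i))"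
  by (induction I rule: infinite_finite_induct) (simp_all add: tev_0 tev_add)

lemma tev_single: "tev h (Poly_Mapping.single w c) = sc c * prod_list (map h w)"
  by (simp add: tev_def)

lemma tev_mult: "tev h (p * q) = tev h p * tev h q"
proof -
  have pq: "p * q = (\<Sum>u\<in>Poly_Mapping.keys p. \<Sum>w\<in>Poly_Mapping.keys q.
      Poly_Mapping.single (u @ w) (Poly_Mapping.lookup p u * Poly_Mapping.lookup q w))"
    by (subst (1) poly_mapping_sum_single[of p], subst (1) poly_mapping_sum_single[of q])
      (simp add: sum_product single_mult_list)
  have swap: "sc (a * b) * (A * B) = (sc a * A) * (sc b * B)" for a b and A B :: "complex lop"
    by (simp only: sc_mult mult.assoc sc_left_commute[of A b B])
  show ?thesis
    unfolding pq tev_sum tev_single map_append prod_list.append swap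
    unfolding tev_def sum_product ..
qed

lemma tev_simps: "tev h (const_free c) = sc c" "tev h (gen_free x) = h x" "tev h 1 = 1"
proof -
  show "tev h (const_free c) = sc c" for c by (simp add: const_free_def tev_single)
  then show "tev h 1 = 1" using tev_single[of h "[]" 1] by (metis mult_1 prod_list.Nil list.simps(8) sc_simps(2) single_one zero_list_def)
qed (simp add: gen_free_def tev_single)

lemma tev_power: "tev h (p ^ m) = tev h p ^ m"
  by (induction m) (simp_all add: tev_simps tev_mult)

lemma presented_carrier:
  "carrier (presented G R) = {cls G R p | p. p \<in> carrier (free_alg G)}"
  by (auto simp: presented_def quot_alg_def Let_def FactRing_def A_RCOSETS_defs a_r_coset_def cls_def)

lemma cls_hom:
  assumes R: "R \<subseteq> carrier (free_alg G)"
    and p: "p \<in> carrier (free_alg G)" and q: "q \<in> carrier (free_alg G)"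
  shows "cls G R (p + q) = cls G R p \<oplus>\<^bsub>presented G R\<^esub> cls G R q"
    "cls G R (p * q) = cls G R p \<otimes>\<^bsub>presented G R\<^esub> cls G R q"
    "cls G R 1 = \<one>\<^bsub>presented G R\<^esub>"
    "cls G R (const_free c * p) = c \<odot>\<^bsub>presented G R\<^esub> cls G R p"
proof -
  interpret ring "free_alg G" by (rule free_alg_ring)
  interpret I: ideal "Idl\<^bsub>free_alg G\<^esub> R" "free_alg G" by (rule genideal_ideal[OF R])
  note hom = I.rcos_ring_hom
  have m: "cls G R (x * y) = cls G R x \<otimes>\<^bsub>presented G R\<^esub> cls G R y"
    if "x \<in> carrier (free_alg G)" "y \<in> carrier (free_alg G)" for x y
    using ring_hom_mult[OF hom that]
    by (simp add: cls_def presented_def quot_alg_def Let_def free_alg_sel(2))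
  show "cls G R (p * q) = cls G R p \<otimes>\<^bsub>presented G R\<^esub> cls G R q" using p q by (rule m)
  show "cls G R (p + q) = cls G R p \<oplus>\<^bsub>presented G R\<^esub> cls G R q"
    using ring_hom_add[OF hom p q]
    by (simp add: cls_def presented_def quot_alg_def Let_def free_alg_sel(5))
  show "cls G R 1 = \<one>\<^bsub>presented G R\<^esub>"
    using ring_hom_one[OF hom]
    by (simp add: cls_def presented_def quot_alg_def Let_def free_alg_sel(3))
  show "cls G R (const_free c * p) = c \<odot>\<^bsub>presented G R\<^esub> cls G R p"
    using m[OF free_closed(3) p] by (simp add: cls_def presented_def quot_alg_def Let_def free_alg_sel(2,3,6))
qed

text \<open>Being stable under the generators is enough, as the elements mapping \<open>S\<close>
  into itself contain the scalars and are closed under sums and products.\<close>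

lemma presented_action_closed:
  assumes R: "R \<subseteq> carrier (free_alg G)" and \<rho>: "\<rho> \<in> alg_hom (presented G R) (End_alg W)"
    and W: "is_subspace W" and S: "S \<subseteq> W" "is_subspace S"
    and gens: "\<And>x v. x \<in> G \<Longrightarrow> v \<in> S \<Longrightarrow> \<rho> (cls G R (gen_free x)) v \<in> S"
    and x: "x \<in> carrier (presented G R)" and v: "v \<in> S"
  shows "\<rho> x v \<in> S"
proof -
  obtain p where p: "p \<in> carrier (free_alg G)" "x = cls G R p" using x presented_carrier by blast
  have hom: "\<rho> \<in> ring_hom (presented G R) (End_alg W)"
    and sm: "\<And>c x. x \<in> carrier (presented G R) \<Longrightarrow>
      \<rho> (c \<odot>\<^bsub>presented G R\<^esub> x) = c \<odot>\<^bsub>End_alg W\<^esub> \<rho> x"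
    using \<rho> by (auto simp: alg_hom_def)
  have cls: "cls G R p \<in> carrier (presented G R)" if "p \<in> carrier (free_alg G)" for p
    using that presented_carrier by blast
  have "\<forall>v\<in>S. \<rho> (cls G R p) v \<in> S"
    using p(1)
  proof (induction rule: free_alg_induct)
    case (const c)
    have "\<rho> (cls G R (const_free c * 1)) = c \<odot>\<^bsub>End_alg W\<^esub> \<rho> (cls G R 1)"
      using cls_hom(4)[OF R free_closed(2) free_closed(2)] sm[OF cls[OF free_closed(2)]] by simp
    also have "\<rho> (cls G R 1) = \<one>\<^bsub>End_alg W\<^esub>"
      using cls_hom(3)[OF R free_closed(2) free_closed(2)] ring_hom_one[OF hom] by simp
    finally show ?case
      using S by (auto simp: End_apply(5)[OF W] End_apply(3)[OF W] is_subspace_def subset_iff)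
  next
    case (gen x)
    then show ?case using gens by blast
  next
    case (add p q)
    have "\<rho> (cls G R (p + q)) = \<rho> (cls G R p) \<oplus>\<^bsub>End_alg W\<^esub> \<rho> (cls G R q)"
      unfolding cls_hom(1)[OF R add(1,2)] by (rule ring_hom_add[OF hom cls[OF add(1)] cls[OF add(2)]])
    then have eq: "\<rho> (cls G R (p + q)) v = \<rho> (cls G R p) v + \<rho> (cls G R q) v" if "v \<in> S" for v
      using that S(1) by (simp only: End_apply(2)[OF W] subsetD)
    have S_add: "v + w \<in> S" if "v \<in> S" "w \<in> S" for v w
      using S(2) that unfolding is_subspace_def by blast
    show ?case
    proof
      fix v assume v: "v \<in> S"
      show "\<rho> (cls G R (p + q)) v \<in> S"
        unfolding eq[OF v] by (rule S_add[OF bspec[OF add(3) v] bspec[OF add(4) v]])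
    qed
  next
    case (mult p q)
    have "\<rho> (cls G R (p * q)) = \<rho> (cls G R p) \<otimes>\<^bsub>End_alg W\<^esub> \<rho> (cls G R q)"
      unfolding cls_hom(2)[OF R mult(1,2)] by (rule ring_hom_mult[OF hom cls[OF mult(1)] cls[OF mult(2)]])
    then have "\<rho> (cls G R (p * q)) v = \<rho> (cls G R p) (\<rho> (cls G R q) v)" if "v \<in> S" for v
      using that S(1) by (simp only: End_apply(1)[OF W] subsetD)
    then show ?case using mult(3,4) by simp
  qed
  then show ?thesis using p v by blast
qed

section \<open>From the cyclic representation to the lattice\<close>

definition redn :: "nat \<Rightarrow> nat \<Rightarrow> lat \<Rightarrow> idx" where
  "redn n l M = (\<lambda>p\<in>positions n. nat (M p mod int l))"

definition emb :: "nat \<Rightarrow> idx \<Rightarrow> lat" where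
  "emb n m = (\<lambda>p. if p \<in> positions n then int (m p) else 0)"

text \<open>Vectors are viewed as periodic functions on the lattice.\<close>

definition Th :: "nat \<Rightarrow> nat \<Rightarrow> vec \<Rightarrow> lat \<Rightarrow> complex" where
  "Th n l v = (\<lambda>M. v (redn n l M))"

text \<open>\<open>S\<close> is the restriction of \<open>A\<close> to periodic functions. It is
  determined by \<open>A\<close>, but not conversely, so identities are proved for lattice operators
  and carried over to endomorphisms.\<close>

definition reps :: "nat \<Rightarrow> nat \<Rightarrow> endo \<Rightarrow> complex lop \<Rightarrow> bool" where
  "reps n l S A \<longleftrightarrow> S \<in> carrier (EndV n l) \<and> (\<forall>v\<in>Vspace n l. Th n l (S v) = app A (Th n l v))"

definition cong_lat :: "nat \<Rightarrow> nat \<Rightarrow> lat \<Rightarrow> lat \<Rightarrow> bool" where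
  "cong_lat n l M N \<longleftrightarrow> (\<forall>p\<in>positions n. int l dvd M p - N p)"

lemma Vspace_subspace: "is_subspace (Vspace n l)"
  by (auto simp: is_subspace_def Vspace_def vscale_def)

lemma finite_idx_set: "finite (idx_set n l)"
proof -
  have "finite (positions n)"
    by (rule finite_subset[of _ "{1..n} \<times> {1..n}"]) (auto simp: positions_def)
  then show ?thesis unfolding idx_set_def by (intro finite_PiE) auto
qed

lemma sum_apply: "(\<Sum>i\<in>I. f i) x = (\<Sum>i\<in>I. f i x)"
  by (induction I rule: infinite_finite_induct) auto

lemma u_vec_mem: "m \<in> idx_set n l \<Longrightarrow> u_vec m \<in> Vspace n l"
  by (auto simp: Vspace_def u_vec_def)

lemma V_mem_simps:
  "v \<in> Vspace n l \<Longrightarrow> w \<in> Vspace n l \<Longrightarrow> v + w \<in> Vspace n l"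
  "v \<in> Vspace n l \<Longrightarrow> vscale c v \<in> Vspace n l" "0 \<in> Vspace n l"
  using Vspace_subspace[of n l] by (auto simp: is_subspace_def)

lemma V_mem_sum: "(\<And>x. x \<in> I \<Longrightarrow> f x \<in> Vspace n l) \<Longrightarrow> (\<Sum>x\<in>I. f x) \<in> Vspace n l"
  by (induction I rule: infinite_finite_induct) (auto intro: V_mem_simps)

lemma on_basis_apply: "v \<in> Vspace n l \<Longrightarrow> on_basis n l h v = (\<lambda>m'. \<Sum>m\<in>idx_set n l. v m * h m m')"
  by (rule ext) (simp add: on_basis_def sum_apply vscale_def)

lemma on_basis_carrier:
  assumes "\<And>m. m \<in> idx_set n l \<Longrightarrow> h m \<in> Vspace n l"
  shows "on_basis n l h \<in> carrier (EndV n l)"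
  unfolding EndV_def End_carrier_iff
proof (intro conjI ballI allI)
  show "on_basis n l h \<in> Vspace n l \<rightarrow>\<^sub>E Vspace n l"
    using assms by (auto simp: on_basis_def intro!: V_mem_sum V_mem_simps)
  fix v w assume v: "v \<in> Vspace n l" and w: "w \<in> Vspace n l"
  show "on_basis n l h (v + w) = on_basis n l h v + on_basis n l h w"
    by (rule ext) (simp add: on_basis_apply v w V_mem_simps sum.distrib algebra_simps)
next
  fix c v assume v: "v \<in> Vspace n l"
  show "on_basis n l h (vscale c v) = vscale c (on_basis n l h v)"
    unfolding on_basis_apply[OF v] on_basis_apply[OF V_mem_simps(2)[OF v]]
    by (rule ext) (simp add: vscale_def sum_distrib_left mult.assoc)
qed

lemma on_basis_cong: "(\<And>m. m \<in> idx_set n l \<Longrightarrow> h m = h' m) \<Longrightarrow> on_basis n l h = on_basis n l h'"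
  unfolding on_basis_def by (intro restrict_ext sum.cong) auto

lemma redn_cong: "cong_lat n l M N \<Longrightarrow> redn n l M = redn n l N"
proof -
  assume "cong_lat n l M N"
  then have "M p mod int l = N p mod int l" if "p \<in> positions n" for p
    using that unfolding cong_lat_def mod_eq_dvd_iff by blast
  then show ?thesis unfolding redn_def by (intro restrict_ext) simp
qed

lemma redn_emb: "m \<in> idx_set n l \<Longrightarrow> redn n l (emb n m) = m"
  by (rule ext) (auto simp: redn_def emb_def idx_set_def PiE_iff extensional_def nat_mod_distrib)

context
  fixes n l :: nat
  assumes l_pos: "0 < l"
begin

lemma redn_mem: "redn n l M \<in> idx_set n l"
  using l_pos by (auto simp: redn_def idx_set_def nat_less_iff)

lemma emb_redn: "cong_lat n l (emb n (redn n l M)) M"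
proof -
  have "int l dvd M p mod int l - M p" for p
    by (simp flip: mod_eq_dvd_iff)
  then show ?thesis using l_pos by (simp add: cong_lat_def emb_def redn_def)
qed

lemma Th_inj: "\<lbrakk>v \<in> Vspace n l; w \<in> Vspace n l; Th n l v = Th n l w\<rbrakk> \<Longrightarrow> v = w"
proof (rule ext)
  fix m assume *: "v \<in> Vspace n l" "w \<in> Vspace n l" "Th n l v = Th n l w"
  show "v m = w m"
  proof (cases "m \<in> idx_set n l")
    case True
    then show ?thesis using fun_cong[OF *(3), of "emb n m"] by (simp add: Th_def redn_emb)
  qed (use * in \<open>auto simp: Vspace_def\<close>)
qed

lemma Th_simps: "Th n l (v + w) = Th n l v + Th n l w" "Th n l (vscale c v) = (\<lambda>M. c * Th n l v M)"
  by (auto simp: Th_def vscale_def fun_eq_iff)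

lemma reps_mem: "reps n l S A \<Longrightarrow> v \<in> Vspace n l \<Longrightarrow> S v \<in> Vspace n l"
  by (auto simp: reps_def EndV_def End_carrier_iff)

lemma reps_apply: "reps n l S A \<Longrightarrow> v \<in> Vspace n l \<Longrightarrow> Th n l (S v) = app A (Th n l v)"
  by (simp add: reps_def)

lemma reps_carrier: "reps n l S A \<Longrightarrow> S \<in> carrier (EndV n l)"
  by (simp add: reps_def)

lemma reps_unique: "reps n l S A \<Longrightarrow> reps n l S' A \<Longrightarrow> S = S'"
proof -
  assume *: "reps n l S A" "reps n l S' A"
  have "S v = S' v" if v: "v \<in> Vspace n l" for v
    using reps_mem[OF *(1) v] reps_mem[OF *(2) v] reps_apply[OF *(1) v] reps_apply[OF *(2) v]
    by (intro Th_inj) simp_all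
  then show ?thesis
    using reps_carrier[OF *(1)] reps_carrier[OF *(2)] unfolding EndV_def by (intro End_eqI)
qed

lemma reps_mult: "reps n l S A \<Longrightarrow> reps n l S' A' \<Longrightarrow> reps n l (S \<otimes>\<^bsub>EndV n l\<^esub> S') (A * A')"
proof -
  assume *: "reps n l S A" "reps n l S' A'"
  have "Th n l ((S \<otimes>\<^bsub>EndV n l\<^esub> S') v) = app (A * A') (Th n l v)" if v: "v \<in> Vspace n l" for v
    using reps_apply[OF *(1) reps_mem[OF *(2) v]] reps_apply[OF *(2) v] v
    by (simp add: EndV_def End_apply[OF Vspace_subspace])
  then show ?thesis using * unfolding reps_def EndV_def by (auto simp: End_closed[OF Vspace_subspace])
qed

lemma reps_one: "reps n l \<one>\<^bsub>EndV n l\<^esub> 1"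
  unfolding reps_def EndV_def
  by (auto simp: End_closed[OF Vspace_subspace] End_apply[OF Vspace_subspace])

lemma reps_zero: "reps n l \<zero>\<^bsub>EndV n l\<^esub> 0"
  unfolding reps_def EndV_def
  by (auto simp: End_closed[OF Vspace_subspace] End_apply[OF Vspace_subspace] Th_def)

lemma reps_add: "reps n l S A \<Longrightarrow> reps n l S' A' \<Longrightarrow> reps n l (S \<oplus>\<^bsub>EndV n l\<^esub> S') (A + A')"
proof -
  assume *: "reps n l S A" "reps n l S' A'"
  have "Th n l ((S \<oplus>\<^bsub>EndV n l\<^esub> S') v) = app (A + A') (Th n l v)" if v: "v \<in> Vspace n l" for v
  proof -
    have "(S \<oplus>\<^bsub>EndV n l\<^esub> S') v = S v + S' v"
      unfolding EndV_def by (rule End_apply(2)[OF Vspace_subspace v])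
    then show ?thesis
      unfolding app_simps by (simp only: Th_simps reps_apply[OF *(1) v] reps_apply[OF *(2) v]) (rule plus_fun_def)
  qed
  then show ?thesis using * unfolding reps_def EndV_def by (auto simp: End_closed[OF Vspace_subspace])
qed

lemma reps_smult: "reps n l S A \<Longrightarrow> reps n l (c \<odot>\<^bsub>EndV n l\<^esub> S) (sc c * A)"
  unfolding reps_def EndV_def
  by (auto simp: End_closed[OF Vspace_subspace] End_apply[OF Vspace_subspace] Th_simps)

lemma EndV_ring: "ring (EndV n l)"
  unfolding EndV_def by (rule End_ring[OF Vspace_subspace])

lemma reps_minus: "reps n l S A \<Longrightarrow> reps n l S' A' \<Longrightarrow> reps n l (S \<ominus>\<^bsub>EndV n l\<^esub> S') (A - A')"
proof -
  assume *: "reps n l S A" "reps n l S' A'"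
  interpret ring "EndV n l" by (rule EndV_ring)
  have "(S \<ominus>\<^bsub>EndV n l\<^esub> S') v = S v - S' v" if "v \<in> Vspace n l" for v
    using End_a_minus[OF Vspace_subspace] * that unfolding reps_def EndV_def by blast
  moreover have "Th n l (v - w) = (\<lambda>M. Th n l v M - Th n l w M)" for v w
    by (auto simp: Th_def)
  ultimately show ?thesis using * by (auto simp: reps_def)
qed

lemma reps_finsum:
  "\<lbrakk>finite I; \<And>i. i \<in> I \<Longrightarrow> reps n l (S i) (A i)\<rbrakk> \<Longrightarrow> reps n l (\<Oplus>\<^bsub>EndV n l\<^esub>i\<in>I. S i) (\<Sum>i\<in>I. A i)"
proof (induction I rule: finite_induct)
  case empty
  interpret ring "EndV n l" by (rule EndV_ring)
  show ?case by (simp add: reps_zero)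
next
  case (insert x I)
  interpret ring "EndV n l" by (rule EndV_ring)
  have "(\<Oplus>\<^bsub>EndV n l\<^esub>i\<in>insert x I. S i) = S x \<oplus>\<^bsub>EndV n l\<^esub> (\<Oplus>\<^bsub>EndV n l\<^esub>i\<in>I. S i)"
    using insert reps_carrier by (intro finsum_insert) auto
  then show ?case using insert by (simp add: reps_add)
qed

lemma reps_op_prod:
  "(\<And>x. x \<in> set xs \<Longrightarrow> reps n l (S x) (A x)) \<Longrightarrow> reps n l (op_prod (EndV n l) (map S xs)) (prod_list (map A xs))"
  by (induction xs) (auto simp: op_prod_def intro: reps_one reps_mult)

lemma reps_inv:
  assumes "reps n l S A" "reps n l S' A'" "A * A' = 1" "A' * A = 1"
  shows "reps n l (inv\<^bsub>EndV n l\<^esub> S) A'"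
proof -
  interpret ring "EndV n l" by (rule EndV_ring)
  have "S \<otimes>\<^bsub>EndV n l\<^esub> S' = \<one>\<^bsub>EndV n l\<^esub>" "S' \<otimes>\<^bsub>EndV n l\<^esub> S = \<one>\<^bsub>EndV n l\<^esub>"
    using reps_mult[OF assms(1,2)] reps_mult[OF assms(2,1)] assms(3,4) reps_one
    by (auto intro: reps_unique)
  then have "inv\<^bsub>EndV n l\<^esub> S = S'"
    using assms(1,2) reps_carrier by (intro inv_char) auto
  then show ?thesis using assms(2) by simp
qed

text \<open>A periodic coefficient makes the weighted shift preserve periodic functions; the
  endomorphism then acts on representatives and reduces the result modulo l.\<close>

lemma reps_T:
  assumes per: "\<And>M N. cong_lat n l M N \<Longrightarrow> \<phi> M = \<phi> N"
  shows "reps n l (on_basis n l (\<lambda>m. vscale (\<phi> (emb n m)) (u_vec (redn n l (emb n m + d))))) (T d \<phi>)"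
proof -
  have iff: "redn n l M = redn n l (emb n m + d) \<longleftrightarrow> m = redn n l (M - d)" if m: "m \<in> idx_set n l" for m M
  proof
    assume "m = redn n l (M - d)"
    then have "cong_lat n l (emb n m) (M - d)" using emb_redn by simp
    then have "cong_lat n l (emb n m + d) M" by (simp add: cong_lat_def algebra_simps)
    then show "redn n l M = redn n l (emb n m + d)" by (simp add: redn_cong)
  next
    assume "redn n l M = redn n l (emb n m + d)"
    then have "cong_lat n l (emb n (redn n l M)) (emb n m + d)" using emb_redn by simp
    then have "cong_lat n l (M - d) (emb n m)"
      using emb_redn[of M] unfolding cong_lat_def
    proof (intro ballI)
      fix p assume *: "\<forall>p\<in>positions n. int l dvd emb n (redn n l M) p - (emb n m + d) p"
        "\<forall>p\<in>positions n. int l dvd emb n (redn n l M) p - M p" and p: "p \<in> positions n"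
      have "int l dvd (emb n (redn n l M) p - (emb n m + d) p) - (emb n (redn n l M) p - M p)"
        by (rule dvd_diff) (use * p in blast)+
      then show "int l dvd (M - d) p - emb n m p" by (simp add: algebra_simps)
    qed
    then show "m = redn n l (M - d)" using redn_cong redn_emb[OF m] by metis
  qed
  show ?thesis unfolding reps_def
  proof (intro conjI ballI)
    show "on_basis n l (\<lambda>m. vscale (\<phi> (emb n m)) (u_vec (redn n l (emb n m + d)))) \<in> carrier (EndV n l)"
      by (intro on_basis_carrier V_mem_simps u_vec_mem redn_mem)
    fix v assume v: "v \<in> Vspace n l"
    show "Th n l (on_basis n l (\<lambda>m. vscale (\<phi> (emb n m)) (u_vec (redn n l (emb n m + d)))) v) =
        app (T d \<phi>) (Th n l v)"
    proof
      fix M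
      have "Th n l (on_basis n l (\<lambda>m. vscale (\<phi> (emb n m)) (u_vec (redn n l (emb n m + d)))) v) M =
          (\<Sum>m\<in>idx_set n l. if m = redn n l (M - d) then v m * \<phi> (emb n m) else 0)"
        unfolding Th_def on_basis_apply[OF v]
        by (intro sum.cong) (auto simp: vscale_def u_vec_def iff)
      also have "\<dots> = v (redn n l (M - d)) * \<phi> (emb n (redn n l (M - d)))"
        using finite_idx_set redn_mem by simp
      also have "\<dots> = app (T d \<phi>) (Th n l v) M"
        unfolding app_simps Th_def per[OF emb_redn] by (rule mult.commute)
      finally show "Th n l (on_basis n l (\<lambda>m. vscale (\<phi> (emb n m)) (u_vec (redn n l (emb n m + d)))) v) M =
          app (T d \<phi>) (Th n l v) M" .
    qed
  qed
qed

lemma X_op_reps: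
  assumes "(j, k) \<in> positions n"
  shows "reps n l (X_op n l j k) (T (\<lambda>p. if p = (j, k) then 1 else 0) (\<lambda>M. 1))"
proof -
  have "X_op n l j k = on_basis n l (\<lambda>m. vscale 1 (u_vec (redn n l (emb n m + (\<lambda>p. if p = (j, k) then 1 else 0)))))"
    unfolding X_op_def
  proof (rule on_basis_cong)
    fix m assume m: "m \<in> idx_set n l"
    have "m((j, k) := (m (j, k) + 1) mod l) = redn n l (emb n m + (\<lambda>p. if p = (j, k) then 1 else 0))"
    proof
      fix p
      have "nat ((int x + 1) mod int l) = Suc x mod l" for x
        by (metis add.commute nat_int of_nat_Suc zmod_int)
      then show "(m((j, k) := (m (j, k) + 1) mod l)) p =
          redn n l (emb n m + (\<lambda>p. if p = (j, k) then 1 else 0)) p"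
        using assms m
        by (cases p) (auto simp: redn_def emb_def idx_set_def PiE_iff extensional_def nat_mod_distrib)
    qed
    then show "u_vec (m((j, k) := (m (j, k) + 1) mod l)) =
        vscale 1 (u_vec (redn n l (emb n m + (\<lambda>p. if p = (j, k) then 1 else 0))))"
      by (simp add: vscale_simps)
  qed
  then show ?thesis using reps_T[of "\<lambda>_. 1"] by simp
qed

end

text \<open>\<open>induced\<close> takes the unique value of the evaluation on a coset, so constancy
  on cosets comes first: the kernel of \<open>tev h'\<close> is an ideal containing the relations,
  and the value of \<open>tev\<close> determines the endomorphism.\<close>

lemma induced_presented:
  assumes l: "0 < l" and R: "R \<subseteq> carrier (free_alg G)"
    and gens: "\<And>x. x \<in> G \<Longrightarrow> reps n l (h x) (h' x)" and rels: "\<And>r. r \<in> R \<Longrightarrow> tev h' r = 0"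
  shows "p \<in> carrier (free_alg G) \<Longrightarrow> reps n l (induced (EndV n l) h (cls G R p)) (tev h' p)"
    "induced (EndV n l) h \<in> alg_hom (presented G R) (EndV n l)"
proof -
  interpret ring "free_alg G" by (rule free_alg_ring)
  interpret I: ideal "Idl\<^bsub>free_alg G\<^esub> R" "free_alg G" by (rule genideal_ideal[OF R])
  define K where "K = {p \<in> carrier (free_alg G). tev h' p = 0}"
  have "ideal K (free_alg G)"
  proof (rule idealI[OF free_alg_ring])
    have "subgroup K (add_monoid (free_alg G))"
    proof (unfold_locales)
      fix x assume x: "x \<in> K"
      have "\<ominus>\<^bsub>free_alg G\<^esub> x = - x"
        by (rule minus_equality) (use x in \<open>auto simp: K_def free_closed free_alg_sel(4,5)\<close>)
      then show "inv\<^bsub>add_monoid (free_alg G)\<^esub> x \<in> K"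
        using x by (simp add: K_def a_inv_def free_closed tev_uminus)
    qed (auto simp: K_def free_alg_sel(4,5) free_closed tev_0 tev_add)
    then show "subgroup K (add_monoid (free_alg G))" .
  qed (auto simp: K_def free_alg_sel(2) free_closed tev_mult)
  then have K: "Idl\<^bsub>free_alg G\<^esub> R \<subseteq> K"
    by (rule genideal_minimal) (use R rels in \<open>auto simp: K_def\<close>)
  have ev: "reps n l (eval_free (EndV n l) h p) (tev h' p)" if "p \<in> carrier (free_alg G)" for p
    unfolding eval_free_def tev_def
    using that gens by (intro reps_finsum reps_smult reps_op_prod l) (auto simp: free_alg_sel)
  have ind: "induced (EndV n l) h (cls G R p) = eval_free (EndV n l) h p"
    if p: "p \<in> carrier (free_alg G)" for p
  proof -
    have "eval_free (EndV n l) h x = eval_free (EndV n l) h p" if "x \<in> cls G R p" for x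
    proof -
      have "x \<in> (\<Union>i\<in>Idl\<^bsub>free_alg G\<^esub> R. {i + p})"
        using that by (simp only: cls_def a_r_coset_def' free_alg_sel(5))
      then obtain i where i: "i \<in> Idl\<^bsub>free_alg G\<^esub> R" "x \<in> {i + p}" by (rule UN_E)
      have "i \<in> K" using K i(1) by (rule subsetD)
      then have "x \<in> carrier (free_alg G)" and eq: "tev h' x = tev h' p"
        using i(2) p by (simp_all add: K_def free_closed tev_add)
      then show ?thesis using ev[of x, unfolded eq] ev[OF p] by (intro reps_unique[OF l])
    qed
    moreover have "p \<in> cls G R p" unfolding cls_def by (rule I.a_rcos_self[OF p])
    ultimately have "eval_free (EndV n l) h ` cls G R p = {eval_free (EndV n l) h p}" by blast
    then show ?thesis by (simp add: induced_def)
  qed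
  have main: "reps n l (induced (EndV n l) h (cls G R p)) (tev h' p)"
    if "p \<in> carrier (free_alg G)" for p
    using ev[OF that] ind[OF that] by simp
  then show "p \<in> carrier (free_alg G) \<Longrightarrow> reps n l (induced (EndV n l) h (cls G R p)) (tev h' p)" .
  note [intro] = reps_unique[OF l]
  show "induced (EndV n l) h \<in> alg_hom (presented G R) (EndV n l)"
    unfolding alg_hom_def
  proof (intro CollectI conjI ring_hom_memI ballI allI)
    fix x assume "x \<in> carrier (presented G R)"
    then obtain p where p: "p \<in> carrier (free_alg G)" "x = cls G R p" using presented_carrier by blast
    show "induced (EndV n l) h x \<in> carrier (EndV n l)" using main[OF p(1)] p(2) by (simp add: reps_def)
    show "induced (EndV n l) h (c \<odot>\<^bsub>presented G R\<^esub> x) = c \<odot>\<^bsub>EndV n l\<^esub> induced (EndV n l) h x" for c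
      using main[OF free_closed(6)[OF free_closed(3) p(1)], of c] reps_smult[OF l main[OF p(1)], of c]
      by (auto simp: p(2) tev_mult tev_simps simp flip: cls_hom(4)[OF R p(1) p(1)])
    fix y assume "y \<in> carrier (presented G R)"
    then obtain q where q: "q \<in> carrier (free_alg G)" "y = cls G R q" using presented_carrier by blast
    show "induced (EndV n l) h (x \<otimes>\<^bsub>presented G R\<^esub> y) =
        induced (EndV n l) h x \<otimes>\<^bsub>EndV n l\<^esub> induced (EndV n l) h y"
      using main[OF free_closed(6)[OF p(1) q(1)]] reps_mult[OF l main[OF p(1)] main[OF q(1)]]
      by (auto simp: p(2) q(2) tev_mult simp flip: cls_hom(2)[OF R p(1) q(1)])
    show "induced (EndV n l) h (x \<oplus>\<^bsub>presented G R\<^esub> y) =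
        induced (EndV n l) h x \<oplus>\<^bsub>EndV n l\<^esub> induced (EndV n l) h y"
      using main[OF free_closed(5)[OF p(1) q(1)]] reps_add[OF l main[OF p(1)] main[OF q(1)]]
      by (auto simp: p(2) q(2) tev_add simp flip: cls_hom(1)[OF R p(1) q(1)])
  next
    show "induced (EndV n l) h \<one>\<^bsub>presented G R\<^esub> = \<one>\<^bsub>EndV n l\<^esub>"
      using main[OF free_closed(2)] reps_one[OF l, of n]
      by (auto simp: tev_simps simp flip: cls_hom(3)[OF R free_closed(2) free_closed(2)])
  qed
qed

locale cyclic_rep = cyclic_lattice \<epsilon> l n lam
  for \<epsilon> :: complex and l n :: nat and lam :: "nat \<Rightarrow> nat" +
  fixes r s :: "nat \<Rightarrow> complex" and a b :: "nat \<Rightarrow> nat \<Rightarrow> complex"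
  assumes rs: "\<forall>i\<in>{1..n}. r i \<noteq> 0 \<and> s i \<noteq> 0"
    and ab: "\<forall>(j, k)\<in>positions n. a j k \<noteq> 0 \<and> b j k \<noteq> 0"
    and a_prod: "\<forall>(i, k)\<in>positions n. (\<Prod>p\<in>{k..n}. a i p) = 1"
    and rb: "\<forall>(i, k)\<in>positions n.
           r i * b_ext n b i k * b_ext n b i (k - 1)
             * inverse (b_ext n b (i - 1) (k - 1)) * inverse (b_ext n b (i + 1) k) = 1"
    and rsb: "\<forall>i\<in>{1..n}.
           r i / s i * b_ext n b i n ^ 2
             * inverse (b_ext n b (i - 1) n) * inverse (b_ext n b (i + 1) n) = \<epsilon> ^ lam i"
begin

lemma l_pos: "0 < l"
  using root(1) by simp

abbreviation "EV \<equiv> EndV n l"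

abbreviation rp :: "endo \<Rightarrow> complex lop \<Rightarrow> bool" where
  "rp \<equiv> reps n l"

lemma a_eq_1:
  assumes "(i, k) \<in> positions n"
  shows "a i k = 1"
proof -
  have ik: "1 \<le> i" "i \<le> k" "k \<le> n" using assms by (auto simp: positions_def)
  have 1: "(\<Prod>p\<in>{k..n}. a i p) = 1" using a_prod assms by auto
  have 2: "(\<Prod>p\<in>{Suc k..n}. a i p) = 1"
  proof (cases "Suc k \<le> n")
    case True
    then have "(i, Suc k) \<in> positions n" using ik by (auto simp: positions_def)
    then show ?thesis using a_prod by auto
  qed simp
  have "{k..n} = insert k {Suc k..n}" using ik by auto
  then show ?thesis using 1 2 by simp
qed

definition dv :: "nat \<Rightarrow> nat \<Rightarrow> lat" where
  "dv j k = (\<lambda>p. if p = (j, k) then 1 else 0)"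

lemma x_op_reps:
  assumes "(j, k) \<in> positions n"
  shows "rp (x_op n l a j k) (T (dv j k) (\<lambda>M. 1))"
  using reps_smult[OF l_pos X_op_reps[OF l_pos assms], of 1]
  by (simp add: x_op_def a_eq_1[OF assms] dv_def)

lemma x_op_inv_reps:
  assumes "(j, k) \<in> positions n"
  shows "rp (inv\<^bsub>EV\<^esub> x_op n l a j k) (T (- dv j k) (\<lambda>M. 1))"
proof (rule reps_inv[OF l_pos x_op_reps[OF assms]])
  show "rp (on_basis n l (\<lambda>m. vscale 1 (u_vec (redn n l (emb n m + - dv j k))))) (T (- dv j k) (\<lambda>M. 1))"
    by (rule reps_T[OF l_pos]) simp
qed (simp_all add: T_mult T_one)

lemma x_prod_reps:
  assumes "1 \<le> i" "i \<le> k" "k \<le> Suc n"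
  shows "rp (op_prod EV (map (\<lambda>p. x_op n l a i p) [k..<Suc n])) (T (yv n i k) (\<lambda>M. 1))"
proof -
  have "rp (op_prod EV (map (\<lambda>p. x_op n l a i p) [k..<Suc n]))
      (prod_list (map (\<lambda>p. T (dv i p) (\<lambda>M. 1)) [k..<Suc n]))"
    using assms by (intro reps_op_prod[OF l_pos] x_op_reps) (auto simp: positions_def)
  also have "prod_list (map (\<lambda>p. T (dv i p) (\<lambda>M. 1)) [k..<Suc n]) = T (yv n i k) (\<lambda>M. 1 :: complex)"
    using assms(3)
  proof (induction k rule: inc_induct)
    case base
    have "yv n i (Suc n) = 0" by (auto simp: yv_def fun_eq_iff)
    then show ?case by (simp add: T_one[unfolded zero_fun_def])
  next
    case (step k)
    have "dv i k + yv n i (Suc k) = yv n i k"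
      using step by (auto simp: yv_def dv_def fun_eq_iff)
    then show ?case using step by (simp add: upt_conv_Cons[of k "Suc n"] T_mult del: upt_Suc)
  qed
  finally show ?thesis .
qed

text \<open>The positions multiplied here lie on a diagonal ending at \<open>(i, n)\<close>, which
  \<open>flip\<close> makes out of row \<open>n + 1 - i\<close>.\<close>

lemma x_inv_prod_reps:
  assumes "i \<in> {1..n}" "k \<in> {1..i}"
  shows "rp (op_prod EV (map (\<lambda>p. inv\<^bsub>EV\<^esub> x_op n l a (i + p - k) (n + p - k)) [1..<Suc k]))
    (T (flip n (yv n (n + 1 - i) (n + 1 - k))) (\<lambda>M. 1))"
proof -
  have "rp (op_prod EV (map (\<lambda>p. inv\<^bsub>EV\<^esub> x_op n l a (i + p - k) (n + p - k)) [1..<Suc k]))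
      (prod_list (map (\<lambda>p. T (- dv (i + p - k) (n + p - k)) (\<lambda>M. 1)) [1..<Suc k]))"
    using assms by (intro reps_op_prod[OF l_pos] x_op_inv_reps) (auto simp: positions_def)
  also have "prod_list (map (\<lambda>p. T (- dv (i + p - k) (n + p - k)) (\<lambda>M. 1)) [1..<Suc k]) =
      T (flip n (yv n (n + 1 - i) (n + 1 - k))) (\<lambda>M. 1 :: complex)"
  proof -
    have "prod_list (map (\<lambda>p. T (- dv (i + p - k) (n + p - k)) (\<lambda>M. 1)) [t..<Suc k]) =
      T (flip n (yv n (n + 1 - i) (n + t - k))) (\<lambda>M. 1 :: complex)" if "1 \<le> t" "t \<le> Suc k" for t
      using that(2,1)
    proof (induction t rule: inc_induct)
      case base
      have "flip n (yv n (n + 1 - i) (n + Suc k - k)) = 0"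
        by (auto simp: yv_def flip_def fun_eq_iff positions_def)
      then show ?case by (simp add: T_one[unfolded zero_fun_def])
    next
      case (step t)
      have "- dv (i + t - k) (n + t - k) + flip n (yv n (n + 1 - i) (n + Suc t - k)) =
          flip n (yv n (n + 1 - i) (n + t - k))"
      proof
        fix x
        obtain j p :: nat where x: "x = (j, p)" by (cases x)
        have A: "j = i + t - k \<and> p = n + t - k \<longleftrightarrow> (j, p) \<in> positions n \<and> p + 1 - j = n + 1 - i \<and> p = n + t - k"
          using step assms by (auto simp: positions_def)
        have B: "(n + t - k \<le> p) \<longleftrightarrow> (n + Suc t - k \<le> p) \<or> p = n + t - k"
          "n + Suc t - k \<le> p \<longrightarrow> p \<noteq> n + t - k" "1 \<le> n + 1 - i" "n + 1 - i \<le> n + t - k"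
          "n + 1 - i \<le> n + Suc t - k"
          using step assms by auto
        show "(- dv (i + t - k) (n + t - k) + flip n (yv n (n + 1 - i) (n + Suc t - k))) x =
          flip n (yv n (n + 1 - i) (n + t - k)) x"
        proof (cases "(j, p) \<in> positions n")
          case True
          then have "p \<le> n" by (simp add: positions_def)
          with True A B(1,2) show ?thesis
            by (cases "p = n + t - k"; cases "p + 1 - j = n + 1 - i"; cases "n + Suc t - k \<le> p")
              (simp_all add: x dv_def flip_def yv_def)
        next
          case False
          have "yv n (n + 1 - i) (n + t - k) (j, p) = 0" "yv n (n + 1 - i) (n + Suc t - k) (j, p) = 0"
            using False B(3-5) by (auto simp: positions_def yv_def)
          moreover have "dv (i + t - k) (n + t - k) (j, p) = 0" using A False by (simp add: dv_def)
          ultimately show ?thesis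
            using False by (simp only: x flip_def plus_fun_def uminus_apply prod.case if_False)
        qed
      qed
      moreover have "[t..<Suc k] = t # [Suc t..<Suc k]" using step by (simp only: upt_conv_Cons)
      moreover have "prod_list (map (\<lambda>p. T (- dv (i + p - k) (n + p - k)) (\<lambda>M. 1)) [Suc t..<Suc k]) =
          T (flip n (yv n (n + 1 - i) (n + Suc t - k))) (\<lambda>M. 1 :: complex)"
        by (rule step(3)) simp
      ultimately show ?case by (simp only: list.map prod_list.Cons T_mult mult_1)
    qed
    from this[of 1] show ?thesis using assms by simp
  qed
  finally show ?thesis .
qed

definition adm :: "(lat \<Rightarrow> int) \<Rightarrow> bool" where
  "adm f \<longleftrightarrow> (\<forall>M N. cong_lat n l M N \<longrightarrow> int l dvd f M - f N)"

text \<open>Constant and exponent are kept apart because the hypotheses on the parameters evaluate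
  only the product of all constants in a bracket. \<open>adm\<close> ensures that \<epsilon> to this
  exponent is periodic.\<close>

definition diag :: "endo \<Rightarrow> complex \<Rightarrow> (lat \<Rightarrow> int) \<Rightarrow> bool" where
  "diag S c f \<longleftrightarrow> rp S (T 0 (\<lambda>M. c * E.qp (f M))) \<and> c \<noteq> 0 \<and> adm f"

lemma adm_add: "adm f \<Longrightarrow> adm g \<Longrightarrow> adm (\<lambda>M. f M + g M)"
  unfolding adm_def
proof (intro allI impI)
  fix M N
  assume "\<forall>M N. cong_lat n l M N \<longrightarrow> int l dvd f M - f N"
    "\<forall>M N. cong_lat n l M N \<longrightarrow> int l dvd g M - g N" "cong_lat n l M N"
  then have "int l dvd (f M - f N) + (g M - g N)" by (intro dvd_add) blast+
  then show "int l dvd f M + g M - (f N + g N)" by (simp add: algebra_simps)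
qed

lemma adm_uminus: "adm f \<Longrightarrow> adm (\<lambda>M. - f M)"
  unfolding adm_def by (metis dvd_minus_iff minus_diff_minus)

lemmas adm_simps = adm_add adm_uminus

lemma adm_ext: "adm (\<lambda>M. ext n M j k)"
  by (auto simp: adm_def ext_def cong_lat_def)

lemma diag_exists:
  assumes "adm f"
  shows "\<exists>S. rp S (T 0 (\<lambda>M. c * E.qp (f M)))"
proof -
  have "c * E.qp (f M) = c * E.qp (f N)" if "cong_lat n l M N" for M N
  proof -
    have "E.qp (f M - f N) = 1" using assms that by (simp add: E.qp_eq_1_iff adm_def)
    then show ?thesis using E.qp_add[of "f M - f N" "f N"] by simp
  qed
  then show ?thesis using reps_T[OF l_pos, of n "\<lambda>M. c * E.qp (f M)" 0] by blast
qed

lemma diag_mult: "diag S c f \<Longrightarrow> diag S' c' f' \<Longrightarrow> diag (S \<otimes>\<^bsub>EV\<^esub> S') (c * c') (\<lambda>M. f M + f' M)"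
  unfolding diag_def using reps_mult[OF l_pos, of n S _ S'] 
  by (fastforce simp: T_0_mult E.qp_add adm_simps mult_ac)

lemma diag_inv: "diag S c f \<Longrightarrow> diag (inv\<^bsub>EV\<^esub> S) (inverse c) (\<lambda>M. - f M)"
proof -
  assume *: "diag S c f"
  then have c: "c \<noteq> 0" and f: "adm (\<lambda>M. - f M)" and S: "rp S (T 0 (\<lambda>M. c * E.qp (f M)))"
    by (auto simp: diag_def adm_simps)
  obtain S' where S': "rp S' (T 0 (\<lambda>M. inverse c * E.qp (- f M)))" using diag_exists[OF f] by blast
  have one: "T 0 (\<lambda>M. c * E.qp (f M)) * T 0 (\<lambda>M. inverse c * E.qp (- f M)) = 1"
  proof -
    have "c * E.qp (f M) * (inverse c * E.qp (- f M)) = (c * inverse c) * (E.qp (f M) * E.qp (- f M))" for M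
      by (simp only: mult_ac)
    then show ?thesis using c unfolding T_0_mult E.qp_inverse by (simp add: T_one)
  qed
  moreover from this have "T 0 (\<lambda>M. inverse c * E.qp (- f M)) * T 0 (\<lambda>M. c * E.qp (f M)) = 1"
    by (simp only: T_0_commute)
  ultimately have "rp (inv\<^bsub>EV\<^esub> S) (T 0 (\<lambda>M. inverse c * E.qp (- f M)))"
    by (rule reps_inv[OF l_pos S S'])
  then show ?thesis using c f by (simp add: diag_def)
qed

lemma diag_smult: "d \<noteq> 0 \<Longrightarrow> diag S c f \<Longrightarrow> diag (d \<odot>\<^bsub>EV\<^esub> S) (d * c) f"
  unfolding diag_def using reps_smult[OF l_pos, of n S _ d] by (fastforce simp: sc_T mult.assoc)

lemma diag_rp: "diag S c f \<Longrightarrow> rp S (T 0 (\<lambda>M. c * E.qp (f M)))"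
  by (simp add: diag_def)

lemma curly_reps:
  assumes "diag S c f" and c: "c = E.qp k"
  shows "rp (curly n l \<epsilon> S) (T 0 (\<lambda>M. E.br (f M + k)))"
proof -
  have k: "inverse (E.qp k) = E.qp (- k)"
    by (rule inverse_unique) (rule E.qp_inverse)
  have "rp (curly n l \<epsilon> S) (sc (1 / (\<epsilon> - inverse \<epsilon>)) *
      (T 0 (\<lambda>M. c * E.qp (f M)) - T 0 (\<lambda>M. inverse c * E.qp (- f M))))"
    unfolding curly_def Let_def
    by (intro reps_smult[OF l_pos] reps_minus[OF l_pos] diag_rp assms(1) diag_inv)
  also have "sc (1 / (\<epsilon> - inverse \<epsilon>)) *
      (T 0 (\<lambda>M. c * E.qp (f M)) - T 0 (\<lambda>M. inverse c * E.qp (- f M))) = T 0 (\<lambda>M. E.br (f M + k))"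
  proof -
    have "E.qp (f M + k) = c * E.qp (f M)" "E.qp (- (f M + k)) = inverse c * E.qp (- f M)" for M
      using E.qp_add[of k "f M"] E.qp_add[of "- k" "- f M"] unfolding c k by (simp_all add: add.commute)
    then show ?thesis unfolding T_minus sc_T E.br_def by (simp only: inverse_eq_divide)
  qed
  finally show ?thesis .
qed

lemma b_nz: "b_ext n b j k \<noteq> 0"
  using ab by (auto simp: b_ext_def)

lemma z_op_diag: "diag (z_op n l \<epsilon> b j k) (b_ext n b j k) (\<lambda>M. ext n M j k)"
proof (cases "(j, k) \<in> positions n")
  case True
  have "rp (Z_op n l \<epsilon> j k) (T 0 (\<lambda>M. 1 * E.qp (ext n M j k)))"
  proof -
    have "Z_op n l \<epsilon> j k = on_basis n l (\<lambda>m. vscale (E.qp (ext n (emb n m) j k)) (u_vec (redn n l (emb n m + 0))))"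
      unfolding Z_op_def using True
      by (intro on_basis_cong) (simp add: redn_emb E.qp_eq, simp add: ext_def emb_def)
    moreover have "E.qp (ext n M j k) = E.qp (ext n N j k)" if "cong_lat n l M N" for M N
    proof -
      have "E.qp (ext n M j k - ext n N j k) = 1"
        using adm_ext that by (simp add: E.qp_eq_1_iff adm_def)
      then show ?thesis using E.qp_add[of "ext n M j k - ext n N j k" "ext n N j k"] by simp
    qed
    ultimately show ?thesis using reps_T[OF l_pos, of n "\<lambda>M. E.qp (ext n M j k)" 0] by simp
  qed
  then have "diag (Z_op n l \<epsilon> j k) 1 (\<lambda>M. ext n M j k)" by (simp add: diag_def adm_ext)
  from diag_smult[OF b_nz[of j k] this] show ?thesis using True by (simp add: z_op_def b_ext_def)
next
  case False
  then show ?thesis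
    using reps_one[OF l_pos, of n] adm_ext[of j k] by (simp add: z_op_def b_ext_def diag_def ext_def T_one)
qed

lemma Phi_e_reps:
  assumes i: "i \<in> {1..n}"
  shows "rp (Phi_e n l \<epsilon> r a b i) (E.e i)"
proof -
  have "rp (Phi_e n l \<epsilon> r a b i)
      (\<Sum>k\<in>{i..n}. T (yv n i k) (\<lambda>M. 1) * T 0 (\<lambda>M. E.br (cx n i k M + 0)))"
    unfolding Phi_e_def Let_def
  proof (intro reps_finsum[OF l_pos] reps_mult[OF l_pos] x_prod_reps)
    fix k assume k: "k \<in> {i..n}"
    let ?S = "r i \<odot>\<^bsub>EV\<^esub> (z_op n l \<epsilon> b i k \<otimes>\<^bsub>EV\<^esub> z_op n l \<epsilon> b i (k - 1) \<otimes>\<^bsub>EV\<^esub>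
      inv\<^bsub>EV\<^esub> z_op n l \<epsilon> b (i - 1) (k - 1) \<otimes>\<^bsub>EV\<^esub> inv\<^bsub>EV\<^esub> z_op n l \<epsilon> b (i + 1) k)"
    have "diag ?S (r i * (b_ext n b i k * b_ext n b i (k - 1) * inverse (b_ext n b (i - 1) (k - 1))
        * inverse (b_ext n b (i + 1) k))) (\<lambda>M. ext n M i k + ext n M i (k - 1) + - ext n M (i - 1) (k - 1)
        + - ext n M (i + 1) k)"
      using rs i by (intro diag_smult diag_mult diag_inv z_op_diag) auto
    moreover have "r i * (b_ext n b i k * b_ext n b i (k - 1) * inverse (b_ext n b (i - 1) (k - 1))
        * inverse (b_ext n b (i + 1) k)) = 1"
      using rb k i by (force simp: positions_def mult.assoc)
    ultimately have "diag ?S 1 (cx n i k)" by (simp add: cx_def[abs_def])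
    from curly_reps[OF this, of 0] show "rp (curly n l \<epsilon> ?S) (T 0 (\<lambda>M. E.br (cx n i k M + 0)))"
      by simp
  qed (use i in auto)
  then show ?thesis by (simp add: E.e_def T_mult)
qed

lemma rbD:
  "(i, k) \<in> positions n \<Longrightarrow> r i * b_ext n b i k * b_ext n b i (k - 1)
     * inverse (b_ext n b (i - 1) (k - 1)) * inverse (b_ext n b (i + 1) k) = 1"
  using bspec[OF rb, of "(i, k)"] by simp

text \<open>The hypotheses fix the coefficients of e and t; those of f must follow. For k = 1 the
  conditions for \<open>e_i\<close> at (i, n) and for \<open>t_i\<close> are combined. Passing from
  k to k + 1 multiplies by a quotient of the conditions for \<open>e_j\<close> at (j, n - k) and (j,
  n + 1 - k), j = i - k, where \<open>r j\<close> drops out.\<close>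

lemma f_coefficient:
  assumes i: "i \<in> {1..n}" and k: "1 \<le> k" "k \<le> i"
  shows "s i * (b_ext n b (i + 1 - k) (n - k) * inverse (b_ext n b (i + 1 - k) (n + 1 - k))
    * b_ext n b (i - k) (n + 1 - k) * inverse (b_ext n b (i - k) (n - k))) = E.qp (- int (lam i))"
  using k
proof (induction k rule: nat_induct_at_least)
  case base
  have alg: "S * (B1 * inverse B * B2 * inverse B3) = inverse L"
    if "R * B * B1 * inverse B3 * inverse B4 = 1" "R / S * B ^ 2 * inverse B2 * inverse B4 = L"
      "R \<noteq> 0" "S \<noteq> 0" "B \<noteq> 0" "B1 \<noteq> 0" "B2 \<noteq> 0" "B3 \<noteq> 0" "B4 \<noteq> 0" for S R B B1 B2 B3 B4 L :: complex
  proof -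
    have "R * B * B1 = B3 * B4" using that(1,8,9) by (simp add: field_simps)
    then have 1: "R * (B * B1) = B3 * B4" by (simp add: mult.assoc)
    have L: "S * B2 * B4 * L = R * (B * B)"
      using that(2,4,7,9) by (simp add: field_simps power2_eq_square)
    have "S * B1 * B2 * L * (B * R * B4) = (S * B2 * B4 * L) * (R * (B * B1))" by (simp only: mult_ac)
    also have "\<dots> = R * (B * B) * (B3 * B4)" by (simp only: L 1)
    finally have "S * B1 * B2 * L * (B * R * B4) = B * B3 * (B * R * B4)" by (simp only: mult_ac)
    then have "S * B1 * B2 * L = B * B3" using that(3,5,9) by simp
    moreover have "L \<noteq> 0" using L that(3,5) by auto
    ultimately show ?thesis using that(3-) by (simp add: field_simps)
  qed
  have "(i, n) \<in> positions n" using i by (auto simp: positions_def)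
  then have "s i * (b_ext n b i (n - 1) * inverse (b_ext n b i n) * b_ext n b (i - 1) n
      * inverse (b_ext n b (i - 1) (n - 1))) = inverse (\<epsilon> ^ lam i)"
    by (intro alg[of "r i" _ _ _ "b_ext n b (i + 1) n"]) (use rb rsb rs i b_nz in auto)
  then show ?case by (simp add: E.qp_eq power_int_minus)
next
  case (Suc k)
  have alg: "S * (C4 * inverse C3 * C2 * inverse C5) = S * (D1 * inverse D2 * C1 * inverse C3)"
    if "R * C3 * C4 * inverse C5 * inverse D1 = 1" "R * C1 * C3 * inverse C2 * inverse D2 = 1"
      "R \<noteq> 0" "C1 \<noteq> 0" "C2 \<noteq> 0" "C3 \<noteq> 0" "C4 \<noteq> 0" "C5 \<noteq> 0" "D1 \<noteq> 0" "D2 \<noteq> 0"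
    for S R C1 C2 C3 C4 C5 D1 D2 :: complex
  proof -
    have 1: "R * C3 * C4 = C5 * D1" "C2 * D2 = R * C1 * C3" using that by (simp_all add: field_simps)
    have "C4 * C2 * D2 * (R * C3) = (R * C3 * C4) * (C2 * D2)" by (simp only: mult_ac)
    also have "\<dots> = (C5 * D1) * (R * C1 * C3)" by (simp only: 1)
    finally have "C4 * C2 * D2 * (R * C3) = D1 * C1 * C5 * (R * C3)" by (simp only: mult_ac)
    then have "C4 * C2 * D2 = D1 * C1 * C5" using that(3,6) by simp
    then show ?thesis using that by (simp add: field_simps)
  qed
  define j where "j = i - k"
  have j: "1 \<le> j" "j \<le> n - k" "k < n" "i - Suc k = j - 1" "i + 1 - Suc k = j" "i + 1 - k = j + 1"
    "n - k - 1 = n - Suc k" "n + 1 - Suc k = n - k" "n + 1 - k - 1 = n - k"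
    using i Suc by (auto simp: j_def)
  have "(j, n - k) \<in> positions n" "(j, n + 1 - k) \<in> positions n"
    using j Suc by (auto simp: positions_def)
  from rbD[OF this(1), unfolded j(7)] rbD[OF this(2), unfolded j(9)]
  have "r j * b_ext n b j (n - k) * b_ext n b j (n - Suc k) * inverse (b_ext n b (j - 1) (n - Suc k))
      * inverse (b_ext n b (j + 1) (n - k)) = 1"
    "r j * b_ext n b j (n + 1 - k) * b_ext n b j (n - k) * inverse (b_ext n b (j - 1) (n - k))
      * inverse (b_ext n b (j + 1) (n + 1 - k)) = 1"
    .
  then have "s i * (b_ext n b j (n - Suc k) * inverse (b_ext n b j (n - k)) * b_ext n b (j - 1) (n - k)
      * inverse (b_ext n b (j - 1) (n - Suc k))) =
    s i * (b_ext n b (j + 1) (n - k) * inverse (b_ext n b (j + 1) (n + 1 - k)) * b_ext n b j (n + 1 - k)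
      * inverse (b_ext n b j (n - k)))"
    by (rule alg) (use rs j b_nz in auto)
  also have "\<dots> = E.qp (- int (lam i))" using Suc j by (simp add: j_def)
  finally show ?case using j by simp
qed

lemma Phi_f_reps:
  assumes i: "i \<in> {1..n}"
  shows "rp (Phi_f n l \<epsilon> s a b i) (F.fl i)"
proof -
  let ?i = "n + 1 - i"
  have "rp (Phi_f n l \<epsilon> s a b i)
      (\<Sum>k\<in>{1..i}. T (flip n (yv n ?i (n + 1 - k))) (\<lambda>M. 1) *
        T 0 (\<lambda>M. E.br (cx n ?i (n + 1 - k) (flip n M) + - int (lam i))))"
    unfolding Phi_f_def Let_def
  proof (intro reps_finsum[OF l_pos] reps_mult[OF l_pos] x_inv_prod_reps i)
    fix k assume k: "k \<in> {1..i}"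
    let ?S = "s i \<odot>\<^bsub>EV\<^esub> (z_op n l \<epsilon> b (i + 1 - k) (n - k) \<otimes>\<^bsub>EV\<^esub> inv\<^bsub>EV\<^esub> z_op n l \<epsilon> b (i + 1 - k) (n + 1 - k)
        \<otimes>\<^bsub>EV\<^esub> z_op n l \<epsilon> b (i - k) (n + 1 - k) \<otimes>\<^bsub>EV\<^esub> inv\<^bsub>EV\<^esub> z_op n l \<epsilon> b (i - k) (n - k))"
    have "diag ?S (s i * (b_ext n b (i + 1 - k) (n - k) * inverse (b_ext n b (i + 1 - k) (n + 1 - k))
      * b_ext n b (i - k) (n + 1 - k) * inverse (b_ext n b (i - k) (n - k))))
      (\<lambda>M. ext n M (i + 1 - k) (n - k) + - ext n M (i + 1 - k) (n + 1 - k) + ext n M (i - k) (n + 1 - k)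
        + - ext n M (i - k) (n - k))"
      using rs i by (intro diag_smult diag_mult diag_inv z_op_diag) auto
    moreover have "(\<lambda>M. ext n M (i + 1 - k) (n - k) + - ext n M (i + 1 - k) (n + 1 - k)
        + ext n M (i - k) (n + 1 - k) + - ext n M (i - k) (n - k)) =
      (\<lambda>M. cx n ?i (n + 1 - k) (flip n M))"
    proof
      fix M
      have "(?i, n + 1 - k) \<in> positions n" "n + 1 - k + 1 - ?i = i + 1 - k" "n + 1 - k - ?i = i - k"
        "n + 1 - k - 1 = n - k"
        using i k by (auto simp: positions_def)
      then show "ext n M (i + 1 - k) (n - k) + - ext n M (i + 1 - k) (n + 1 - k)
          + ext n M (i - k) (n + 1 - k) + - ext n M (i - k) (n - k) = cx n ?i (n + 1 - k) (flip n M)"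
        using cx_flip[of ?i "n + 1 - k" n M] by simp
    qed
    ultimately have "diag ?S (E.qp (- int (lam i))) (\<lambda>M. cx n ?i (n + 1 - k) (flip n M))"
      using f_coefficient[OF i, of k] k by simp
    from curly_reps[OF this refl]
    show "rp (curly n l \<epsilon> ?S) (T 0 (\<lambda>M. E.br (cx n ?i (n + 1 - k) (flip n M) + - int (lam i))))" .
  qed auto
  also have "(\<Sum>k\<in>{1..i}. T (flip n (yv n ?i (n + 1 - k))) (\<lambda>M. 1) *
        T 0 (\<lambda>M. E.br (cx n ?i (n + 1 - k) (flip n M) + - int (lam i)))) = F.fl i"
    unfolding fl_eq[OF i]
    by (rule sum.reindex_bij_witness[of _ "\<lambda>k. n + 1 - k" "\<lambda>k. n + 1 - k"])
      (use i in \<open>auto simp: T_mult\<close>)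
  finally show ?thesis .
qed

lemma Phi_t_reps:
  assumes i: "i \<in> {1..n}"
  shows "rp (Phi_t n l \<epsilon> r s b i) (tl i)" "rp (inv\<^bsub>EV\<^esub> Phi_t n l \<epsilon> r s b i) (tl' i)"
proof -
  interpret ring EV by (rule EndV_ring[OF l_pos])
  have "z_op n l \<epsilon> b i n \<in> carrier EV"
    by (rule reps_carrier[OF l_pos diag_rp[OF z_op_diag]])
  then have sq: "z_op n l \<epsilon> b i n [^]\<^bsub>EV\<^esub> (2::nat) = z_op n l \<epsilon> b i n \<otimes>\<^bsub>EV\<^esub> z_op n l \<epsilon> b i n"
    by (simp add: numeral_2_eq_2)
  have "diag (Phi_t n l \<epsilon> r s b i) (r i / s i * (b_ext n b i n * b_ext n b i n * inverse (b_ext n b (i - 1) n)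
      * inverse (b_ext n b (i + 1) n))) (\<lambda>M. ext n M i n + ext n M i n + - ext n M (i - 1) n + - ext n M (i + 1) n)"
    unfolding Phi_t_def Let_def sq
    using rs i by (intro diag_smult diag_mult diag_inv z_op_diag) auto
  moreover have "r i / s i * (b_ext n b i n * b_ext n b i n * inverse (b_ext n b (i - 1) n)
      * inverse (b_ext n b (i + 1) n)) = \<epsilon> ^ lam i"
    using rsb i by (simp add: power2_eq_square mult.assoc)
  ultimately have d: "diag (Phi_t n l \<epsilon> r s b i) (E.qp (int (lam i))) (tau n i)"
    by (simp add: tau_def[abs_def] E.qp_eq)
  have k: "inverse (E.qp (int (lam i))) = E.qp (- int (lam i))"
    by (rule inverse_unique) (rule E.qp_inverse)
  have eq: "E.qp (tau n i M + int (lam i)) = E.qp (int (lam i)) * E.qp (tau n i M)"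
    "E.qp (- (tau n i M + int (lam i))) = E.qp (- int (lam i)) * E.qp (- tau n i M)" for M
    by (simp_all only: E.qp_add[symmetric] minus_add_distrib add.commute)
  show "rp (Phi_t n l \<epsilon> r s b i) (tl i)"
    unfolding tl_def eq by (rule diag_rp[OF d])
  show "rp (inv\<^bsub>EV\<^esub> Phi_t n l \<epsilon> r s b i) (tl' i)"
    unfolding tl'_def eq using diag_rp[OF diag_inv[OF d]] unfolding k .
qed

fun gen_lop :: "nat qgen \<Rightarrow> complex lop" where
  "gen_lop (GE i) = E.e i"
| "gen_lop (GF i) = F.fl i"
| "gen_lop (GT i) = tl i"
| "gen_lop (GTinv i) = tl' i"

lemma Phi_gen_reps: "x \<in> qgens n {1..n} \<Longrightarrow> rp (Phi_gen n l \<epsilon> r s a b x) (gen_lop x)"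
  using Phi_e_reps Phi_f_reps Phi_t_reps by (auto simp: qgens_def)

end

section \<open>Roots of type A\<close>

definition rt :: "nat \<Rightarrow> nat \<Rightarrow> root" where
  "rt j k = (\<Sum>i\<in>{j..k}. simple_root i)"

definition bot_index :: "root \<Rightarrow> nat" where
  "bot_index \<alpha> = Min {i. \<alpha> i \<noteq> 0}"

lemma rt_apply: "rt j k m = (if j \<le> m \<and> m \<le> k then 1 else 0)"
proof -
  have "(\<Sum>i\<in>I. simple_root i) m = (\<Sum>i\<in>I. simple_root i m)" for I
    by (induction I rule: infinite_finite_induct) auto
  then show ?thesis by (simp add: rt_def simple_root_def)
qed

lemma rt_refl: "rt j j = simple_root j"
  by (simp add: rt_def)

lemma rt_add: "i < k \<Longrightarrow> rt (Suc i) k + simple_root i = rt i k"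
  unfolding rt_def by (subst (2) sum.atLeast_Suc_atMost) (simp_all add: add.commute)

lemma pos_roots_rt: "pos_roots n = {rt j k | j k. 1 \<le> j \<and> j \<le> k \<and> k \<le> n}"
  by (simp add: pos_roots_def rt_def)

lemma rt_support: "{i. rt j k i \<noteq> 0} = {j..k}"
  by (auto simp: rt_apply)

lemma top_index_rt: "j \<le> k \<Longrightarrow> top_index (rt j k) = k"
  and bot_index_rt: "j \<le> k \<Longrightarrow> bot_index (rt j k) = j"
  unfolding top_index_def bot_index_def rt_support by (auto intro: Max_eqI Min_eqI)

lemma root_form_rt:
  assumes "i \<in> {1..n}" "1 \<le> j" "k \<le> n"
  shows "root_form n (simple_root i) (rt j k) =
    (if j \<le> i \<and> i \<le> k then 2 else 0) - (if j \<le> i + 1 \<and> i + 1 \<le> k then 1 else 0)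
      - (if j \<le> i - 1 \<and> i - 1 \<le> k then 1 else 0)"
proof -
  have "root_form n (simple_root i) (rt j k) = (\<Sum>i'\<in>{1..n}. if i' = i then \<Sum>m\<in>{1..n}. cartan i' m * rt j k m else 0)"
    unfolding root_form_def by (intro sum.cong) (auto simp: simple_root_def)
  also have "\<dots> = (\<Sum>m\<in>{1..n}. cartan i m * rt j k m)" using assms(1) by simp
  also have "\<dots> = (\<Sum>m\<in>{1..n}. if m \<in> {j..k} then cartan i m else 0)"
    by (intro sum.cong) (auto simp: rt_apply)
  also have "\<dots> = (\<Sum>m\<in>{1..n} \<inter> {j..k}. cartan i m)" by (simp only: sum.inter_restrict finite_atLeastAtMost)
  also have "{1..n} \<inter> {j..k} = {j..k}" using assms by auto
  also have "(\<Sum>m\<in>{j..k}. cartan i m) = (\<Sum>m\<in>{j..k}. (if m = i then 2 else 0) - (if m = i + 1 then 1 else 0)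
      - (if m = i - 1 then 1 else 0))"
    using assms(1) by (intro sum.cong) (auto simp: cartan_def)
  also have "\<dots> = (if j \<le> i \<and> i \<le> k then 2 else 0) - (if j \<le> i + 1 \<and> i + 1 \<le> k then 1 else 0)
      - (if j \<le> i - 1 \<and> i - 1 \<le> k then 1 else 0)"
    by (simp add: sum_subtractf)
  finally show ?thesis .
qed

text \<open>With \<open>i < k\<close> the extension at the upper end is excluded. So a non-simple
  root arises in exactly one way, and the recursion for the root vectors is consistent.\<close>

lemma root_form_minus_1:
  assumes "i \<in> {1..n}" "1 \<le> j" "j \<le> k" "k \<le> n" "i < k"
  shows "root_form n (simple_root i) (rt j k) = - 1 \<longleftrightarrow> j = Suc i"
  using assms by (subst root_form_rt) auto

lemma root_form_0:
  assumes "i \<in> {1..n}" "1 \<le> j" "j \<le> k" "k \<le> n" "i < k" "root_form n (simple_root i) (rt j k) = 0"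
  shows "i + 2 \<le> j \<or> j < i"
proof (rule ccontr)
  assume "\<not> ?thesis"
  then have "j = i \<or> j = Suc i" by auto
  then show False using assms(6) root_form_rt[OF assms(1,2,4)] assms(1-5) by (auto split: if_splits)
qed

lemma sc_mult_power: "(sc c * A) ^ m = sc (c ^ m) * A ^ m"
proof (induction m)
  case (Suc m)
  have "(sc c * A) ^ Suc m = sc c * (A * (sc (c ^ m) * A ^ m))" by (simp add: Suc mult.assoc)
  then show ?case by (simp add: sc_left_commute[of A] sc_mult mult.assoc)
qed simp

section \<open>The relations\<close>

lemma common_rels_carrier:
  assumes "\<And>i. i \<in> {1..n} \<Longrightarrow> e i \<in> carrier (free_alg G)" "\<And>i. i \<in> {1..n} \<Longrightarrow> f i \<in> carrier (free_alg G)"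
    "\<And>i. i \<in> {1..n} \<Longrightarrow> GT i \<in> G \<and> GTinv i \<in> G"
  shows "common_rels n \<epsilon> e f \<subseteq> carrier (free_alg G)"
proof -
  have t: "t_gen i \<in> carrier (free_alg G)" "t_inv_gen i \<in> carrier (free_alg G)" if "i \<in> {1..n}" for i
    using assms(3)[OF that] by (auto simp: t_gen_def t_inv_gen_def intro: free_closed)
  show ?thesis
    unfolding common_rels_def Let_def
    by (auto intro!: free_closed free_closed' assms(1,2) t)
qed

context cyclic_rep
begin

lemma qint_2: "qint \<epsilon> 2 = \<epsilon> + inverse \<epsilon>"
proof -
  have "\<epsilon> powi 2 - \<epsilon> powi - 2 = (\<epsilon> + inverse \<epsilon>) * (\<epsilon> - inverse \<epsilon>)"
    using E.\<epsilon>_nz by (simp add: power_int_minus power2_eq_square algebra_simps)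
  then show ?thesis using E.diff_nz by (simp add: qint_def)
qed

text \<open>Generic in the free generators \<open>e\<close> and \<open>f\<close>, since these
  relations belong to both algebras.\<close>

lemma common_rels_tev:
  assumes H: "\<And>i. i \<in> {1..n} \<Longrightarrow> tev H (e i) = E.e i" "\<And>i. i \<in> {1..n} \<Longrightarrow> tev H (f i) = F.fl i"
    "\<And>i. H (GT i) = tl i" "\<And>i. H (GTinv i) = tl' i"
    and z: "z \<in> common_rels n \<epsilon> e f"
  shows "tev H z = 0"
proof -
  have t: "tev H (t_gen i) = tl i" "tev H (t_inv_gen i) = tl' i" for i
    by (simp_all add: t_gen_def t_inv_gen_def tev_simps H)
  note ev = tev_add tev_minus tev_mult tev_simps t H(1,2)
  from z consider
      (1) i where "i \<in> {1..n}" "z = t_gen i * t_inv_gen i - 1"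
    | (2) i where "i \<in> {1..n}" "z = t_inv_gen i * t_gen i - 1"
    | (3) i j where "i \<in> {1..n}" "j \<in> {1..n}" "z = t_gen i * t_gen j - t_gen j * t_gen i"
    | (4) i j where "i \<in> {1..n}" "j \<in> {1..n}" "z = t_gen i * e j * t_inv_gen i - const_free (\<epsilon> powi cartan i j) * e j"
    | (5) i j where "i \<in> {1..n}" "j \<in> {1..n}" "z = t_gen i * f j * t_inv_gen i - const_free (\<epsilon> powi (- cartan i j)) * f j"
    | (6) i j where "i \<in> {1..n}" "j \<in> {1..n}" "z = e i * f j - f j * e i
         - (if i = j then const_free (1 / (\<epsilon> - inverse \<epsilon>)) * (t_gen i - t_inv_gen i) else 0)"
    unfolding common_rels_def Let_def by blast
  then show ?thesis
  proof cases
    case 1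
    then show ?thesis by (simp add: ev tl_inverse)
  next
    case 2
    then show ?thesis by (simp add: ev tl_inverse)
  next
    case 3
    then show ?thesis using tl_commute[of i j] by (simp add: ev)
  next
    case 4
    then show ?thesis using tl_e[of i j] by (simp add: ev)
  next
    case 5
    then show ?thesis using tl_f[of i j] by (simp add: ev)
  next
    case 6
    then show ?thesis using e_f_commutator[of i j] by (cases "i = j") (simp_all add: ev tev_0)
  qed
qed

lemma serre_rels_tev:
  assumes H: "\<And>i. i \<in> {1..n} \<Longrightarrow> tev H (y i) = g i" and z: "z \<in> serre_rels n \<epsilon> y"
    and g: "serre_family (\<lambda>c A. sc c * A) \<epsilon> (inverse \<epsilon>) (inverse (\<epsilon> + inverse \<epsilon>)) n g"
  shows "tev H z = 0"
proof -
  interpret g: serre_family "\<lambda>c A. sc c * A" \<epsilon> "inverse \<epsilon>" "inverse (\<epsilon> + inverse \<epsilon>)" n g by (rule g)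
  note ev = tev_add tev_minus tev_mult tev_power tev_simps H
  from z consider
      (1) i j where "i \<in> {1..n}" "j \<in> {1..n}" "i + 2 \<le> j \<or> j + 2 \<le> i" "z = y i * y j - y j * y i"
    | (2) i j where "i \<in> {1..n}" "j \<in> {1..n}" "i = j + 1 \<or> j = i + 1"
        "z = y i ^ 2 * y j - const_free (qint \<epsilon> 2) * (y i * y j * y i) + y j * y i ^ 2"
    unfolding serre_rels_def Let_def by blast
  then show ?thesis
  proof cases
    case 1
    then show ?thesis using g.far[of i j] g.far[of j i] by (auto simp: ev)
  next
    case 2
    then have "E.srr (g i) (g j) = 0" using g.serre[of i] g.serre'[of j] by auto
    then show ?thesis using 2 by (simp add: ev E.srr_def qint_2 power2_eq_square mult.assoc)
  qed
qed

lemma E_family: "serre_family (\<lambda>c A. sc c * A) \<epsilon> (inverse \<epsilon>) (inverse (\<epsilon> + inverse \<epsilon>)) n E.e"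
  by (rule E.serre_family_axioms)

lemma F_family: "serre_family (\<lambda>c A. sc c * A) \<epsilon> (inverse \<epsilon>) (inverse (\<epsilon> + inverse \<epsilon>)) n F.fl"
  by (rule F.fl.serre_family_axioms)

lemma U_rels_carrier: "U_rels n \<epsilon> \<subseteq> carrier (free_alg (qgens n {1..n}))"
proof -
  have gens: "gen_free (GE i) \<in> carrier (free_alg (qgens n {1..n}))"
    "gen_free (GF i) \<in> carrier (free_alg (qgens n {1..n}))" if "i \<in> {1..n}" for i
    using that by (auto simp: qgens_def intro: free_closed)
  have serre: "serre_rels n \<epsilon> y \<subseteq> carrier (free_alg G)"
    if "\<And>i. i \<in> {1..n} \<Longrightarrow> y i \<in> carrier (free_alg G)" for y :: "nat \<Rightarrow> nat qgen free" and G
    unfolding serre_rels_def Let_def using that by (auto intro!: free_closed free_closed')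
  show ?thesis
    unfolding U_rels_def Let_def
    by (intro Un_least serre common_rels_carrier gens) (auto simp: qgens_def)
qed

lemma U_rels_tev: "x \<in> U_rels n \<epsilon> \<Longrightarrow> tev gen_lop x = 0"
  unfolding U_rels_def Let_def
  using common_rels_tev[of gen_lop "\<lambda>i. gen_free (GE i)" "\<lambda>i. gen_free (GF i)" x]
    serre_rels_tev[OF _ _ E_family, of gen_lop "\<lambda>i. gen_free (GE i)" x]
    serre_rels_tev[OF _ _ F_family, of gen_lop "\<lambda>i. gen_free (GF i)" x]
  by (auto simp: tev_simps)

abbreviation "PhiU \<equiv> Phi n l \<epsilon> r s a b"

lemma PhiU_reps:
  "p \<in> carrier (free_alg (qgens n {1..n})) \<Longrightarrow> rp (PhiU (cls (qgens n {1..n}) (U_rels n \<epsilon>) p)) (tev gen_lop p)"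
  unfolding Phi_def
  by (rule induced_presented(1)[OF l_pos U_rels_carrier Phi_gen_reps U_rels_tev])

lemma PhiU_hom: "PhiU \<in> alg_hom (Ueps n \<epsilon>) EV"
  unfolding Phi_def Ueps_def
  by (rule induced_presented(2)[OF l_pos U_rels_carrier Phi_gen_reps U_rels_tev])

lemma PhiU_gen_reps: "x \<in> qgens n {1..n} \<Longrightarrow> rp (PhiU (U_cls n \<epsilon> x)) (gen_lop x)"
  using PhiU_reps[OF free_closed(4)] by (simp add: U_cls_def tev_simps)

definition root_E :: "root \<Rightarrow> complex lop" where
  "root_E \<alpha> = E.rv (bot_index \<alpha>) (top_index \<alpha> - bot_index \<alpha>)"

text \<open>
  Passing from the recursion of the \<open>f\<^sub>\<alpha>\<close> to that of the \<open>e\<^sub>\<alpha>\<close> costs a factor \<open>- \<epsilon>\<close> at every step.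
\<close>

definition root_F :: "root \<Rightarrow> complex lop" where
  "root_F \<alpha> = sc ((- \<epsilon>) ^ (top_index \<alpha> - bot_index \<alpha>)) *
     F.fl.rv (bot_index \<alpha>) (top_index \<alpha> - bot_index \<alpha>)"

lemma root_E_rt: "j \<le> k \<Longrightarrow> root_E (rt j k) = E.rv j (k - j)"
  and root_F_rt: "j \<le> k \<Longrightarrow> root_F (rt j k) = sc ((- \<epsilon>) ^ (k - j)) * F.fl.rv j (k - j)"
  by (simp_all add: root_E_def root_F_def top_index_rt bot_index_rt)

lemma root_E_simple: "root_E (simple_root i) = E.e i"
  and root_F_simple: "root_F (simple_root i) = F.fl i"
  using root_E_rt[of i i] root_F_rt[of i i] by (simp_all add: rt_refl)

lemma root_E_step:
  assumes "i < k"
  shows "root_E (rt i k) = sc (inverse \<epsilon>) * (E.e i * root_E (rt (Suc i) k)) - root_E (rt (Suc i) k) * E.e i"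
proof -
  have "k - i = Suc (k - Suc i)" using assms by simp
  then show ?thesis using assms by (simp add: root_E_rt E.qcomm_def)
qed

lemma root_F_step:
  assumes "i < k"
  shows "root_F (rt i k) = sc \<epsilon> * (root_F (rt (Suc i) k) * F.fl i) - F.fl i * root_F (rt (Suc i) k)"
proof -
  have k: "k - i = Suc (k - Suc i)" using assms by simp
  define c R where "c = (- \<epsilon>) ^ (k - Suc i)" and "R = F.fl.rv (Suc i) (k - Suc i)"
  have "root_F (rt i k) = sc (- \<epsilon> * c) * (sc (inverse \<epsilon>) * (F.fl i * R) - R * F.fl i)"
    using assms k by (simp add: root_F_rt E.qcomm_def c_def R_def)
  also have "\<dots> = sc (- \<epsilon> * c * inverse \<epsilon>) * (F.fl i * R) - sc (- \<epsilon> * c) * (R * F.fl i)"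
    by (simp only: right_diff_distrib sc_mult mult.assoc)
  also have "- \<epsilon> * c * inverse \<epsilon> = - c" using E.\<epsilon>_nz by simp
  also have "sc (- c) * (F.fl i * R) - sc (- \<epsilon> * c) * (R * F.fl i) =
      sc \<epsilon> * (sc c * R * F.fl i) - F.fl i * (sc c * R)"
    by (simp add: sc_uminus mult.assoc sc_left_commute[of "F.fl i"])
  finally show ?thesis using assms by (simp add: root_F_rt c_def R_def)
qed

fun fin_lop :: "root qgen \<Rightarrow> complex lop" where
  "fin_lop (GE \<alpha>) = root_E \<alpha>"
| "fin_lop (GF \<alpha>) = root_F \<alpha>"
| "fin_lop (GT i) = tl i"
| "fin_lop (GTinv i) = tl' i"

end

lemma scaled_q_commute:
  fixes A B :: "'k::comm_ring_1 lop"
  assumes "sc q * (A * B) = B * A"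
  shows "sc q * ((sc c * A) * (sc d * B)) = (sc d * B) * (sc c * A)"
proof -
  have swap: "(sc c * A) * (sc d * B) = sc c * (sc d * (A * B))" for c d and A B :: "'k lop"
    by (simp only: mult.assoc sc_left_commute[of A d B])
  have collect: "sc x * (sc y * (sc z * C)) = sc (x * y * z) * C" for x y z and C :: "'k lop"
    by (simp only: sc_mult mult.assoc)
  have "sc q * (sc c * (sc d * (A * B))) = sc d * (sc c * (sc q * (A * B)))"
    unfolding collect by (simp only: mult.commute mult.left_commute)
  then show ?thesis unfolding swap assms .
qed

context cyclic_rep
begin

lemma simple_root_pos: "i \<in> {1..n} \<Longrightarrow> simple_root i \<in> pos_roots n"
  unfolding pos_roots_rt by (auto simp flip: rt_refl)

lemma fin_carrier:
  "\<alpha> \<in> pos_roots n \<Longrightarrow> gen_free (GE \<alpha>) \<in> carrier (free_alg (qgens n (pos_roots n)))"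
  "\<alpha> \<in> pos_roots n \<Longrightarrow> gen_free (GF \<alpha>) \<in> carrier (free_alg (qgens n (pos_roots n)))"
  "i \<in> {1..n} \<Longrightarrow> t_gen i \<in> carrier (free_alg (qgens n (pos_roots n)))"
  by (auto simp: qgens_def t_gen_def intro: free_closed)

lemma orthogonal_commute:
  assumes i: "i \<in> {1..n}" and jk: "1 \<le> j" "j \<le> k" "k \<le> n" "i < k" and ij: "i + 2 \<le> j \<or> j < i"
  shows "E.e i * root_E (rt j k) = root_E (rt j k) * E.e i"
    "F.fl i * root_F (rt j k) = root_F (rt j k) * F.fl i"
proof -
  have k: "j + (k - j) = k" using jk by simp
  have *: "E.e i * E.rv j (k - j) = E.rv j (k - j) * E.e i \<and>
    F.fl i * F.fl.rv j (k - j) = F.fl.rv j (k - j) * F.fl i"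
    using ij
  proof
    assume ij: "i + 2 \<le> j"
    have "j + (k - j) \<le> n" using k jk by simp
    then show ?thesis using E.rv_far[OF i ij] F.fl.rv_far[OF i ij] by blast
  next
    assume ij: "j < i"
    have "i < j + (k - j)" "j + (k - j) \<le> n" using k jk by simp_all
    then show ?thesis using E.rv_interior[OF jk(1) ij] F.fl.rv_interior[OF jk(1) ij] by blast
  qed
  show "E.e i * root_E (rt j k) = root_E (rt j k) * E.e i" using * jk by (simp add: root_E_rt)
  show "F.fl i * root_F (rt j k) = root_F (rt j k) * F.fl i"
    using scaled_q_commute[of 1 "F.fl i" "F.fl.rv j (k - j)" 1 "(- \<epsilon>) ^ (k - j)"] * jk
    by (simp add: root_F_rt)
qed

lemma adjacent_commute:
  assumes "1 \<le> i" "i < k" "k \<le> n"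
  shows "sc \<epsilon> * (E.e i * root_E (rt i k)) = root_E (rt i k) * E.e i"
    "sc \<epsilon> * (root_E (rt i k) * root_E (rt (Suc i) k)) = root_E (rt (Suc i) k) * root_E (rt i k)"
    "sc \<epsilon> * (F.fl i * root_F (rt i k)) = root_F (rt i k) * F.fl i"
    "sc \<epsilon> * (root_F (rt i k) * root_F (rt (Suc i) k)) = root_F (rt (Suc i) k) * root_F (rt i k)"
proof -
  have k: "k - i = Suc (k - Suc i)" "Suc i + (k - Suc i) \<le> n" using assms by auto
  have E: "root_E (rt i k) = E.rv i (Suc (k - Suc i))" "root_E (rt (Suc i) k) = E.rv (Suc i) (k - Suc i)"
    using assms k by (simp_all only: root_E_rt less_imp_le Suc_leI)
  have F: "root_F (rt i k) = sc ((- \<epsilon>) ^ (k - i)) * F.fl.rv i (Suc (k - Suc i))"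
    "root_F (rt (Suc i) k) = sc ((- \<epsilon>) ^ (k - Suc i)) * F.fl.rv (Suc i) (k - Suc i)"
    using assms k by (simp_all only: root_F_rt less_imp_le Suc_leI)
  show "sc \<epsilon> * (E.e i * root_E (rt i k)) = root_E (rt i k) * E.e i"
    unfolding E by (rule E.rv_left[OF assms(1) k(2)])
  show "sc \<epsilon> * (root_E (rt i k) * root_E (rt (Suc i) k)) = root_E (rt (Suc i) k) * root_E (rt i k)"
    unfolding E by (rule E.rv_right[OF assms(1) k(2)])
  show "sc \<epsilon> * (F.fl i * root_F (rt i k)) = root_F (rt i k) * F.fl i"
    using scaled_q_commute[OF F.fl.rv_left[OF assms(1) k(2)], of 1] unfolding F sc_simps mult_1 .
  show "sc \<epsilon> * (root_F (rt i k) * root_F (rt (Suc i) k)) = root_F (rt (Suc i) k) * root_F (rt i k)"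
    unfolding F by (rule scaled_q_commute[OF F.fl.rv_right[OF assms(1) k(2)]])
qed

lemma root_power:
  assumes "1 \<le> j" "j \<le> k" "k \<le> n"
  shows "root_E (rt j k) ^ l = 0" "root_F (rt j k) ^ l = 0"
proof -
  have "j + (k - j) \<le> n" using assms by simp
  then show "root_E (rt j k) ^ l = 0" "root_F (rt j k) ^ l = 0"
    using assms E.rv_power(1)[of j "k - j"] F.rv_power(2)[of j "k - j"]
    by (simp_all add: root_E_rt root_F_rt sc_mult_power)
qed

lemma Ufin_rels_hold:
  assumes "z \<in> Ufin_rels n l \<epsilon>"
  shows "z \<in> carrier (free_alg (qgens n (pos_roots n))) \<and> tev fin_lop z = 0"
proof -
  let ?G = "qgens n (pos_roots n)"
  let ?E = "\<lambda>\<alpha>. gen_free (GE \<alpha>) :: root qgen free" and ?F = "\<lambda>\<alpha>. gen_free (GF \<alpha>) :: root qgen free"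
  let ?e = "\<lambda>i. ?E (simple_root i)" and ?f = "\<lambda>i. ?F (simple_root i)"
  let ?R0 = "\<lambda>i \<alpha>. i \<in> {1..n} \<and> \<alpha> \<in> pos_roots n \<and> root_form n (simple_root i) \<alpha> = 0 \<and> i < top_index \<alpha>"
  let ?R1 = "\<lambda>i \<alpha>. i \<in> {1..n} \<and> \<alpha> \<in> pos_roots n \<and> root_form n (simple_root i) \<alpha> = - 1 \<and> i < top_index \<alpha>"
  let ?q = "const_free \<epsilon>" and ?q' = "const_free (inverse \<epsilon>)"
  note ev = tev_add tev_minus tev_mult tev_power tev_simps fin_lop.simps root_E_simple root_F_simple
  note cl = free_closed(1-3,5-7) free_closed' fin_carrier simple_root_pos
  have R0: "\<exists>j k. \<alpha> = rt j k \<and> 1 \<le> j \<and> j \<le> k \<and> k \<le> n \<and> i < k \<and> (i + 2 \<le> j \<or> j < i)"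
    if R0: "?R0 i \<alpha>" for i \<alpha>
  proof -
    obtain j k where jk: "\<alpha> = rt j k" "1 \<le> j" "j \<le> k" "k \<le> n" using R0 unfolding pos_roots_rt by blast
    then have "i < k" using R0 by (simp add: top_index_rt)
    then show ?thesis using root_form_0[of i n j k] R0 jk by blast
  qed
  have R1: "\<exists>k. \<alpha> = rt (Suc i) k \<and> \<alpha> + simple_root i = rt i k \<and> 1 \<le> i \<and> i < k \<and> k \<le> n"
    if R1: "?R1 i \<alpha>" for i \<alpha>
  proof -
    obtain j k where jk: "\<alpha> = rt j k" "1 \<le> j" "j \<le> k" "k \<le> n" using R1 unfolding pos_roots_rt by blast
    then have "i < k" using R1 by (simp add: top_index_rt)
    moreover from this have "j = Suc i" using root_form_minus_1[of i n j k] R1 jk by blast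
    ultimately show ?thesis using rt_add[of i k] jk R1 by auto
  qed
  have pos: "rt j k \<in> pos_roots n" if "1 \<le> j" "j \<le> k" "k \<le> n" for j k
    using that unfolding pos_roots_rt by blast
  have c: ?thesis if c: "z \<in> common_rels n \<epsilon> ?e ?f"
  proof -
    have "common_rels n \<epsilon> ?e ?f \<subseteq> carrier (free_alg ?G)"
    proof (rule common_rels_carrier)
      fix i assume i: "i \<in> {1..n}"
      show "?e i \<in> carrier (free_alg ?G)" by (rule fin_carrier(1)[OF simple_root_pos[OF i]])
      show "?f i \<in> carrier (free_alg ?G)" by (rule fin_carrier(2)[OF simple_root_pos[OF i]])
      show "GT i \<in> ?G \<and> GTinv i \<in> ?G" using i by (auto simp: qgens_def)
    qed
    moreover have "tev fin_lop z = 0"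
      by (rule common_rels_tev[OF _ _ _ _ c]) (simp_all add: tev_simps root_E_simple root_F_simple)
    ultimately show ?thesis using c by blast
  qed
  have e0: ?thesis if e0: "z = ?e i * ?E \<alpha> - ?E \<alpha> * ?e i" "?R0 i \<alpha>" for i \<alpha>
  proof -
    from R0[OF e0(2)] obtain j k where jk: "\<alpha> = rt j k" "1 \<le> j" "j \<le> k" "k \<le> n" "i < k" "i + 2 \<le> j \<or> j < i"
      by blast
    have "tev fin_lop z = 0" unfolding e0(1) ev jk(1)
      using orthogonal_commute(1)[OF _ jk(2-6)] e0(2) by simp
    then show ?thesis using e0 by (auto intro!: cl)
  qed
  have f0: ?thesis if f0: "z = ?f i * ?F \<alpha> - ?F \<alpha> * ?f i" "?R0 i \<alpha>" for i \<alpha>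
  proof -
    from R0[OF f0(2)] obtain j k where jk: "\<alpha> = rt j k" "1 \<le> j" "j \<le> k" "k \<le> n" "i < k" "i + 2 \<le> j \<or> j < i"
      by blast
    have "tev fin_lop z = 0" unfolding f0(1) ev jk(1)
      using orthogonal_commute(2)[OF _ jk(2-6)] f0(2) by simp
    then show ?thesis using f0 by (auto intro!: cl)
  qed
  have e1: ?thesis if e1: "z = ?E (\<alpha> + simple_root i) - (?q' * (?e i * ?E \<alpha>) - ?E \<alpha> * ?e i)" "?R1 i \<alpha>" for i \<alpha>
  proof -
    from R1[OF e1(2)] obtain k where k: "\<alpha> = rt (Suc i) k" "\<alpha> + simple_root i = rt i k" "1 \<le> i" "i < k" "k \<le> n"
      by blast
    have "tev fin_lop z = 0" unfolding e1(1) k(2) unfolding ev k(1) root_E_step[OF k(4)] by simp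
    moreover have "\<alpha> + simple_root i \<in> pos_roots n" unfolding k(2) using k by (intro pos) auto
    ultimately show ?thesis using e1 by (auto intro!: cl)
  qed
  have e2: ?thesis if e2: "z = ?q * (?e i * ?E (\<alpha> + simple_root i)) - ?E (\<alpha> + simple_root i) * ?e i" "?R1 i \<alpha>" for i \<alpha>
  proof -
    from R1[OF e2(2)] obtain k where k: "\<alpha> = rt (Suc i) k" "\<alpha> + simple_root i = rt i k" "1 \<le> i" "i < k" "k \<le> n"
      by blast
    have "tev fin_lop z = 0" unfolding e2(1) k(2) unfolding ev k(1) adjacent_commute[OF k(3-5)] by simp
    moreover have "\<alpha> + simple_root i \<in> pos_roots n" unfolding k(2) using k by (intro pos) auto
    ultimately show ?thesis using e2 by (auto intro!: cl)
  qed
  have e3: ?thesis if e3: "z = ?q * (?E (\<alpha> + simple_root i) * ?E \<alpha>) - ?E \<alpha> * ?E (\<alpha> + simple_root i)" "?R1 i \<alpha>" for i \<alpha>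
  proof -
    from R1[OF e3(2)] obtain k where k: "\<alpha> = rt (Suc i) k" "\<alpha> + simple_root i = rt i k" "1 \<le> i" "i < k" "k \<le> n"
      by blast
    have "tev fin_lop z = 0" unfolding e3(1) k(2) unfolding ev k(1) adjacent_commute[OF k(3-5)] by simp
    moreover have "\<alpha> + simple_root i \<in> pos_roots n" unfolding k(2) using k by (intro pos) auto
    ultimately show ?thesis using e3 by (auto intro!: cl)
  qed
  have f1: ?thesis if f1: "z = ?F (\<alpha> + simple_root i) - (?q * (?F \<alpha> * ?f i) - ?f i * ?F \<alpha>)" "?R1 i \<alpha>" for i \<alpha>
  proof -
    from R1[OF f1(2)] obtain k where k: "\<alpha> = rt (Suc i) k" "\<alpha> + simple_root i = rt i k" "1 \<le> i" "i < k" "k \<le> n"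
      by blast
    have "tev fin_lop z = 0" unfolding f1(1) k(2) unfolding ev k(1) root_F_step[OF k(4)] by simp
    moreover have "\<alpha> + simple_root i \<in> pos_roots n" unfolding k(2) using k by (intro pos) auto
    ultimately show ?thesis using f1 by (auto intro!: cl)
  qed
  have f2: ?thesis if f2: "z = ?q * (?f i * ?F (\<alpha> + simple_root i)) - ?F (\<alpha> + simple_root i) * ?f i" "?R1 i \<alpha>" for i \<alpha>
  proof -
    from R1[OF f2(2)] obtain k where k: "\<alpha> = rt (Suc i) k" "\<alpha> + simple_root i = rt i k" "1 \<le> i" "i < k" "k \<le> n"
      by blast
    have "tev fin_lop z = 0" unfolding f2(1) k(2) unfolding ev k(1) adjacent_commute[OF k(3-5)] by simp
    moreover have "\<alpha> + simple_root i \<in> pos_roots n" unfolding k(2) using k by (intro pos) auto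
    ultimately show ?thesis using f2 by (auto intro!: cl)
  qed
  have f3: ?thesis if f3: "z = ?q * (?F (\<alpha> + simple_root i) * ?F \<alpha>) - ?F \<alpha> * ?F (\<alpha> + simple_root i)" "?R1 i \<alpha>" for i \<alpha>
  proof -
    from R1[OF f3(2)] obtain k where k: "\<alpha> = rt (Suc i) k" "\<alpha> + simple_root i = rt i k" "1 \<le> i" "i < k" "k \<le> n"
      by blast
    have "tev fin_lop z = 0" unfolding f3(1) k(2) unfolding ev k(1) adjacent_commute[OF k(3-5)] by simp
    moreover have "\<alpha> + simple_root i \<in> pos_roots n" unfolding k(2) using k by (intro pos) auto
    ultimately show ?thesis using f3 by (auto intro!: cl)
  qed
  have el: ?thesis if el: "z = ?E \<alpha> ^ l" "\<alpha> \<in> pos_roots n" for \<alpha>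
  proof -
    obtain j k where jk: "\<alpha> = rt j k" "1 \<le> j" "j \<le> k" "k \<le> n" using el(2) unfolding pos_roots_rt by blast
    have "tev fin_lop z = 0" unfolding el(1) ev jk(1) by (rule root_power[OF jk(2-4)])
    then show ?thesis using el by (auto intro!: cl)
  qed
  have fl: ?thesis if fl: "z = ?F \<alpha> ^ l" "\<alpha> \<in> pos_roots n" for \<alpha>
  proof -
    obtain j k where jk: "\<alpha> = rt j k" "1 \<le> j" "j \<le> k" "k \<le> n" using fl(2) unfolding pos_roots_rt by blast
    have "tev fin_lop z = 0" unfolding fl(1) ev jk(1) by (rule root_power[OF jk(2-4)])
    then show ?thesis using fl by (auto intro!: cl)
  qed
  have t: ?thesis if t: "z = t_gen i ^ (2 * l) - 1" "i \<in> {1..n}" for i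
  proof -
    have "tev fin_lop z = 0" unfolding t(1) t_gen_def ev tl_power by simp
    then show ?thesis using t by (auto intro!: cl)
  qed
  from assms show ?thesis
    unfolding Ufin_rels_def Let_def
    apply (elim UnE)
    subgoal by (rule c)
    subgoal by (elim CollectE exE conjE, rule e0, assumption, simp)
    subgoal by (elim CollectE exE conjE, rule f0, assumption, simp)
    subgoal by (elim CollectE exE conjE, rule e1, assumption, simp)
    subgoal by (elim CollectE exE conjE, rule e2, assumption, simp)
    subgoal by (elim CollectE exE conjE, rule e3, assumption, simp)
    subgoal by (elim CollectE exE conjE, rule f1, assumption, simp)
    subgoal by (elim CollectE exE conjE, rule f2, assumption, simp)
    subgoal by (elim CollectE exE conjE, rule f3, assumption, simp)
    subgoal by (elim CollectE exE conjE, rule el, assumption, assumption)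
    subgoal by (elim CollectE exE conjE, rule fl, assumption, assumption)
    subgoal by (elim CollectE exE conjE, rule t, assumption, assumption)
    done
qed

end

section \<open>The action of the small quantum group\<close>

context cyclic_rep
begin

abbreviation "Ue i \<equiv> PhiU (U_cls n \<epsilon> (GE i))"

abbreviation "Uf i \<equiv> PhiU (U_cls n \<epsilon> (GF i))"

abbreviation "step_E i S \<equiv> inverse \<epsilon> \<odot>\<^bsub>EV\<^esub> (Ue i \<otimes>\<^bsub>EV\<^esub> S) \<ominus>\<^bsub>EV\<^esub> S \<otimes>\<^bsub>EV\<^esub> Ue i"

abbreviation "step_F i S \<equiv> \<epsilon> \<odot>\<^bsub>EV\<^esub> (S \<otimes>\<^bsub>EV\<^esub> Uf i) \<ominus>\<^bsub>EV\<^esub> Uf i \<otimes>\<^bsub>EV\<^esub> S"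

abbreviation "LM \<equiv> Lmod n l \<epsilon> r s a b"

lemma EndV_eq: "EV = End_alg (Vspace n l)"
  by (simp add: EndV_def)

lemma rt_pos: "\<lbrakk>1 \<le> j; j \<le> k; k \<le> n\<rbrakk> \<Longrightarrow> rt j k \<in> pos_roots n"
  unfolding pos_roots_rt by blast

lemma gen_mem: "i \<in> {1..n} \<Longrightarrow> GE i \<in> qgens n {1..n}" "i \<in> {1..n} \<Longrightarrow> GF i \<in> qgens n {1..n}"
  "i \<in> {1..n} \<Longrightarrow> GT i \<in> qgens n {1..n}" "i \<in> {1..n} \<Longrightarrow> GTinv i \<in> qgens n {1..n}"
  by (auto simp: qgens_def)

lemma PhiU_E: "i \<in> {1..n} \<Longrightarrow> rp (Ue i) (E.e i)"
  and PhiU_F: "i \<in> {1..n} \<Longrightarrow> rp (Uf i) (F.fl i)"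
  and PhiU_T: "i \<in> {1..n} \<Longrightarrow> rp (PhiU (U_cls n \<epsilon> (GT i))) (tl i)"
  and PhiU_Tinv: "i \<in> {1..n} \<Longrightarrow> rp (PhiU (U_cls n \<epsilon> (GTinv i))) (tl' i)"
  using PhiU_gen_reps[OF gen_mem(1)] PhiU_gen_reps[OF gen_mem(2)]
    PhiU_gen_reps[OF gen_mem(3)] PhiU_gen_reps[OF gen_mem(4)] by simp_all

lemma reps_root_E_step:
  assumes "1 \<le> i" "i < k" "k \<le> n" "rp S (root_E (rt (Suc i) k))"
  shows "rp (step_E i S)
    (root_E (rt i k))"
  unfolding root_E_step[OF assms(2)]
  by (intro reps_minus[OF l_pos] reps_smult[OF l_pos] reps_mult[OF l_pos] PhiU_E assms(4)) (use assms in auto)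

lemma reps_root_F_step:
  assumes "1 \<le> i" "i < k" "k \<le> n" "rp S (root_F (rt (Suc i) k))"
  shows "rp (step_F i S)
    (root_F (rt i k))"
  unfolding root_F_step[OF assms(2)]
  by (intro reps_minus[OF l_pos] reps_smult[OF l_pos] reps_mult[OF l_pos] PhiU_F assms(4)) (use assms in auto)

lemma root_reps_exist: "\<lbrakk>1 \<le> j; j + d \<le> n\<rbrakk> \<Longrightarrow>
  (\<exists>S. rp S (root_E (rt j (j + d)))) \<and> (\<exists>S. rp S (root_F (rt j (j + d))))"
proof (induction d arbitrary: j)
  case 0
  then have "rp (Ue j) (root_E (rt j (j + 0)))"
    "rp (Uf j) (root_F (rt j (j + 0)))"
    using PhiU_E[of j] PhiU_F[of j] by (simp_all add: rt_refl root_E_simple root_F_simple)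
  then show ?case by blast
next
  case (Suc d)
  then obtain S S' where "rp S (root_E (rt (Suc j) (Suc j + d)))" "rp S' (root_F (rt (Suc j) (Suc j + d)))"
    using Suc.IH[of "Suc j"] by auto
  then show ?case
    using reps_root_E_step[of j "Suc j + d" S] reps_root_F_step[of j "Suc j + d" S'] Suc.prems by auto
qed

text \<open>Equivalent to the recursion, by the two implications proved below. One direction shows
  that solutions exist, the other transfers the lattice relations to every solution.\<close>

definition root_reps :: "(root \<Rightarrow> endo) \<Rightarrow> (root \<Rightarrow> endo) \<Rightarrow> bool" where
  "root_reps E F \<longleftrightarrow> (\<forall>\<alpha>\<in>pos_roots n. rp (E \<alpha>) (root_E \<alpha>) \<and> rp (F \<alpha>) (root_F \<alpha>))"

lemma root_reps_ex: "\<exists>E F. root_reps E F"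
proof -
  have "\<exists>S S'. rp S (root_E \<alpha>) \<and> rp S' (root_F \<alpha>)" if \<alpha>: "\<alpha> \<in> pos_roots n" for \<alpha>
  proof -
    obtain j k where jk: "\<alpha> = rt j k" "1 \<le> j" "j \<le> k" "k \<le> n" using \<alpha> unfolding pos_roots_rt by blast
    then show ?thesis using root_reps_exist[of j "k - j"] by auto
  qed
  then show ?thesis unfolding root_reps_def by metis
qed

lemma root_cases:
  assumes "i \<in> {1..n}" "\<alpha> \<in> pos_roots n" "root_form n (simple_root i) \<alpha> = - 1" "i < top_index \<alpha>"
  obtains k where "\<alpha> = rt (Suc i) k" "\<alpha> + simple_root i = rt i k" "1 \<le> i" "i < k" "k \<le> n"
proof -
  obtain j k where jk: "\<alpha> = rt j k" "1 \<le> j" "j \<le> k" "k \<le> n" using assms(2) unfolding pos_roots_rt by blast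
  then have i: "i < k" using assms(4) by (simp add: top_index_rt)
  then have "j = Suc i" using root_form_minus_1[of i n j k] assms jk by blast
  then show thesis using that[of k] rt_add[of i k] jk i assms(1) by simp
qed

lemma root_reps_imp_rec: "root_reps E F \<Longrightarrow> recursive_root_actions n l \<epsilon> PhiU E F"
  unfolding recursive_root_actions_def Let_def
proof (intro conjI ballI impI)
  assume R: "root_reps E F"
  have RE: "rp (E \<alpha>) (root_E \<alpha>)" and RF: "rp (F \<alpha>) (root_F \<alpha>)" if "\<alpha> \<in> pos_roots n" for \<alpha>
    using R that by (simp_all add: root_reps_def)
  fix i assume i: "i \<in> {1..n}"
  show "E (simple_root i) = Ue i"
    using RE[OF simple_root_pos[OF i]] PhiU_E[OF i] unfolding root_E_simple by (rule reps_unique[OF l_pos])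
  show "F (simple_root i) = Uf i"
    using RF[OF simple_root_pos[OF i]] PhiU_F[OF i] unfolding root_F_simple by (rule reps_unique[OF l_pos])
  fix \<alpha> assume \<alpha>: "\<alpha> \<in> pos_roots n" "root_form n (simple_root i) \<alpha> = - 1 \<and> i < top_index \<alpha>"
  then obtain k where k: "\<alpha> = rt (Suc i) k" "\<alpha> + simple_root i = rt i k" "1 \<le> i" "i < k" "k \<le> n"
    using root_cases[OF i] by blast
  have pos: "rt i k \<in> pos_roots n" using k by (intro rt_pos) auto
  have RE': "rp (E \<alpha>) (root_E (rt (Suc i) k))" using RE[OF \<alpha>(1)] unfolding k(1) .
  have RF': "rp (F \<alpha>) (root_F (rt (Suc i) k))" using RF[OF \<alpha>(1)] unfolding k(1) .
  show "E (\<alpha> + simple_root i) = step_E i (E \<alpha>)"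
    unfolding k(2) by (rule reps_unique[OF l_pos RE[OF pos] reps_root_E_step[OF k(3-5) RE']])
  show "F (\<alpha> + simple_root i) = step_F i (F \<alpha>)"
    unfolding k(2) by (rule reps_unique[OF l_pos RF[OF pos] reps_root_F_step[OF k(3-5) RF']])
qed

context
  fixes E F
  assumes rec: "recursive_root_actions n l \<epsilon> PhiU E F"
begin

lemma rec_simple:
  assumes "i \<in> {1..n}"
  shows "E (simple_root i) = Ue i" "F (simple_root i) = Uf i"
  using rec assms unfolding recursive_root_actions_def Let_def by blast+

lemma rec_step:
  assumes "1 \<le> i" "i < k" "k \<le> n"
  shows "E (rt i k) = step_E i (E (rt (Suc i) k))"
    "F (rt i k) = step_F i (F (rt (Suc i) k))"
proof -
  have i: "i \<in> {1..n}" and pos: "rt (Suc i) k \<in> pos_roots n"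
    using assms by (auto intro: rt_pos)
  have "root_form n (simple_root i) (rt (Suc i) k) = - 1 \<and> i < top_index (rt (Suc i) k)"
    using assms i by (simp add: root_form_minus_1 top_index_rt)
  then have *: "E (rt (Suc i) k + simple_root i) = step_E i (E (rt (Suc i) k)) \<and>
    F (rt (Suc i) k + simple_root i) = step_F i (F (rt (Suc i) k))"
    using rec i pos unfolding recursive_root_actions_def Let_def by blast
  show "E (rt i k) = step_E i (E (rt (Suc i) k))"
    using conjunct1[OF *] unfolding rt_add[OF assms(2)] .
  show "F (rt i k) = step_F i (F (rt (Suc i) k))"
    using conjunct2[OF *] unfolding rt_add[OF assms(2)] .
qed

lemma rec_reps_rt: "\<lbrakk>1 \<le> j; j + d \<le> n\<rbrakk> \<Longrightarrow>
  rp (E (rt j (j + d))) (root_E (rt j (j + d))) \<and> rp (F (rt j (j + d))) (root_F (rt j (j + d)))"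
proof (induction d arbitrary: j)
  case 0
  then show ?case
    using PhiU_E[of j] PhiU_F[of j] rec_simple[of j] by (simp add: rt_refl root_E_simple root_F_simple)
next
  case (Suc d)
  have IH: "rp (E (rt (Suc j) (j + Suc d))) (root_E (rt (Suc j) (j + Suc d)))"
    "rp (F (rt (Suc j) (j + Suc d))) (root_F (rt (Suc j) (j + Suc d)))"
    using Suc.IH[of "Suc j"] Suc.prems by simp_all
  have j: "1 \<le> j" "j < j + Suc d" "j + Suc d \<le> n" using Suc.prems by auto
  show ?case
    unfolding rec_step[OF j]
    using reps_root_E_step[OF j IH(1)] reps_root_F_step[OF j IH(2)] by blast
qed

lemma rec_imp_root_reps: "root_reps E F"
  unfolding root_reps_def
proof
  fix \<alpha> assume "\<alpha> \<in> pos_roots n"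
  then obtain j k where jk: "\<alpha> = rt j k" "1 \<le> j" "j \<le> k" "k \<le> n" unfolding pos_roots_rt by blast
  then show "rp (E \<alpha>) (root_E \<alpha>) \<and> rp (F \<alpha>) (root_F \<alpha>)" using rec_reps_rt[of j "k - j"] by simp
qed

definition fin_gen :: "root qgen \<Rightarrow> endo" where
  "fin_gen x = (case x of GE \<alpha> \<Rightarrow> E \<alpha> | GF \<alpha> \<Rightarrow> F \<alpha> | GT i \<Rightarrow> PhiU (U_cls n \<epsilon> (GT i))
     | GTinv i \<Rightarrow> PhiU (U_cls n \<epsilon> (GTinv i)))"

lemma fin_gen_reps: "x \<in> qgens n (pos_roots n) \<Longrightarrow> rp (fin_gen x) (fin_lop x)"
  using rec_imp_root_reps PhiU_T PhiU_Tinv by (auto simp: qgens_def fin_gen_def root_reps_def)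

lemma Ufin_rels_carrier: "Ufin_rels n l \<epsilon> \<subseteq> carrier (free_alg (qgens n (pos_roots n)))"
  using Ufin_rels_hold by blast

lemma Ufin_structure_exists: "\<exists>\<rho>. Ufin_structure n l \<epsilon> PhiU E F \<rho>"
proof -
  define \<rho> where "\<rho> = induced EV fin_gen"
  have ind: "p \<in> carrier (free_alg (qgens n (pos_roots n))) \<Longrightarrow>
      rp (\<rho> (cls (qgens n (pos_roots n)) (Ufin_rels n l \<epsilon>) p)) (tev fin_lop p)" for p
    unfolding \<rho>_def
    by (rule induced_presented(1)[OF l_pos Ufin_rels_carrier fin_gen_reps conjunct2[OF Ufin_rels_hold]])
  have hom: "\<rho> \<in> alg_hom (Ufin n l \<epsilon>) EV"
    unfolding \<rho>_def Ufin_def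
    by (rule induced_presented(2)[OF l_pos Ufin_rels_carrier fin_gen_reps conjunct2[OF Ufin_rels_hold]])
  have gen: "\<rho> (Ufin_cls n l \<epsilon> x) = fin_gen x" if x: "x \<in> qgens n (pos_roots n)" for x
    using ind[OF free_closed(4)[OF x]] fin_gen_reps[OF x]
    unfolding tev_simps Ufin_cls_def by (rule reps_unique[OF l_pos])
  have "\<rho> (Ufin_cls n l \<epsilon> (GE \<alpha>)) = E \<alpha>" "\<rho> (Ufin_cls n l \<epsilon> (GF \<alpha>)) = F \<alpha>" if "\<alpha> \<in> pos_roots n" for \<alpha>
    using gen[of "GE \<alpha>"] gen[of "GF \<alpha>"] that by (simp_all add: qgens_def fin_gen_def)
  moreover have "\<rho> (Ufin_cls n l \<epsilon> (GT i)) = PhiU (U_cls n \<epsilon> (GT i))"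
    "\<rho> (Ufin_cls n l \<epsilon> (GTinv i)) = PhiU (U_cls n \<epsilon> (GTinv i))" if "i \<in> {1..n}" for i
    using gen[of "GT i"] gen[of "GTinv i"] that by (simp_all add: qgens_def fin_gen_def)
  ultimately show ?thesis using hom unfolding Ufin_structure_def by blast
qed

end

section \<open>Irreducibility\<close>

abbreviation "u0 \<equiv> u_vec (\<lambda>p\<in>positions n. 0)"

abbreviation "clsU \<equiv> cls (qgens n {1..n}) (U_rels n \<epsilon>)"

abbreviation "FU \<equiv> carrier (free_alg (qgens n {1..n}))"

lemma zero_idx: "(\<lambda>p\<in>positions n. 0) \<in> idx_set n l"
  using l_pos by (auto simp: idx_set_def)

lemma u0_mem: "u0 \<in> Vspace n l"
  by (rule u_vec_mem[OF zero_idx])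

lemma Lmod_eq: "LM = {PhiU (clsU p) u0 | p. p \<in> FU}"
  unfolding Lmod_def Ueps_def presented_carrier by blast

lemma PhiU_cls_ops:
  assumes p: "p \<in> FU" and q: "q \<in> FU" and v: "v \<in> Vspace n l"
  shows "PhiU (clsU (p + q)) v = PhiU (clsU p) v + PhiU (clsU q) v"
    "PhiU (clsU (p * q)) v = PhiU (clsU p) (PhiU (clsU q) v)"
    "PhiU (clsU (const_free c * p)) v = vscale c (PhiU (clsU p) v)"
    "PhiU (clsU 1) v = v"
proof -
  note R = PhiU_reps
  have "PhiU (clsU (p + q)) = PhiU (clsU p) \<oplus>\<^bsub>EV\<^esub> PhiU (clsU q)"
    using R[OF free_closed(5)[OF p q]] reps_add[OF l_pos R[OF p] R[OF q]]
    unfolding tev_add by (rule reps_unique[OF l_pos])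
  then show "PhiU (clsU (p + q)) v = PhiU (clsU p) v + PhiU (clsU q) v"
    unfolding EndV_eq by (simp only: End_apply[OF Vspace_subspace v])
  have "PhiU (clsU (p * q)) = PhiU (clsU p) \<otimes>\<^bsub>EV\<^esub> PhiU (clsU q)"
    using R[OF free_closed(6)[OF p q]] reps_mult[OF l_pos R[OF p] R[OF q]]
    unfolding tev_mult by (rule reps_unique[OF l_pos])
  then show "PhiU (clsU (p * q)) v = PhiU (clsU p) (PhiU (clsU q) v)"
    unfolding EndV_eq by (simp only: End_apply[OF Vspace_subspace v])
  have "PhiU (clsU (const_free c * p)) = c \<odot>\<^bsub>EV\<^esub> PhiU (clsU p)"
    using R[OF free_closed(6)[OF free_closed(3) p]] reps_smult[OF l_pos R[OF p]]
    unfolding tev_mult tev_simps by (rule reps_unique[OF l_pos])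
  then show "PhiU (clsU (const_free c * p)) v = vscale c (PhiU (clsU p) v)"
    unfolding EndV_eq by (simp only: End_apply[OF Vspace_subspace v])
  have "PhiU (clsU 1) = \<one>\<^bsub>EV\<^esub>"
    using R[OF free_closed(2)] reps_one[OF l_pos] unfolding tev_simps by (rule reps_unique[OF l_pos])
  then show "PhiU (clsU 1) v = v" unfolding EndV_eq by (simp only: End_apply[OF Vspace_subspace v])
qed

lemma PhiU_mem: "p \<in> FU \<Longrightarrow> v \<in> Vspace n l \<Longrightarrow> PhiU (clsU p) v \<in> Vspace n l"
  using reps_mem[OF l_pos PhiU_reps] by blast

lemma Lmod_subspace: "LM \<subseteq> Vspace n l" "is_subspace (LM)"
proof -
  show "LM \<subseteq> Vspace n l" unfolding Lmod_eq using PhiU_mem[OF _ u0_mem] by blast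
  have "0 = PhiU (clsU (const_free 0 * 1)) u0"
    using PhiU_cls_ops(3)[OF free_closed(2) free_closed(2) u0_mem, of 0] by (simp add: vscale_simps)
  then have "0 \<in> LM" unfolding Lmod_eq using free_closed(6)[OF free_closed(3) free_closed(2)] by blast
  moreover have "v + w \<in> LM" if vw: "v \<in> LM" "w \<in> LM" for v w
  proof -
    obtain p q where pq: "p \<in> FU" "q \<in> FU" "v = PhiU (clsU p) u0" "w = PhiU (clsU q) u0"
      using vw unfolding Lmod_eq by blast
    have "v + w = PhiU (clsU (p + q)) u0" unfolding pq(3,4) by (rule PhiU_cls_ops(1)[OF pq(1,2) u0_mem, symmetric])
    then show ?thesis unfolding Lmod_eq using free_closed(5)[OF pq(1,2)] by blast
  qed
  moreover have "vscale c v \<in> LM" if v: "v \<in> LM" for c v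
  proof -
    obtain p where p: "p \<in> FU" "v = PhiU (clsU p) u0" using v unfolding Lmod_eq by blast
    have "vscale c v = PhiU (clsU (const_free c * p)) u0"
      unfolding p(2) by (rule PhiU_cls_ops(3)[OF p(1) p(1) u0_mem, symmetric])
    then show ?thesis unfolding Lmod_eq using free_closed(6)[OF free_closed(3) p(1)] by blast
  qed
  ultimately show "is_subspace (LM)" unfolding is_subspace_def by blast
qed

lemma Lmod_closed:
  assumes "x \<in> qgens n {1..n}" "v \<in> LM"
  shows "PhiU (U_cls n \<epsilon> x) v \<in> LM"
proof -
  obtain p where p: "p \<in> FU" "v = PhiU (clsU p) u0" using assms(2) unfolding Lmod_eq by blast
  note g = free_closed(4)[OF assms(1)]
  have "PhiU (U_cls n \<epsilon> x) v = PhiU (clsU (gen_free x * p)) u0"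
    unfolding p(2) U_cls_def by (rule PhiU_cls_ops(2)[OF g p(1) u0_mem, symmetric])
  then show ?thesis unfolding Lmod_eq using free_closed(6)[OF g p(1)] by blast
qed

lemma u0_Lmod: "u0 \<in> LM"
  unfolding Lmod_eq using PhiU_cls_ops(4)[OF free_closed(2) free_closed(2) u0_mem] free_closed(2) by force

text \<open>Residues are represented below l, so an index tuple with all entries divisible by l is
  the zero tuple.\<close>

lemma singular_unique:
  assumes v: "v \<in> Vspace n l" and sing: "\<And>i. i \<in> {1..n} \<Longrightarrow> app (E.e i) (Th n l v) = (\<lambda>M. 0)"
  shows "v = vscale (v (\<lambda>p\<in>positions n. 0)) u0"
proof
  fix m
  show "v m = vscale (v (\<lambda>p\<in>positions n. 0)) u0 m"
  proof (cases "v m = 0")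
    case True
    then show ?thesis by (cases "m = (\<lambda>p\<in>positions n. 0)") (simp_all add: vscale_def u_vec_def)
  next
    case False
    then have m: "m \<in> idx_set n l" using v unfolding Vspace_def by blast
    then have "Th n l v (emb n m) \<noteq> 0" using False by (simp add: Th_def redn_emb)
    then have dvd: "int l dvd emb n m p" if "p \<in> positions n" for p
      using E.singular_support_0[OF sing] that by blast
    have "m = (\<lambda>p\<in>positions n. 0)"
    proof
      fix p
      show "m p = (\<lambda>p\<in>positions n. 0) p"
      proof (cases "p \<in> positions n")
        case True
        then have "l dvd m p" "m p < l" using dvd[OF True] m by (auto simp: emb_def idx_set_def)
        then show ?thesis using True by (auto dest: dvd_imp_le)
      next
        case False
        then show ?thesis using m by (cases p) (auto simp: idx_set_def PiE_iff extensional_def)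
      qed
    qed
    then show ?thesis by (simp add: vscale_def u_vec_def)
  qed
qed

lemma submodule_contains_u0:
  assumes S: "S \<subseteq> Vspace n l" "is_subspace S" "S \<noteq> {0}"
    and closed: "\<And>i v. \<lbrakk>i \<in> {1..n}; v \<in> S\<rbrakk> \<Longrightarrow> Ue i v \<in> S"
  shows "u0 \<in> S"
proof -
  have scale: "vscale c v \<in> S" if "v \<in> S" for c v using S(2) that unfolding is_subspace_def by blast
  have "0 \<in> S" using S(2) unfolding is_subspace_def by blast
  then obtain v where v: "v \<in> S" "v \<noteq> 0" using S(3) by blast
  have Th_0: "w = 0" if "w \<in> S" "Th n l w = (\<lambda>M. 0)" for w
    using that S(1) by (intro Th_inj[OF l_pos _ V_mem_simps(3)]) (auto simp: Th_def)
  have app_e: "app (E.e i) (Th n l w) = Th n l (Ue i w)"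
    if "i \<in> {1..n}" "w \<in> S" for i w
    using reps_apply[OF l_pos PhiU_E[OF that(1)]] that(2) S(1) by (metis subsetD)
  have "\<exists>g\<in>Th n l ` S. g \<noteq> (\<lambda>M. 0) \<and> (\<forall>i\<in>{1..n}. app (E.e i) g = (\<lambda>M. 0))"
  proof (rule E.singular_vector_exists)
    show "app (E.e i) g \<in> Th n l ` S" if g: "g \<in> Th n l ` S" and i: "i \<in> {1..n}" for g i
    proof -
      obtain w where w: "w \<in> S" "g = Th n l w" using g by blast
      show ?thesis unfolding w(2) app_e[OF i w(1)] using closed[OF i w(1)] by blast
    qed
    show "Th n l v \<in> Th n l ` S" using v(1) by blast
    show "Th n l v \<noteq> (\<lambda>M. 0)" using Th_0[OF v(1)] v(2) by blast
  qed
  then obtain w where w: "w \<in> S" "Th n l w \<noteq> (\<lambda>M. 0)" "\<forall>i\<in>{1..n}. app (E.e i) (Th n l w) = (\<lambda>M. 0)"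
    by blast
  define c where "c = w (\<lambda>p\<in>positions n. 0)"
  have "w \<in> Vspace n l" using w(1) S(1) by blast
  then have wc: "w = vscale c u0" unfolding c_def by (rule singular_unique) (use w(3) in blast)
  have "c \<noteq> 0"
  proof
    assume "c = 0"
    then have "w = 0" using wc by (simp add: vscale_simps)
    then show False using w(2) by (simp add: Th_def)
  qed
  then have "u0 = vscale (inverse c) w" unfolding wc by (simp add: vscale_simps)
  then show ?thesis using scale[OF w(1)] by metis
qed

text \<open>The elements \<open>e_i\<close>, \<open>f_i\<close>,
  \<open>t_i\<^sup>\<plusminus>\<^sup>1\<close> act alike for both algebras. Hence a submodule for
  the finite algebra is one for the non-restricted algebra, and once it contains \<open>u0\<close>
  it contains all of \<open>LM\<close>. Conversely, \<open>LM\<close> is stable under the composite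
  root vectors because the recursion expresses them through simple ones.\<close>

lemma Ufin_irreducible:
  assumes rec: "recursive_root_actions n l \<epsilon> PhiU E F" and \<rho>: "Ufin_structure n l \<epsilon> PhiU E F \<rho>"
  shows "rep_irreducible (Ufin n l \<epsilon>) (Vspace n l) \<rho> (LM)"
proof -
  let ?L = LM
  let ?G = "qgens n (pos_roots n)"
  have hom: "\<rho> \<in> alg_hom (presented ?G (Ufin_rels n l \<epsilon>)) (End_alg (Vspace n l))"
    using \<rho> unfolding Ufin_structure_def Ufin_def EndV_eq by blast
  have \<rho>E: "\<rho> (Ufin_cls n l \<epsilon> (GE \<alpha>)) = E \<alpha>" and \<rho>F: "\<rho> (Ufin_cls n l \<epsilon> (GF \<alpha>)) = F \<alpha>"
    if "\<alpha> \<in> pos_roots n" for \<alpha>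
    using \<rho> that unfolding Ufin_structure_def by blast+
  have \<rho>T: "\<rho> (Ufin_cls n l \<epsilon> (GT i)) = PhiU (U_cls n \<epsilon> (GT i))"
    and \<rho>T': "\<rho> (Ufin_cls n l \<epsilon> (GTinv i)) = PhiU (U_cls n \<epsilon> (GTinv i))" if "i \<in> {1..n}" for i
    using \<rho> that unfolding Ufin_structure_def by blast+
  have L_diff: "vscale c v - w \<in> ?L" if "v \<in> ?L" "w \<in> ?L" for c v w
  proof -
    have "vscale c v + vscale (- 1) w \<in> ?L" using that Lmod_subspace(2) unfolding is_subspace_def by blast
    moreover have "vscale c v + vscale (- 1) w = vscale c v - w" by (simp add: vscale_def fun_eq_iff)
    ultimately show ?thesis by metis
  qed
  have car: "PhiU (U_cls n \<epsilon> x) \<in> carrier EV" if "x \<in> qgens n {1..n}" for x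
    by (rule reps_carrier[OF l_pos PhiU_gen_reps[OF that]])
  have root_closed: "\<lbrakk>1 \<le> j; j + d \<le> n\<rbrakk> \<Longrightarrow> \<forall>v\<in>?L. E (rt j (j + d)) v \<in> ?L \<and> F (rt j (j + d)) v \<in> ?L" for j d
  proof (induction d arbitrary: j)
    case 0
    then have j: "j \<in> {1..n}" by simp
    show ?case
      using Lmod_closed[OF gen_mem(1)[OF j]] Lmod_closed[OF gen_mem(2)[OF j]]
      by (simp add: rt_refl rec_simple[OF rec j])
  next
    case (Suc d)
    have j: "1 \<le> j" "j < j + Suc d" "j + Suc d \<le> n" "j \<in> {1..n}" using Suc.prems by auto
    let ?e = "Ue j" and ?f = "Uf j"
    let ?E = "E (rt (Suc j) (j + Suc d))" and ?F = "F (rt (Suc j) (j + Suc d))"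
    have IH: "?E v \<in> ?L" "?F v \<in> ?L" if "v \<in> ?L" for v using Suc.IH[of "Suc j"] Suc.prems that by simp_all
    have ce: "?e v \<in> ?L" "?f v \<in> ?L" if "v \<in> ?L" for v
      using Lmod_closed[OF gen_mem(1)[OF j(4)] that] Lmod_closed[OF gen_mem(2)[OF j(4)] that] by auto
    have carE: "?E \<in> carrier EV" "?F \<in> carrier EV"
      using rec_reps_rt[OF rec, of "Suc j" d] Suc.prems reps_carrier[OF l_pos] by auto
    note cs = carE car[OF gen_mem(1)[OF j(4)]] car[OF gen_mem(2)[OF j(4)]]
    show ?case
    proof
      fix v assume v: "v \<in> ?L"
      then have vV: "v \<in> Vspace n l" using Lmod_subspace(1) by blast
      have "E (rt j (j + Suc d)) v = vscale (inverse \<epsilon>) (?e (?E v)) - ?E (?e v)"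
        unfolding rec_step(1)[OF rec j(1-3)] using cs unfolding EndV_eq
        by (subst End_a_minus[OF Vspace_subspace _ _ vV])
          (simp_all add: End_closed[OF Vspace_subspace] End_apply[OF Vspace_subspace vV])
      moreover have "F (rt j (j + Suc d)) v = vscale \<epsilon> (?F (?f v)) - ?f (?F v)"
        unfolding rec_step(2)[OF rec j(1-3)] using cs unfolding EndV_eq
        by (subst End_a_minus[OF Vspace_subspace _ _ vV])
          (simp_all add: End_closed[OF Vspace_subspace] End_apply[OF Vspace_subspace vV])
      ultimately show "E (rt j (j + Suc d)) v \<in> ?L \<and> F (rt j (j + Suc d)) v \<in> ?L"
        using L_diff IH ce v by simp
    qed
  qed
  have L_root: "E \<alpha> v \<in> ?L" "F \<alpha> v \<in> ?L" if \<alpha>: "\<alpha> \<in> pos_roots n" and v: "v \<in> ?L" for \<alpha> v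
  proof -
    obtain j k where jk: "\<alpha> = rt j k" "1 \<le> j" "j \<le> k" "k \<le> n" using \<alpha> unfolding pos_roots_rt by blast
    then show "E \<alpha> v \<in> ?L" "F \<alpha> v \<in> ?L" using root_closed[of j "k - j"] v by auto
  qed
  have L_gen: "\<rho> (cls ?G (Ufin_rels n l \<epsilon>) (gen_free x)) v \<in> ?L" if x: "x \<in> ?G" and v: "v \<in> ?L" for x v
  proof -
    have "\<rho> (Ufin_cls n l \<epsilon> x) v \<in> ?L"
      using x unfolding qgens_def
    proof (elim UnE imageE)
      fix \<alpha> assume "x = GE \<alpha>" "\<alpha> \<in> pos_roots n"
      then show ?thesis using L_root(1) v by (simp add: \<rho>E)
    next
      fix \<alpha> assume "x = GF \<alpha>" "\<alpha> \<in> pos_roots n"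
      then show ?thesis using L_root(2) v by (simp add: \<rho>F)
    next
      fix i assume i: "x = GT i" "i \<in> {1..n}"
      show ?thesis unfolding i(1) \<rho>T[OF i(2)] by (rule Lmod_closed[OF gen_mem(3)[OF i(2)] v])
    next
      fix i assume i: "x = GTinv i" "i \<in> {1..n}"
      show ?thesis unfolding i(1) \<rho>T'[OF i(2)] by (rule Lmod_closed[OF gen_mem(4)[OF i(2)] v])
    qed
    then show ?thesis by (simp add: Ufin_cls_def)
  qed
  have sub: "rep_submodule (Ufin n l \<epsilon>) (Vspace n l) \<rho> ?L"
    unfolding rep_submodule_def Ufin_def
    using presented_action_closed[OF Ufin_rels_carrier[OF rec] hom Vspace_subspace Lmod_subspace L_gen] Lmod_subspace
    by blast
  have nz: "?L \<noteq> {0}"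
  proof
    assume "?L = {0}"
    then have "u0 = 0" using u0_Lmod by blast
    then have "u0 (\<lambda>p\<in>positions n. 0) = 0" by simp
    then show False by (simp add: u_vec_def)
  qed
  have "S = ?L" if S: "rep_submodule (Ufin n l \<epsilon>) (Vspace n l) \<rho> S" "S \<subseteq> ?L" "S \<noteq> {0}" for S
  proof -
    have SV: "S \<subseteq> Vspace n l" "is_subspace S"
      and S_closed: "\<And>x v. \<lbrakk>x \<in> carrier (Ufin n l \<epsilon>); v \<in> S\<rbrakk> \<Longrightarrow> \<rho> x v \<in> S"
      using S(1) unfolding rep_submodule_def by blast+
    have cls_mem: "Ufin_cls n l \<epsilon> x \<in> carrier (Ufin n l \<epsilon>)" if "x \<in> ?G" for x
      unfolding Ufin_def Ufin_cls_def presented_carrier using free_closed(4)[OF that] by blast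
    have G: "GE (simple_root i) \<in> ?G" "GF (simple_root i) \<in> ?G" "GT i \<in> ?G" "GTinv i \<in> ?G" if "i \<in> {1..n}" for i
      using that simple_root_pos[OF that] by (auto simp: qgens_def)
    have S_e: "Ue i v \<in> S" and S_f: "Uf i v \<in> S"
      and S_t: "PhiU (U_cls n \<epsilon> (GT i)) v \<in> S" and S_t': "PhiU (U_cls n \<epsilon> (GTinv i)) v \<in> S"
      if i: "i \<in> {1..n}" and v: "v \<in> S" for i v
      using S_closed[OF cls_mem[OF G(1)[OF i]] v] S_closed[OF cls_mem[OF G(2)[OF i]] v]
        S_closed[OF cls_mem[OF G(3)[OF i]] v] S_closed[OF cls_mem[OF G(4)[OF i]] v]
      unfolding \<rho>E[OF simple_root_pos[OF i]] \<rho>F[OF simple_root_pos[OF i]] \<rho>T[OF i] \<rho>T'[OF i] rec_simple[OF rec i]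
      by blast+
    have u0: "u0 \<in> S" by (rule submodule_contains_u0[OF SV S(3) S_e])
    have gens: "PhiU (cls (qgens n {1..n}) (U_rels n \<epsilon>) (gen_free x)) v \<in> S"
      if x: "x \<in> qgens n {1..n}" and v: "v \<in> S" for x v
    proof -
      have "PhiU (U_cls n \<epsilon> x) v \<in> S"
        using x S_e[OF _ v] S_f[OF _ v] S_t[OF _ v] S_t'[OF _ v] by (auto simp: qgens_def)
      then show ?thesis by (simp add: U_cls_def)
    qed
    have "PhiU \<in> alg_hom (presented (qgens n {1..n}) (U_rels n \<epsilon>)) (End_alg (Vspace n l))"
      using PhiU_hom unfolding Ueps_def EndV_eq .
    from presented_action_closed[OF U_rels_carrier this Vspace_subspace SV gens _ u0]
    have "?L \<subseteq> S" unfolding Lmod_def Ueps_def by blast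
    then show ?thesis using S(2) by blast
  qed
  then show ?thesis unfolding rep_irreducible_def using sub nz by blast
qed

end

theorem theorem5p5:
  fixes n l :: nat and \<epsilon> :: complex and lam :: "nat \<Rightarrow> nat"
    and r s :: "nat \<Rightarrow> complex" and a b :: "nat \<Rightarrow> nat \<Rightarrow> complex"
  assumes "n \<ge> 1" and "l > 1" and "odd l"
    and "\<epsilon> ^ l = 1" and "\<forall>k. 0 < k \<and> k < l \<longrightarrow> \<epsilon> ^ k \<noteq> 1"
    and "\<forall>i\<in>{1..n}. lam i \<in> {0..l - 1}"
    and "\<forall>i\<in>{1..n}. r i \<noteq> 0 \<and> s i \<noteq> 0"
    and "\<forall>(j, k)\<in>positions n. a j k \<noteq> 0 \<and> b j k \<noteq> 0"
    and "\<forall>(i, k)\<in>positions n. (\<Prod>p\<in>{k..n}. a i p) = 1"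
    and "\<forall>(i, k)\<in>positions n.
           r i * b_ext n b i k * b_ext n b i (k - 1)
             * inverse (b_ext n b (i - 1) (k - 1)) * inverse (b_ext n b (i + 1) k) = 1"
    and "\<forall>i\<in>{1..n}.
           r i / s i * b_ext n b i n ^ 2
             * inverse (b_ext n b (i - 1) n) * inverse (b_ext n b (i + 1) n) = \<epsilon> ^ lam i"
  shows "let \<Phi> = Phi n l \<epsilon> r s a b in
           (\<exists>E F. recursive_root_actions n l \<epsilon> \<Phi> E F) \<and>
           (\<forall>E F. recursive_root_actions n l \<epsilon> \<Phi> E F \<longrightarrow>
              (\<exists>\<rho>. Ufin_structure n l \<epsilon> \<Phi> E F \<rho>) \<and>
              (\<forall>\<rho>. Ufin_structure n l \<epsilon> \<Phi> E F \<rho> \<longrightarrow>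
                 rep_irreducible (Ufin n l \<epsilon>) (Vspace n l) \<rho> (Lmod n l \<epsilon> r s a b)))"
proof -
  interpret cyclic_rep \<epsilon> l n lam r s a b
    by unfold_locales (fact assms)+
  have "\<exists>E F. recursive_root_actions n l \<epsilon> PhiU E F"
    using root_reps_ex root_reps_imp_rec by blast
  then show ?thesis
    unfolding Let_def using Ufin_structure_exists Ufin_irreducible by blast
qed

end
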